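(* Let $(T,\Sigma,\mu)$ be a complete $\sigma$-finite measure space, let $Z,Y$ be separable reflexive Banach spaces, let $1\le p,r<\infty$, and let $F:T\times Z\rightrightarrows Y$ be a multifunction such that $t\mapsto\operatorname{Gr}F(t,\cdot)$ is measurable with nonempty closed values. Let $N_F:L^p(T,Z)\rightrightarrows L^r(T,Y)$ be the multivalued Nemytskii operator $$N_F(x):=\{v\in L^r(T,Y): v(t)\in F(t,x(t))\text{ a.e.}\}.$$ Then $\operatorname{Gr}N_F=\mathsf{Sel}_{p,r}(t\mapsto\operatorname{Gr}F(t,\cdot))$, and for every $(x,y)\in\operatorname{Gr}N_F$: (a) $\widehat{\mathbf T}_{\operatorname{Gr}N_F}(x,y)=\mathsf{Sel}_{p,r}\big(t\mapsto\widehat{\mathbf T}_{\operatorname{Gr}F(t,\cdot)}(x(t),y(t))\big)$; (b) $\widehat{\mathbf N}_{\operatorname{Gr}N_F}(x,y)=\mathsf{Sel}_{q,s}\big(t\mapsto\widehat{\mathbf N}_{\operatorname{Gr}F(t,\cdot)}(x(t),y(t))\big)$, where $q,s$ are the conjugate exponents of $p,r$ respectively.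
   Context: $L^p(T,Z)$, $L^r(T,Y)$ are Lebesgue--Bochner spaces; products carry the sum norm. The conjugate exponent of $p$ is $\infty$ if $p=1$ and $q$ with $1/p+1/q=1$ otherwise. Since $Z,Y$ are reflexive, the dual of $L^p(T,Z)\times L^r(T,Y)$ is identified with $L^q(T,Z^* )\times L^s(T,Y^* )$ via the integral pairing. $\operatorname{Gr}F(t,\cdot)=\{(a,b)\in Z\times Y:b\in F(t,a)\}$ and $\operatorname{Gr}N_F=\{(a,b)\in L^p(T,Z)\times L^r(T,Y): b\in N_F(a)\}$. A multifunction $G$ with nonempty closed values in a separable Banach space $W$ is measurable if $\{t:G(t)\cap U\neq\emptyset\}\in\Sigma$ for every open $U\subset W$. For a multifunction $S:T\rightrightarrows Z\times Y$, $\mathsf{Sel}_{p,r}(S):=\{(a,b)\in L^p(T,Z)\times L^r(T,Y):(a(t),b(t))\in S(t)\text{ a.e.}\}$; for a multifunction $G:T\rightrightarrows Z^*\times Y^*$, $\mathsf{Sel}_{q,s}(G):=\{(\xi,\zeta)\in L^q(T,Z^* )\times L^s(T,Y^* ):(\xi(t),\zeta(t))\in G(t)\text{ a.e.}\}$. Clarke tangent cone: for a Banach space $X$ with closed unit ball $\overline{\mathbf B}_X$, $C\subset X$ closed and $x\in C$, $\widehat{\mathbf T}_C(x)$ is the set of all $v\in X$ such that for every $\varepsilon>0$ there exist $\delta>0$, $\lambda>0$ such that $C\cap[y+\eta(v+\varepsilon\overline{\mathbf B}_X)]\ne\emptyset$ for every $y\in C\cap(x+\delta\overline{\mathbf B}_X)$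 and every $\eta\in[0,\lambda]$. Clarke normal cone: $\widehat{\mathbf N}_C(x):=\{\xi\in X^*:\langle\xi,v\rangle\le0\ \forall v\in\widehat{\mathbf T}_C(x)\}$. *)

theory Defs
  imports "HOL-Analysis.Analysis"
begin

section \<open>Normed spaces with explicit carrier\<close>

text \<open>
  The space \<open>L\<^sup>p(T,Z)\<close> depends on a measure and an exponent, hence cannot be a type.  The Clarke
  cones are therefore defined for a space given by its carrier and operations, and this one
  definition is used both for \<open>Z \<times> Y\<close> and for \<open>L\<^sup>p(T,Z) \<times> L\<^sup>r(T,Y)\<close>.
\<close>

record 'x nspace =
  points :: "'x set"
  plus_of :: "'x \<Rightarrow> 'x \<Rightarrow> 'x"
  scale_of :: "real \<Rightarrow> 'x \<Rightarrow> 'x"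
  norm_of :: "'x \<Rightarrow> real"

definition type_nspace :: "'a::real_normed_vector nspace" where
  "type_nspace = \<lparr> points = UNIV, plus_of = (+), scale_of = (*\<^sub>R), norm_of = norm \<rparr>"

text \<open>Products carry the sum norm (the library norm on the product type is the Euclidean one).\<close>

definition prod_nspace :: "'a nspace \<Rightarrow> 'b nspace \<Rightarrow> ('a \<times> 'b) nspace" where
  "prod_nspace X Y =
     \<lparr> points = points X \<times> points Y,
       plus_of = (\<lambda>(a, b) (a', b'). (plus_of X a a', plus_of Y b b')),
       scale_of = (\<lambda>c (a, b). (scale_of X c a, scale_of Y c b)),
       norm_of = (\<lambda>(a, b). norm_of X a + norm_of Y b) \<rparr>"

definition closed_unit_ball :: "'x nspace \<Rightarrow> 'x set" where
  "closed_unit_ball X = {b \<in> points X. norm_of X b \<le> 1}"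

text \<open>Bounded linear functionals; extensionality makes a functional determined by its values on the
  carrier.\<close>

definition dual_of :: "'x nspace \<Rightarrow> ('x \<Rightarrow> real) set" where
  "dual_of X = {\<phi> \<in> extensional (points X).
     (\<forall>u\<in>points X. \<forall>v\<in>points X. \<phi> (plus_of X u v) = \<phi> u + \<phi> v) \<and>
     (\<forall>c. \<forall>u\<in>points X. \<phi> (scale_of X c u) = c * \<phi> u) \<and>
     (\<exists>K. \<forall>u\<in>points X. \<bar>\<phi> u\<bar> \<le> K * norm_of X u)}"


section \<open>Clarke tangent and normal cones\<close>

definition clarke_tangent_cone :: "'x nspace \<Rightarrow> 'x set \<Rightarrow> 'x \<Rightarrow> 'x set" where
  "clarke_tangent_cone X C x = {v \<in> points X.
     \<forall>\<epsilon>>0. \<exists>\<delta>>0. \<exists>\<kappa>>0.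
       \<forall>y \<in> C \<inter> {plus_of X x (scale_of X \<delta> b) | b. b \<in> closed_unit_ball X}. \<forall>\<eta>\<in>{0..\<kappa>}.
         C \<inter> {plus_of X y (scale_of X \<eta> (plus_of X v (scale_of X \<epsilon> b))) | b. b \<in> closed_unit_ball X}
           \<noteq> {}}"

definition clarke_normal_cone :: "'x nspace \<Rightarrow> 'x set \<Rightarrow> 'x \<Rightarrow> ('x \<Rightarrow> real) set" where
  "clarke_normal_cone X C x = {\<xi> \<in> dual_of X. \<forall>v\<in>clarke_tangent_cone X C x. \<xi> v \<le> 0}"


section \<open>Reflexivity\<close>

definition bidual_embedding ::
    "'a::real_normed_vector \<Rightarrow> ('a \<Rightarrow>\<^sub>L real) \<Rightarrow>\<^sub>L real" where
  "bidual_embedding z = Blinfun (\<lambda>f. blinfun_apply f z)"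

lemma bidual_embedding_apply [simp]:
  "blinfun_apply (bidual_embedding z) f = blinfun_apply f z"
  unfolding bidual_embedding_def
  by (simp add: bounded_linear_Blinfun_apply blinfun.bounded_linear_left)

definition reflexive :: "'a::real_normed_vector itself \<Rightarrow> bool" where
  "reflexive _ \<longleftrightarrow> surj (bidual_embedding :: 'a \<Rightarrow> ('a \<Rightarrow>\<^sub>L real) \<Rightarrow>\<^sub>L real)"


section \<open>Lebesgue-Bochner spaces\<close>

text \<open>
  Elements are represented by functions, not by classes modulo equality almost everywhere; the norm
  below is then a seminorm.  All sets of functions considered here are saturated under equality
  almost everywhere, so their equality is the same as equality of the sets of classes.
  Borel measurability is strong (Bochner) measurability when the target space is separable; this
  covers \<open>Z\<close> and \<open>Y\<close>, and also their duals, since the dual of a separable reflexive space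
  is separable.
\<close>

definition Lp :: "'t measure \<Rightarrow> ennreal \<Rightarrow> ('t \<Rightarrow> 'a::real_normed_vector) set" where
  "Lp M p = {f \<in> borel_measurable M.
     if p = \<infinity> then \<exists>K. AE t in M. norm (f t) \<le> K
     else integrable M (\<lambda>t. norm (f t) powr enn2real p)}"

definition Lp_nspace :: "'t measure \<Rightarrow> real \<Rightarrow> ('t \<Rightarrow> 'a::real_normed_vector) nspace" where
  "Lp_nspace M p =
     \<lparr> points = Lp M (ennreal p),
       plus_of = (\<lambda>f g t. f t + g t),
       scale_of = (\<lambda>c f t. c *\<^sub>R f t),
       norm_of = (\<lambda>f. (\<integral>t. norm (f t) powr p \<partial>M) powr (1 / p)) \<rparr>"

definition conjugate_exponent :: "real \<Rightarrow> ennreal" where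
  "conjugate_exponent p = (if p = 1 then \<infinity> else ennreal (p / (p - 1)))"

lemma conjugate_exponent_sum:
  assumes "1 < p"
  shows "1 / p + 1 / enn2real (conjugate_exponent p) = 1"
  using assms by (simp add: conjugate_exponent_def field_simps)

definition Sel :: "'t measure \<Rightarrow> ennreal \<Rightarrow> ennreal \<Rightarrow>
    ('t \<Rightarrow> ('a::real_normed_vector \<times> 'b::real_normed_vector) set) \<Rightarrow>
    (('t \<Rightarrow> 'a) \<times> ('t \<Rightarrow> 'b)) set" where
  "Sel M p r S = {(a, b). a \<in> Lp M p \<and> b \<in> Lp M r \<and> (AE t in M. (a t, b t) \<in> S t)}"


section \<open>Identification of duals\<close>

definition pair_functional ::
    "('a::real_normed_vector \<Rightarrow>\<^sub>L real) \<times> ('b::real_normed_vector \<Rightarrow>\<^sub>L real) \<Rightarrow> 'a \<times> 'b \<Rightarrow> real" where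
  "pair_functional = (\<lambda>(\<xi>, \<zeta>) (a, b). blinfun_apply \<xi> a + blinfun_apply \<zeta> b)"

definition integral_functional :: "'t measure \<Rightarrow> real \<Rightarrow> real \<Rightarrow>
    ('t \<Rightarrow> 'a::real_normed_vector \<Rightarrow>\<^sub>L real) \<times> ('t \<Rightarrow> 'b::real_normed_vector \<Rightarrow>\<^sub>L real) \<Rightarrow>
    ('t \<Rightarrow> 'a) \<times> ('t \<Rightarrow> 'b) \<Rightarrow> real" where
  "integral_functional M p r = (\<lambda>(\<xi>, \<zeta>).
     restrict (\<lambda>(a, b). (\<integral>t. blinfun_apply (\<xi> t) (a t) \<partial>M) + (\<integral>t. blinfun_apply (\<zeta> t) (b t) \<partial>M))
       (Lp M (ennreal p) \<times> Lp M (ennreal r)))"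

text \<open>The normal cone to a subset of \<open>Z \<times> Y\<close> as a subset of \<open>Z\<^sup>* \<times> Y\<^sup>*\<close>.\<close>

definition clarke_normal_pairs ::
    "('a::real_normed_vector \<times> 'b::real_normed_vector) set \<Rightarrow> 'a \<times> 'b \<Rightarrow>
     (('a \<Rightarrow>\<^sub>L real) \<times> ('b \<Rightarrow>\<^sub>L real)) set" where
  "clarke_normal_pairs C w =
     {(\<xi>, \<zeta>). pair_functional (\<xi>, \<zeta>) \<in> clarke_normal_cone (prod_nspace type_nspace type_nspace) C w}"


section \<open>Multifunctions and the Nemytskii operator\<close>

definition measurable_closed_multifunction ::
    "'t measure \<Rightarrow> ('t \<Rightarrow> 'w::topological_space set) \<Rightarrow> bool" where
  "measurable_closed_multifunction M G \<longleftrightarrow>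
     (\<forall>t\<in>space M. G t \<noteq> {} \<and> closed (G t)) \<and>
     (\<forall>U. open U \<longrightarrow> {t \<in> space M. G t \<inter> U \<noteq> {}} \<in> sets M)"

definition Gr :: "('a \<Rightarrow> 'b set) \<Rightarrow> ('a \<times> 'b) set" where
  "Gr G = {(a, b). b \<in> G a}"

definition nemytskii :: "'t measure \<Rightarrow> real \<Rightarrow> ('t \<Rightarrow> 'a \<Rightarrow> 'b::real_normed_vector set) \<Rightarrow>
    ('t \<Rightarrow> 'a) \<Rightarrow> ('t \<Rightarrow> 'b) set" where
  "nemytskii M r F x = {v \<in> Lp M (ennreal r). AE t in M. v t \<in> F t (x t)}"

definition Gr_nemytskii :: "'t measure \<Rightarrow> real \<Rightarrow> real \<Rightarrow>
    ('t \<Rightarrow> 'a::real_normed_vector \<Rightarrow> 'b::real_normed_vector set) \<Rightarrow>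
    (('t \<Rightarrow> 'a) \<times> ('t \<Rightarrow> 'b)) set" where
  "Gr_nemytskii M p r F = {(a, b) \<in> Lp M (ennreal p) \<times> Lp M (ennreal r). b \<in> nemytskii M r F a}"

end

(*
  Write C(t) for the graph of F(t, .).  A vector v fails to be tangent at (t, x(t)) at tolerance a
  and step h only if it fails, near x(t), at every smaller step too (iterate the small step).  Hence
  the step at which v(t) fails can be chosen independently of t on a large part of any set of
  positive measure, and measurable selections of C turn pointwise failure into failure in L^p; this
  gives one inclusion between the tangent cones.  Conversely, given pointwise tangency, uniformity
  in t holds outside a set on which v is small in norm, and there one does not move at all.
  For the normal cones, a functional on L^p(Z) x L^r(Y) is a pair of densities (xi, zeta) with values
  in the duals.  If <xi(t), v1> + <zeta(t), v2> > 0 were possible for tangent (v1, v2) on a non-null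
  set of t, an almost everywhere measurable selection of such vectors would be a tangent vector on
  which the functional is positive.  That selection theorem uses measurable envelopes of the
  (possibly non-measurable) sets of t for which a partial coding of a solution can be completed.
*)

theory Submission
  imports Defs
begin

section \<open>Measurable selections\<close>

text \<open>Tangency of \<open>w\<close> at \<open>x t\<close> says that for every tolerance some
  scale satisfies countably many distance inequalities, each measurable in \<open>t\<close> and
  Lipschitz in \<open>w\<close>. Once a scale is fixed for each tolerance these conditions are
  closed in \<open>w\<close>, which is why the selection theorem is stated for formulas
  \<open>\<forall>j. \<exists>k. \<forall>l. g j k l t w \<le> 0\<close>. A dense sequence of
  measurable selections is built for \<open>C\<close> only: the tangent cones are not shown to be a
  measurable multifunction.

  A second obstacle is that the measure may be infinite and that two exponents act at once, so that
  perturbations of constant size need not be integrable. Pointwise tolerances are therefore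
  multiples of a positive function \<open>e\<close> whose powers \<open>e t powr p\<close> and
  \<open>e t powr r\<close> lie below one integrable \<open>h\<close>, and sets of \<open>t\<close>
  are weighed by the integral of \<open>h\<close>. For the dual the same device, a positive weight
  with integrable \<open>p\<close>-th power, makes the variation of the vector measure attached to a
  functional finite.\<close>

lemma (in sigma_finite_measure) ex_measurable_envelope:
  assumes "A \<subseteq> space M"
  shows "\<exists>E. measurable_envelope M A E"
proof -
  obtain C :: "nat \<Rightarrow> 'a set" where C: "range C \<subseteq> sets M" "(\<Union>i. C i) = space M"
      "\<And>i. emeasure M (C i) \<noteq> \<infinity>"
    using sigma_finite by metis
  then show ?thesis
    using measurable_envelopeI_countable_cover[of A C M] assms by (auto simp: top.not_eq_extremum)
qed

lemma ex_dense_sequence: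
  obtains d :: "nat \<Rightarrow> 'w::{metric_space, second_countable_topology}"
  where "\<And>w e. e > 0 \<Longrightarrow> \<exists>n. dist w (d n) < e"
proof -
  obtain D :: "'w set" where D: "countable D" "\<And>X. open X \<Longrightarrow> X \<noteq> {} \<Longrightarrow> \<exists>d \<in> D. d \<in> X"
    by (erule countable_dense_setE)
  have "D \<noteq> {}"
    using D(2)[of UNIV] by auto
  show ?thesis
  proof
    fix w :: 'w and e :: real assume "e > 0"
    then obtain x where "x \<in> D" "x \<in> ball w e"
      using D(2)[of "ball w e"] by auto
    then show "\<exists>n. dist w (from_nat_into D n) < e"
      using from_nat_into_surj[OF D(1), of x] by (auto simp: dist_commute)
  qed
qed

lemma borel_measurable_fst:
  fixes f :: "'t \<Rightarrow> 'a::topological_space \<times> 'b::topological_space"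
  shows "f \<in> borel_measurable M \<Longrightarrow> (\<lambda>t. fst (f t)) \<in> borel_measurable M"
  by (erule measurable_compose) (intro borel_measurable_continuous_onI continuous_intros)

lemma borel_measurable_snd:
  fixes f :: "'t \<Rightarrow> 'a::topological_space \<times> 'b::topological_space"
  shows "f \<in> borel_measurable M \<Longrightarrow> (\<lambda>t. snd (f t)) \<in> borel_measurable M"
  by (erule measurable_compose) (intro borel_measurable_continuous_onI continuous_intros)

lemma norm_fst_le_norm: "norm (fst w) \<le> norm w"
  and norm_snd_le_norm: "norm (snd w) \<le> norm w"
  using norm_fst_le[of "fst w" "snd w"] norm_snd_le[of "snd w" "fst w"] by simp_all

text \<open>A solution is approached along an infinite branch of a tree of finite codes. Since
  \<open>g\<close> is Lipschitz in \<open>w\<close>, inequalities that hold up to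
  \<open>(1/2)^i\<close> at the \<open>i\<close>-th approximation hold exactly in the limit,
  provided that the witnesses \<open>k\<close> are coded along with the points. Existence of a
  solution is not assumed to be a measurable property of \<open>t\<close>; the price is an
  exceptional null set.\<close>

theorem (in sigma_finite_measure) AE_measurable_selection:
  fixes g :: "nat \<Rightarrow> nat \<Rightarrow> 'l::countable \<Rightarrow> 'a \<Rightarrow> 'w::{complete_space, second_countable_topology} \<Rightarrow> real"
  assumes meas[measurable]: "\<And>j k l w. (\<lambda>t. g j k l t w) \<in> borel_measurable M"
    and lip: "\<And>j k l t w w'. t \<in> space M \<Longrightarrow> g j k l t w \<le> g j k l t w' + dist w w'"
  obtains v where "v \<in> borel_measurable M"
    "AE t in M. (\<exists>w. \<forall>j. \<exists>k. \<forall>l. g j k l t w \<le> 0) \<longrightarrow> (\<forall>j. \<exists>k. \<forall>l. g j k l t (v t) \<le> 0)"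
proof -
  obtain d :: "nat \<Rightarrow> 'w" where d: "\<And>w e. e > 0 \<Longrightarrow> \<exists>n. dist w (d n) < e"
    by (erule ex_dense_sequence)
  \<comment> \<open>Entry \<open>i\<close> of a list \<open>s\<close> codes a point \<open>c s i\<close> of the dense sequence within \<open>(1/2)^i\<close> of a
    solution \<open>w\<close>, and the witness \<open>\<kappa> s i\<close> for \<open>k\<close> at \<open>j = i\<close>.  The sets \<open>S s\<close> need not be measurable;
    the measurable relaxation \<open>A s\<close> still forces a solution along an infinite branch.\<close>
  define c where "c s i = d (fst (prod_decode (s ! i)))" for s :: "nat list" and i
  define \<kappa> where "\<kappa> s i = snd (prod_decode (s ! i))" for s :: "nat list" and i
  define S where "S s = {t \<in> space M. \<exists>w. (\<forall>j. \<exists>k. \<forall>l. g j k l t w \<le> 0) \<and>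
      (\<forall>i<length s. dist w (c s i) \<le> (1/2)^i \<and> (\<forall>l. g i (\<kappa> s i) l t w \<le> 0))}" for s
  define A where "A s = {t \<in> space M.
      (\<forall>i<length s. \<forall>j<length s. dist (c s i) (c s j) \<le> (1/2)^i + (1/2)^j) \<and>
      (\<forall>j<length s. \<forall>i<length s. \<forall>l. g j (\<kappa> s j) l t (c s i) \<le> (1/2)^i)}" for s
  have A_sets[measurable]: "A s \<in> sets M" for s
    unfolding A_def by measurable
  have SA: "S s \<subseteq> A s" for s
  proof
    fix t assume "t \<in> S s"
    then obtain w where t: "t \<in> space M" and w: "\<And>i. i < length s \<Longrightarrow> dist w (c s i) \<le> (1/2)^i"
      "\<And>i l. i < length s \<Longrightarrow> g i (\<kappa> s i) l t w \<le> 0"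
      unfolding S_def by blast
    have "dist (c s i) (c s j) \<le> (1/2)^i + (1/2)^j" if "i < length s" "j < length s" for i j
      using w(1)[OF that(1)] w(1)[OF that(2)] dist_triangle3[of "c s i" "c s j" w] by simp
    moreover have "g j (\<kappa> s j) l t (c s i) \<le> (1/2)^i" if "i < length s" "j < length s" for i j l
      using w(1)[OF that(1)] w(2)[OF that(2), of l] lip[OF t, of j "\<kappa> s j" l "c s i" w]
      by (simp add: dist_commute)
    ultimately show "t \<in> A s"
      using t by (simp add: A_def)
  qed
  have "\<exists>E. measurable_envelope M (S s) E" for s
    by (rule ex_measurable_envelope) (auto simp: S_def)
  then obtain E where E: "\<And>s. measurable_envelope M (S s) (E s)"
    by metis
  define H where "H s = E s \<inter> A s" for s
  have H_sets[measurable]: "H s \<in> sets M" for s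
    unfolding H_def using measurable_envelopeD(2)[OF E] by auto
  have SH: "S s \<subseteq> H s" for s
    unfolding H_def using measurable_envelopeD(1)[OF E] SA by auto
  have SU: "S s \<subseteq> (\<Union>n. S (s @ [n]))" for s
  proof
    fix t assume "t \<in> S s"
    then obtain w where t: "t \<in> space M" and w0: "\<forall>j. \<exists>k. \<forall>l. g j k l t w \<le> 0"
      and w: "\<forall>i<length s. dist w (c s i) \<le> (1/2)^i \<and> (\<forall>l. g i (\<kappa> s i) l t w \<le> 0)"
      unfolding S_def by blast
    obtain k where k: "\<forall>l. g (length s) k l t w \<le> 0"
      using w0 by blast
    obtain m where m: "dist w (d m) < (1/2)^length s"
      using d[of "(1/2)^length s" w] by auto
    have "t \<in> S (s @ [prod_encode (m, k)])"
      using t w0 w k m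
      by (auto simp: S_def c_def \<kappa>_def nth_append less_Suc_eq intro!: exI[of _ w])
    then show "t \<in> (\<Union>n. S (s @ [n]))"
      by blast
  qed
  \<comment> \<open>\<open>N\<close> contains the points at which a branch cannot be continued. A
    point of \<open>S s\<close> lies in some \<open>S (s @ [n])\<close>, so the part of
    \<open>H s\<close> missed by all \<open>H (s @ [n])\<close> lies in \<open>E s - S s\<close>,
    and measurable subsets of that set are null. There are only countably many lists.\<close>
  define N where "N = (\<Union>s. H s - (\<Union>n. H (s @ [n])))"
  have "H s - (\<Union>n. H (s @ [n])) \<in> null_sets M" for s
  proof -
    have "H s - (\<Union>n. H (s @ [n])) \<subseteq> E s - S s"
      using SU[of s] SH by (fastforce simp: H_def)
    then show ?thesis
      using measurable_envelopeD1[OF E[of s], of "H s - (\<Union>n. H (s @ [n]))"] by auto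
  qed
  then have N: "N \<in> null_sets M"
    unfolding N_def by (intro null_sets_UN')  auto
  then have [measurable]: "N \<in> sets M"
    by auto
  define G where "G = H [] - N"
  have [measurable]: "G \<in> sets M"
    unfolding G_def by measurable
  \<comment> \<open>Taking the least admissible entry makes the branch measurable: for a fixed list
    this index is measurable in \<open>t\<close>, and \<open>path t m\<close> has countably many
    values.\<close>
  define step where "step t s = s @ [LEAST n. t \<in> H (s @ [n])]" for t s
  define path where "path t m = (step t ^^ m) []" for t m
  have path_simps: "path t 0 = []" "path t (Suc m) = path t m @ [LEAST n. t \<in> H (path t m @ [n])]" for t m
    by (auto simp: path_def step_def)
  have len[simp]: "length (path t m) = m" for t m
    by (induction m) (auto simp: path_simps)
  have path_nth: "path t m ! i = path t (Suc i) ! i" if "i < m" for t m i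
    using that
  proof (induction m)
    case (Suc m)
    then show ?case
      by (cases "i = m") (auto simp: path_simps(2) nth_append)
  qed simp
  have path_H: "t \<in> H (path t m)" if "t \<in> G" for t m
  proof (induction m)
    case 0
    then show ?case using that by (simp add: path_simps G_def)
  next
    case (Suc m)
    have "\<exists>n. t \<in> H (path t m @ [n])"
      using that Suc by (auto simp: G_def N_def)
    then show ?case
      unfolding path_simps by (rule LeastI_ex)
  qed
  have path_meas[measurable]: "(\<lambda>t. path t m) \<in> measurable M (count_space UNIV)" for m
  proof (induction m)
    case (Suc m)
    have [measurable]: "(\<lambda>t. LEAST n. t \<in> H (s @ [n])) \<in> measurable M (count_space UNIV)" for s
      by measurable
    have st: "(\<lambda>t. step t s) \<in> measurable M (count_space UNIV)" for s
      unfolding step_def by (rule measurable_compose[where g="\<lambda>n. s @ [n]", of _ _ "count_space UNIV"]) auto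
    have "(\<lambda>t. step t (path t m)) \<in> measurable M (count_space UNIV)"
      by (rule measurable_compose_countable[where f="\<lambda>s t. step t s", OF st Suc])
    then show ?case
      by (simp add: path_def)
  qed (simp add: path_simps)
  define a where "a t i = c (path t (Suc i)) i" for t i
  define k where "k t i = \<kappa> (path t (Suc i)) i" for t i
  have ac: "c (path t m) i = a t i" "\<kappa> (path t m) i = k t i" if "i < m" for t m i
    unfolding a_def k_def c_def \<kappa>_def path_nth[OF that] by auto
  have a_dist: "dist (a t i) (a t j) \<le> (1/2)^i + (1/2)^j"
    and a_g: "g j (k t j) l t (a t i) \<le> (1/2)^i" if "t \<in> G" for t i j l
  proof -
    let ?m = "Suc (max i j)"
    have "t \<in> A (path t ?m)"
      using path_H[OF that, of ?m] by (simp add: H_def)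
    moreover have "i < ?m" "j < ?m"
      by auto
    ultimately have "dist (c (path t ?m) i) (c (path t ?m) j) \<le> (1/2)^i + (1/2)^j"
      "g j (\<kappa> (path t ?m) j) l t (c (path t ?m) i) \<le> (1/2)^i"
      unfolding A_def by (simp_all del: max_less_iff_conj)
    then show "dist (a t i) (a t j) \<le> (1/2)^i + (1/2)^j" "g j (k t j) l t (a t i) \<le> (1/2)^i"
      unfolding ac[OF \<open>i < ?m\<close>] ac[OF \<open>j < ?m\<close>] by auto
  qed
  have a_conv: "convergent (a t)" if "t \<in> G" for t
    unfolding Cauchy_convergent_iff[symmetric]
  proof (rule metric_CauchyI)
    fix e :: real assume "e > 0"
    then obtain n where n: "(1/2::real)^n < e / 2"
      using real_arch_pow_inv[of "e/2" "1/2"] by auto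
    have "dist (a t i) (a t j) < e" if "i \<ge> n" "j \<ge> n" for i j
    proof -
      have "(1/2::real)^i \<le> (1/2)^n" "(1/2::real)^j \<le> (1/2)^n"
        using that by (auto intro!: power_decreasing)
      with a_dist[OF \<open>t \<in> G\<close>, of i j] n show ?thesis
        by linarith
    qed
    then show "\<exists>n. \<forall>i\<ge>n. \<forall>j\<ge>n. dist (a t i) (a t j) < e"
      by blast
  qed
  \<comment> \<open>Outside \<open>G\<close> the constant \<open>d 0\<close> makes the sequence
    converge at every \<open>t\<close>, so that the limit is measurable on the whole space.\<close>
  define u where "u i t = (if t \<in> G then a t i else d 0)" for i t
  define v where "v t = lim (\<lambda>i. u i t)" for t
  have lim: "(\<lambda>i. u i t) \<longlonglongrightarrow> v t" for t
    unfolding v_def convergent_LIMSEQ_iff[symmetric]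
    using a_conv[of t] by (cases "t \<in> G") (auto simp: u_def convergent_const)
  have [measurable]: "(\<lambda>t. a t i) \<in> borel_measurable M" for i
    unfolding a_def
    by (rule measurable_compose[OF path_meas]) simp
  have [measurable]: "u i \<in> borel_measurable M" for i
    unfolding u_def by measurable
  have "v \<in> borel_measurable M"
    by (rule borel_measurable_LIMSEQ_metric[of u]) (use lim in auto)
  moreover have "AE t in M. (\<exists>w. \<forall>j. \<exists>k. \<forall>l. g j k l t w \<le> 0) \<longrightarrow> (\<forall>j. \<exists>k. \<forall>l. g j k l t (v t) \<le> 0)"
    using AE_not_in[OF N] AE_space
  proof eventually_elim
    case (elim t)
    show ?case
    proof (intro impI allI exI)
      fix j l assume "\<exists>w. \<forall>j. \<exists>k. \<forall>l. g j k l t w \<le> 0"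
      \<comment> \<open>The empty list imposes no approximation, so every \<open>t\<close> with a
        solution lies in \<open>S []\<close>, hence in \<open>H []\<close>.\<close>
      then have "t \<in> S []"
        using elim by (auto simp: S_def)
      then have "t \<in> G"
        using SH[of "[]"] elim by (auto simp: G_def)
      then have "(\<lambda>i. a t i) \<longlonglongrightarrow> v t"
        using lim[of t] by (simp add: u_def)
      then have "(\<lambda>i. (1/2)^i + dist (v t) (a t i)) \<longlonglongrightarrow> 0 + dist (v t) (v t)"
        by (intro tendsto_intros LIMSEQ_power_zero) auto
      moreover have "g j (k t j) l t (v t) \<le> (1/2)^i + dist (v t) (a t i)" for i
        using lip[OF \<open>t \<in> space M\<close>, of j "k t j" l "v t" "a t i"] a_g[OF \<open>t \<in> G\<close>, of j l i] by simp
      ultimately show "g j (k t j) l t (v t) \<le> 0"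
        by (intro LIMSEQ_le_const) auto
    qed
  qed
  ultimately show ?thesis
    by (rule that)
qed

section \<open>Distance functions and Castaing representations\<close>

lemma infdist_less_iff: "C \<noteq> {} \<Longrightarrow> infdist w C < a \<longleftrightarrow> (\<exists>z\<in>C. dist w z < a)"
  by (simp add: infdist_notempty cINF_less_iff bdd_belowI2[where m=0])

text \<open>For a simple \<open>f\<close> the composite is glued from finitely many measurable
  sections \<open>g t w\<close>; continuity in the second argument carries measurability to limits
  of simple functions.\<close>

lemma borel_measurable_Caratheodory_compose:
  fixes g :: "'t \<Rightarrow> 'w::{metric_space, second_countable_topology} \<Rightarrow> 'b::metric_space"
  assumes g: "\<And>w. (\<lambda>t. g t w) \<in> borel_measurable M"
    and cont: "\<And>t. t \<in> space M \<Longrightarrow> continuous_on UNIV (g t)"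
    and f: "f \<in> borel_measurable M"
  shows "(\<lambda>t. g t (f t)) \<in> borel_measurable M"
proof -
  obtain F where F: "\<And>i. simple_function M (F i)" "\<And>t. t \<in> space M \<Longrightarrow> (\<lambda>i. F i t) \<longlonglongrightarrow> f t"
    using borel_measurable_implies_sequence_metric[OF f, of undefined] by blast
  show ?thesis
  proof (rule borel_measurable_LIMSEQ_metric)
    fix i
    have "finite (F i ` space M)"
      using F(1) by (auto simp: simple_function_def)
    moreover have "F i \<in> measurable M (count_space (F i ` space M))"
      by (rule measurableI) (simp_all add: simple_functionD(2)[OF F(1)])
    ultimately show "(\<lambda>t. g t (F i t)) \<in> borel_measurable M"
      using measurable_compose_countable'[where f="\<lambda>w t. g t w" and I="F i ` space M" and g="F i"
          and M=M and N=borel, OF g]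
      by (simp add: countable_finite)
  next
    fix t assume t: "t \<in> space M"
    have "isCont (g t) (f t)"
      using cont[OF t] by (simp add: continuous_on_eq_continuous_at)
    then show "(\<lambda>i. g t (F i t)) \<longlonglongrightarrow> g t (f t)"
      using F(2)[OF t] by (rule isCont_tendsto_compose)
  qed
qed

text \<open>A strict sublevel set of the distance is the set where \<open>C t\<close> meets an open
  ball. All later arguments use measurability of the multifunction through its distance
  functions.\<close>

lemma borel_measurable_infdist_multifunction:
  fixes C :: "'t \<Rightarrow> 'w::metric_space set"
  assumes C: "measurable_closed_multifunction M C"
  shows "(\<lambda>t. infdist w (C t)) \<in> borel_measurable M"
  unfolding borel_measurable_iff_less
proof
  fix a
  have "infdist w (C t) < a \<longleftrightarrow> C t \<inter> ball w a \<noteq> {}" if "t \<in> space M" for t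
  proof -
    have "C t \<noteq> {}"
      using C that by (auto simp: measurable_closed_multifunction_def)
    then show ?thesis
      by (auto simp: infdist_less_iff)
  qed
  then have "{t \<in> space M. infdist w (C t) < a} = {t \<in> space M. C t \<inter> ball w a \<noteq> {}}"
    by blast
  then show "{t \<in> space M. infdist w (C t) < a} \<in> sets M"
    using C by (auto simp: measurable_closed_multifunction_def)
qed

lemma borel_measurable_infdist_compose:
  fixes C :: "'t \<Rightarrow> 'w::{metric_space, second_countable_topology} set"
  assumes "measurable_closed_multifunction M C" "f \<in> borel_measurable M"
  shows "(\<lambda>t. infdist (f t) (C t)) \<in> borel_measurable M"
  by (rule borel_measurable_Caratheodory_compose[where g="\<lambda>t w. infdist w (C t)"])
    (simp_all add: borel_measurable_infdist_multifunction assms continuous_on_infdist)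

text \<open>For each pair of a dense point \<open>d n\<close> and a radius \<open>(1/2)^m\<close> a
  point of \<open>C t\<close> in that ball is selected whenever there is one; these selections come
  arbitrarily close to every point of \<open>C t\<close>.\<close>

theorem (in sigma_finite_measure) ex_Castaing_representation:
  fixes C :: "'a \<Rightarrow> 'w::{complete_space, second_countable_topology} set"
  assumes C: "measurable_closed_multifunction M C"
  obtains c :: "nat \<Rightarrow> 'a \<Rightarrow> 'w" where "\<And>n. c n \<in> borel_measurable M"
    "AE t in M. range (\<lambda>n. c n t) \<subseteq> C t \<and> C t \<subseteq> closure (range (\<lambda>n. c n t))"
proof -
  obtain d :: "nat \<Rightarrow> 'w" where d: "\<And>w e. e > 0 \<Longrightarrow> \<exists>n. dist w (d n) < e"
    by (erule ex_dense_sequence)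
  have ne: "C t \<noteq> {}" and cl: "closed (C t)" if "t \<in> space M" for t
    using C that by (auto simp: measurable_closed_multifunction_def)
  have inf0: "infdist w (C t) \<le> 0 \<longleftrightarrow> w \<in> C t" if "t \<in> space M" for w t
    using in_closed_iff_infdist_zero[OF cl[OF that] ne[OF that], of w] infdist_nonneg[of w "C t"] by auto
  note [measurable] = borel_measurable_infdist_multifunction[OF C] borel_measurable_infdist_compose[OF C]
  define P where "P n m t w \<longleftrightarrow> w \<in> C t \<and> dist w (d n) \<le> (1/2)^m" for n m :: nat and t w
  have "\<exists>v. v \<in> borel_measurable M \<and> (AE t in M. (\<exists>w. P n m t w) \<longrightarrow> P n m t (v t))" for n m
  proof -
    \<comment> \<open>The index \<open>j = 0\<close> encodes membership in the closed set
      \<open>C t\<close> and every other \<open>j\<close> closeness to \<open>d n\<close>;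
      \<open>k\<close> and \<open>l\<close> are dummies.\<close>
    define g where "g j k l t w = (if j = 0 then infdist w (C t) else dist w (d n) - (1/2)^m)"
      for j k :: nat and l :: nat and t w
    have g_iff: "(\<forall>j. \<exists>k. \<forall>l. g j k l t w \<le> 0) \<longleftrightarrow> P n m t w" if "t \<in> space M" for t w
      using inf0[OF that] by (auto simp: g_def P_def split: if_splits)
    have lip: "g j k l t w \<le> g j k l t w' + dist w w'" for j k l t w w'
      using infdist_triangle[of w "C t" w'] dist_triangle[of w "d n" w'] by (auto simp: g_def)
    have meas: "(\<lambda>t. g j k l t w) \<in> borel_measurable M" for j k l w
      unfolding g_def by measurable
    obtain v where "v \<in> borel_measurable M" and
      v: "AE t in M. (\<exists>w. \<forall>j. \<exists>k. \<forall>l. g j k l t w \<le> 0) \<longrightarrow> (\<forall>j. \<exists>k. \<forall>l. g j k l t (v t) \<le> 0)"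
      by (rule AE_measurable_selection[of g, OF meas lip])
    moreover have "AE t in M. (\<exists>w. P n m t w) \<longrightarrow> P n m t (v t)"
      using v AE_space by eventually_elim (simp add: g_iff)
    ultimately show ?thesis
      by blast
  qed
  then obtain v where v[measurable]: "\<And>n m. v n m \<in> borel_measurable M"
    and vP: "\<And>n m. AE t in M. (\<exists>w. P n m t w) \<longrightarrow> P n m t (v n m t)"
    by metis
  \<comment> \<open>Where \<open>C t\<close> has no point near \<open>d n\<close>, the function
    \<open>v n m\<close> may leave \<open>C t\<close>, and \<open>u\<close> replaces it. A dense
    point at distance below 1 from \<open>C t\<close> always exists, and radius 1 is the case
    \<open>m = 0\<close>.\<close>
  define u where "u t = v (LEAST n. infdist (d n) (C t) < 1) 0 t" for t
  have u[measurable]: "u \<in> borel_measurable M"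
    unfolding u_def by measurable
  define c where "c i t = (case prod_decode i of (n, m) \<Rightarrow> if v n m t \<in> C t then v n m t else u t)" for i t
  have [measurable]: "c i \<in> borel_measurable M" for i
  proof -
    obtain n m where i: "prod_decode i = (n, m)"
      by fastforce
    have "(\<lambda>t. if infdist (v n m t) (C t) \<le> 0 then v n m t else u t) \<in> borel_measurable M"
      by measurable
    then show ?thesis
      by (rule measurable_cong[THEN iffD1, rotated]) (simp add: c_def i inf0)
  qed
  have "AE t in M. \<forall>n m. (\<exists>w. P n m t w) \<longrightarrow> P n m t (v n m t)"
    using vP by (simp add: AE_all_countable)
  then have "AE t in M. range (\<lambda>n. c n t) \<subseteq> C t \<and> C t \<subseteq> closure (range (\<lambda>n. c n t))"
    using AE_space
  proof eventually_elim
    case (elim t)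
    have "\<exists>n. infdist (d n) (C t) < 1"
    proof -
      obtain w where "w \<in> C t"
        using ne elim by blast
      moreover obtain n where "dist w (d n) < 1"
        using d[of 1 w] by auto
      ultimately show ?thesis
        by (intro exI[of _ n]) (metis dist_commute infdist_le order_le_less_trans)
    qed
    then have "infdist (d (LEAST n. infdist (d n) (C t) < 1)) (C t) < 1"
      by (rule LeastI_ex)
    then have "\<exists>w. P (LEAST n. infdist (d n) (C t) < 1) 0 t w"
      using ne[of t] elim
      by (auto simp: P_def infdist_less_iff dist_commute intro: less_imp_le)
    then have "u t \<in> C t"
      using elim unfolding u_def P_def by blast
    then have "range (\<lambda>n. c n t) \<subseteq> C t"
      by (auto simp: c_def split: prod.splits)
    moreover have "y \<in> closure (range (\<lambda>n. c n t))" if "y \<in> C t" for y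
      unfolding closure_approachable
    proof (intro allI impI)
      fix e :: real assume "e > 0"
      then obtain m where m: "(1/2::real)^m < e / 2"
        using real_arch_pow_inv[of "e/2" "1/2"] by auto
      obtain n where n: "dist y (d n) < (1/2)^m"
        using d[of "(1/2)^m" y] by auto
      then have "\<exists>w. P n m t w"
        using that by (auto simp: P_def intro!: exI[of _ y])
      then have *: "P n m t (v n m t)"
        using elim by blast
      then have "c (prod_encode (n, m)) t = v n m t"
        by (simp add: c_def P_def)
      moreover have "dist (v n m t) y < e"
        using * n m dist_triangle2[of "v n m t" y "d n"] by (auto simp: P_def)
      ultimately show "\<exists>z\<in>range (\<lambda>n. c n t). dist z y < e"
        by (metis rangeI)
    qed
    ultimately show ?case
      by blast
  qed
  then show ?thesis
    using that[of c] by simp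
qed

section \<open>Tangent cones\<close>

text \<open>The Clarke condition at tolerance \<open>a\<close>, with one scale \<open>b\<close> for
  the neighbourhood and for the step. Both ranges are open, so that dense points and rational steps
  can test it; the distance replaces the existence of a nearby point and is measurable in
  \<open>t\<close>.\<close>

definition tangent_good :: "'w::real_normed_vector set \<Rightarrow> 'w \<Rightarrow> 'w \<Rightarrow> real \<Rightarrow> real \<Rightarrow> bool" where
  "tangent_good C x v a b \<longleftrightarrow>
     (\<forall>y\<in>C. dist y x < b \<longrightarrow> (\<forall>\<eta>. 0 < \<eta> \<longrightarrow> \<eta> < b \<longrightarrow> infdist (y + \<eta> *\<^sub>R v) C \<le> \<eta> * a))"

lemma tangent_good_mono: "tangent_good C x v a b \<Longrightarrow> b' \<le> b \<Longrightarrow> tangent_good C x v a b'"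
  by (simp add: tangent_good_def)

lemma tangent_good_mono': "tangent_good C x v a b \<Longrightarrow> a \<le> a' \<Longrightarrow> tangent_good C x v a' b"
  unfolding tangent_good_def
  by (intro ballI allI impI, rule order.trans[OF _ mult_left_mono]) auto

text \<open>Failure of the inequality is an open condition on the step and on the point of
  \<open>C\<close>, within open ranges; if it occurs at all, it occurs at a rational step and at a
  member of the dense sequence. Tangency thus becomes countably many conditions.\<close>

lemma tangent_good_dense_iff:
  assumes c: "range c \<subseteq> C" "C \<subseteq> closure (range c)"
  shows "tangent_good C x v a b \<longleftrightarrow> (\<forall>n (q::rat). dist (c n) x < b \<longrightarrow> 0 < real_of_rat q \<longrightarrow>
     real_of_rat q < b \<longrightarrow> infdist (c n + real_of_rat q *\<^sub>R v) C \<le> real_of_rat q * a)"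
    (is "?L \<longleftrightarrow> ?R")
proof
  show "?L \<Longrightarrow> ?R"
    using c(1) unfolding tangent_good_def by blast
next
  assume R: ?R
  have 1: "infdist (c n + \<eta> *\<^sub>R v) C \<le> \<eta> * a" if n: "dist (c n) x < b" and \<eta>: "0 < \<eta>" "\<eta> < b" for n \<eta>
  proof (rule ccontr)
    assume far: "\<not> ?thesis"
    define U where "U = {h. infdist (c n + h *\<^sub>R v) C - h * a > 0} \<inter> {0<..<b}"
    have "open U"
      unfolding U_def by (intro open_Int open_greaterThanLessThan open_Collect_less continuous_intros)
    moreover have "\<eta> \<in> U"
      using far \<eta> by (auto simp: U_def)
    ultimately obtain e where e: "e > 0" "ball \<eta> e \<subseteq> U"
      using open_contains_ball by blast
    obtain q where "\<eta> < real_of_rat q" "real_of_rat q < \<eta> + e"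
      using of_rat_dense[of \<eta> "\<eta> + e"] e by auto
    then have "real_of_rat q \<in> U"
      using e by (auto simp: dist_real_def)
    then show False
      using R n by (auto simp: U_def not_le[symmetric])
  qed
  show ?L
    unfolding tangent_good_def
  proof (intro ballI allI impI)
    fix y \<eta> assume y: "y \<in> C" "dist y x < b" and \<eta>: "0 < \<eta>" "\<eta> < b"
    show "infdist (y + \<eta> *\<^sub>R v) C \<le> \<eta> * a"
    proof (rule ccontr)
      assume far: "\<not> ?thesis"
      define U where "U = {h. infdist (h + \<eta> *\<^sub>R v) C - \<eta> * a > 0} \<inter> ball x b"
      have "open U"
        unfolding U_def by (intro open_Int open_ball open_Collect_less continuous_intros)
      moreover have "y \<in> U"
        using far y by (auto simp: U_def dist_commute)
      ultimately have "U \<inter> range c \<noteq> {}"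
        using y c(2) open_Int_closure_eq_empty by blast
      then obtain n where "c n \<in> U"
        by blast
      then show False
        using 1[of n \<eta>] \<eta> by (auto simp: U_def dist_commute)
    qed
  qed
qed

text \<open>Iterating small steps turns failure at one scale \<open>h\<close> into failure at every smaller scale,
  so that a scale of failure can be chosen independently of the parameter \<open>t\<close>.\<close>

lemma not_tangent_good_scales:
  fixes C :: "'w::real_normed_vector set"
  assumes bad: "\<And>b. b > 0 \<Longrightarrow> \<not> tangent_good C x v a b" and a: "a > 0" and \<delta>: "\<delta> > 0"
  shows "\<exists>\<kappa>>0. \<forall>\<eta>. 0 < \<eta> \<longrightarrow> \<eta> \<le> \<kappa> \<longrightarrow>
    (\<exists>y\<in>C. dist y x < \<delta> \<and> infdist (y + \<eta> *\<^sub>R v) C > \<eta> * (a / 2))"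
proof -
  \<comment> \<open>The chain of steps starts within \<open>b\<close> of \<open>x\<close> and lasts
    for a time at most \<open>b\<close>, so it drifts by at most \<open>b * norm v\<close> with an
    error below \<open>b * a\<close>. The sum \<open>b * (1 + norm v + a)\<close> is
    \<open>\<delta> / 2\<close>, so the chain stays in the ball of radius
    \<open>\<delta>\<close>.\<close>
  define b where "b = \<delta> / (2 * (1 + norm v + a))"
  have den: "1 + norm v + a > 0"
    using a by (smt (verit) norm_ge_zero)
  have b: "b > 0" "b * (norm v + a) < \<delta> / 2"  "b \<le> \<delta> / 2"
  proof -
    show "b > 0"
      using den \<delta> by (simp add: b_def)
    have "b * (1 + norm v + a) = \<delta> / 2"
      using den unfolding b_def by (simp add: divide_simps)
    then show "b * (norm v + a) < \<delta> / 2"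
      using \<open>b > 0\<close> by (simp add: algebra_simps)
    have "b * 1 \<le> b * (1 + norm v + a)"
      using \<open>b > 0\<close> a by (intro mult_left_mono) auto
    with \<open>b * (1 + norm v + a) = \<delta> / 2\<close> show "b \<le> \<delta> / 2"
      by simp
  qed
  obtain y0 h where y0: "y0 \<in> C" "dist y0 x < b" and h: "0 < h" "h < b"
    and far: "infdist (y0 + h *\<^sub>R v) C > h * a"
    using bad[OF b(1)] by (auto simp: tangent_good_def not_le)
  \<comment> \<open>When \<open>h\<close> is divided into steps of length at most
    \<open>\<kappa>\<close>, the remaining time costs at most \<open>h * a / 4\<close> of motion
    along \<open>v\<close>. The accumulated error of the chain is at most
    \<open>3 * h * a / 4\<close>, and the sum contradicts the failure at \<open>h\<close>.\<close>
  define \<kappa> where "\<kappa> = h * a / (4 * (norm v + 1))"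
  have nv: "norm v + 1 > 0"
    by (smt (verit) norm_ge_zero)
  have "\<kappa> > 0"
    using h a nv by (simp add: \<kappa>_def)
  moreover have "\<exists>y\<in>C. dist y x < \<delta> \<and> infdist (y + \<eta> *\<^sub>R v) C > \<eta> * (a / 2)" if \<eta>: "0 < \<eta>" "\<eta> \<le> \<kappa>" for \<eta>
  proof (rule ccontr)
    assume "\<not> ?thesis"
    then have close: "infdist (y + \<eta> *\<^sub>R v) C \<le> \<eta> * (a / 2)" if "y \<in> C" "dist y x < \<delta>" for y
      using that by (auto simp: not_less)
    \<comment> \<open>The distance need not be attained; raising \<open>a / 2\<close> to
      \<open>3 * a / 4\<close> leaves room for an actual point of \<open>C\<close>.\<close>
    have step: "\<exists>z\<in>C. dist z (y + \<eta> *\<^sub>R v) < \<eta> * (3 * a / 4)" if y: "y \<in> C" "dist y x < \<delta>" for y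
    proof -
      have "infdist (y + \<eta> *\<^sub>R v) C < \<eta> * (3 * a / 4)"
        using close[OF y] mult_pos_pos[OF \<eta>(1) a] by (simp add: field_simps)
      then show ?thesis
        using y(1) by (subst (asm) infdist_less_iff) (auto simp only: dist_commute)
    qed
    define N where "N = nat \<lfloor>h / \<eta>\<rfloor>"
    have N: "real N * \<eta> \<le> h" "h - real N * \<eta> < \<eta>"
    proof -
      have "real N = of_int \<lfloor>h / \<eta>\<rfloor>"
        using h \<eta> by (simp add: N_def)
      then have "real N \<le> h / \<eta>" "h / \<eta> < real N + 1"
        by linarith+
      then show "real N * \<eta> \<le> h" "h - real N * \<eta> < \<eta>"
        using \<eta> by (simp_all add: field_simps)
    qed
    have "\<exists>y\<in>C. dist y (y0 + (real i * \<eta>) *\<^sub>R v) \<le> real i * \<eta> * (3 * a / 4)" if "i \<le> N" for i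
      using that
    proof (induction i)
      case 0
      then show ?case using y0 by auto
    next
      case (Suc i)
      then obtain y where y: "y \<in> C" "dist y (y0 + (real i * \<eta>) *\<^sub>R v) \<le> real i * \<eta> * (3 * a / 4)"
        by auto
      have i: "real i * \<eta> \<le> b"
      proof -
        have "real i * \<eta> \<le> real N * \<eta>"
          using Suc.prems \<eta> by (intro mult_right_mono) auto
        then show ?thesis using N h by linarith
      qed
      have "dist y x \<le> dist y (y0 + (real i * \<eta>) *\<^sub>R v) + dist (y0 + (real i * \<eta>) *\<^sub>R v) y0 + dist y0 x"
        by (smt (verit) dist_triangle)
      also have "\<dots> < real i * \<eta> * (3 * a / 4) + real i * \<eta> * norm v + b"
        using y y0 \<eta> by (simp add: dist_norm)
      also have "\<dots> \<le> real i * \<eta> * (norm v + a) + b"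
        using a \<eta> by (auto simp: algebra_simps)
      also have "\<dots> \<le> b * (norm v + a) + b"
        using i a by (intro add_right_mono mult_right_mono) auto
      also have "\<dots> < \<delta>"
        using b by simp
      finally obtain z where z: "z \<in> C" "dist z (y + \<eta> *\<^sub>R v) < \<eta> * (3 * a / 4)"
        using step[OF y(1)] by blast
      have "dist z (y0 + (real (Suc i) * \<eta>) *\<^sub>R v) \<le>
          dist z (y + \<eta> *\<^sub>R v) + dist (y + \<eta> *\<^sub>R v) (y0 + (real (Suc i) * \<eta>) *\<^sub>R v)"
        by (rule dist_triangle)
      also have "dist (y + \<eta> *\<^sub>R v) (y0 + (real (Suc i) * \<eta>) *\<^sub>R v) = dist y (y0 + (real i * \<eta>) *\<^sub>R v)"
        by (simp add: dist_norm algebra_simps)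
      finally have "dist z (y0 + (real (Suc i) * \<eta>) *\<^sub>R v) \<le> real (Suc i) * \<eta> * (3 * a / 4)"
        using z y by (simp add: algebra_simps)
      then show ?case
        using z by blast
    qed
    then obtain y where y: "y \<in> C" "dist y (y0 + (real N * \<eta>) *\<^sub>R v) \<le> real N * \<eta> * (3 * a / 4)"
      by blast
    have "infdist (y0 + h *\<^sub>R v) C \<le> dist (y0 + h *\<^sub>R v) y"
      using y by (intro infdist_le)
    also have "\<dots> \<le> dist (y0 + h *\<^sub>R v) (y0 + (real N * \<eta>) *\<^sub>R v) + dist y (y0 + (real N * \<eta>) *\<^sub>R v)"
      by (rule dist_triangle2)
    also have "dist (y0 + h *\<^sub>R v) (y0 + (real N * \<eta>) *\<^sub>R v) = (h - real N * \<eta>) * norm v"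
    proof -
      have "(y0 + h *\<^sub>R v) - (y0 + (real N * \<eta>) *\<^sub>R v) = (h - real N * \<eta>) *\<^sub>R v"
        by (simp add: algebra_simps)
      then show ?thesis
        using N by (simp add: dist_norm)
    qed
    also have "\<dots> \<le> \<kappa> * (norm v + 1)"
      using N \<eta> by (intro mult_mono) auto
    also have "\<kappa> * (norm v + 1) = h * a / 4"
      using nv unfolding \<kappa>_def by (simp add: divide_simps)
    also have "dist y (y0 + (real N * \<eta>) *\<^sub>R v) \<le> h * (3 * a / 4)"
      using a by (intro order.trans[OF y(2) mult_right_mono[OF N(1)]]) simp
    finally show False
      using far by (simp add: mult.commute)
  qed
  ultimately show ?thesis
    by blast
qed

text \<open>An \<open>nspace\<close> records only sums and multiples, so subtraction is a parameter.
  The axioms are the algebra that turns membership in a translated ball into an inequality for the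
  norm of a difference; they hold for functions before any identification almost everywhere.\<close>

locale vec_nspace =
  fixes X :: "'x nspace" and minus_of :: "'x \<Rightarrow> 'x \<Rightarrow> 'x"
  assumes plus_closed: "\<lbrakk>x \<in> points X; y \<in> points X\<rbrakk> \<Longrightarrow> plus_of X x y \<in> points X"
    and scale_closed: "x \<in> points X \<Longrightarrow> scale_of X c x \<in> points X"
    and minus_closed: "\<lbrakk>x \<in> points X; y \<in> points X\<rbrakk> \<Longrightarrow> minus_of y x \<in> points X"
    and plus_minus: "\<lbrakk>x \<in> points X; y \<in> points X\<rbrakk> \<Longrightarrow> plus_of X x (minus_of y x) = y"
    and minus_plus: "\<lbrakk>x \<in> points X; y \<in> points X\<rbrakk> \<Longrightarrow> minus_of (plus_of X x y) x = y"
    and plus_assoc: "\<lbrakk>x \<in> points X; y \<in> points X; z \<in> points X\<rbrakk> \<Longrightarrow>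
      plus_of X x (plus_of X y z) = plus_of X (plus_of X x y) z"
    and scale_plus: "\<lbrakk>x \<in> points X; y \<in> points X\<rbrakk> \<Longrightarrow>
      scale_of X c (plus_of X x y) = plus_of X (scale_of X c x) (scale_of X c y)"
    and scale_scale: "x \<in> points X \<Longrightarrow> scale_of X c (scale_of X d x) = scale_of X (c * d) x"
    and scale_one: "x \<in> points X \<Longrightarrow> scale_of X 1 x = x"
    and plus_scale_zero: "\<lbrakk>x \<in> points X; y \<in> points X\<rbrakk> \<Longrightarrow> plus_of X x (scale_of X 0 y) = x"
    and norm_scale: "x \<in> points X \<Longrightarrow> norm_of X (scale_of X c x) = \<bar>c\<bar> * norm_of X x"
begin

lemma mem_ball_iff:
  assumes "x \<in> points X" "y \<in> points X" "d > 0"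
  shows "(\<exists>b. y = plus_of X x (scale_of X d b) \<and> b \<in> closed_unit_ball X) \<longleftrightarrow> norm_of X (minus_of y x) \<le> d"
proof
  assume "\<exists>b. y = plus_of X x (scale_of X d b) \<and> b \<in> closed_unit_ball X"
  then show "norm_of X (minus_of y x) \<le> d"
    using assms by (auto simp: closed_unit_ball_def minus_plus scale_closed norm_scale)
next
  assume "norm_of X (minus_of y x) \<le> d"
  then show "\<exists>b. y = plus_of X x (scale_of X d b) \<and> b \<in> closed_unit_ball X"
    using assms by (intro exI[of _ "scale_of X (1 / d) (minus_of y x)"])
      (auto simp: closed_unit_ball_def minus_closed scale_closed norm_scale scale_scale scale_one plus_minus)
qed

text \<open>Balls written as images of the unit ball become inequalities for the norm. The step
  \<open>\<eta> = 0\<close>, at which no division by the radius is possible, is always satisfied and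
  drops out.\<close>

lemma clarke_tangent_cone_iff:
  assumes C: "C \<subseteq> points X" and x: "x \<in> points X"
  shows "v \<in> clarke_tangent_cone X C x \<longleftrightarrow> v \<in> points X \<and> (\<forall>\<epsilon>>0. \<exists>\<delta>>0. \<exists>\<kappa>>0.
    \<forall>y\<in>C. norm_of X (minus_of y x) \<le> \<delta> \<longrightarrow> (\<forall>\<eta>. 0 < \<eta> \<longrightarrow> \<eta> \<le> \<kappa> \<longrightarrow>
      (\<exists>u\<in>C. norm_of X (minus_of u (plus_of X y (scale_of X \<eta> v))) \<le> \<eta> * \<epsilon>)))"
proof -
  have 1: "C \<inter> {plus_of X x (scale_of X \<delta> b) |b. b \<in> closed_unit_ball X} =
      {y \<in> C. norm_of X (minus_of y x) \<le> \<delta>}" if "\<delta> > 0" for \<delta>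
    using mem_ball_iff[OF x _ that] C by blast
  have 2: "(\<forall>\<eta>\<in>{0..\<kappa>}. C \<inter> {plus_of X y (scale_of X \<eta> (plus_of X v (scale_of X \<epsilon> b))) |b. b \<in> closed_unit_ball X} \<noteq> {})
      \<longleftrightarrow> (\<forall>\<eta>. 0 < \<eta> \<longrightarrow> \<eta> \<le> \<kappa> \<longrightarrow> (\<exists>u\<in>C. norm_of X (minus_of u (plus_of X y (scale_of X \<eta> v))) \<le> \<eta> * \<epsilon>))"
    (is "?L \<longleftrightarrow> ?R") if y: "y \<in> C" and v: "v \<in> points X" and \<epsilon>: "\<epsilon> > 0" for \<kappa> y \<epsilon>
  proof -
    have yP: "y \<in> points X"
      using y C by blast
    have eq: "plus_of X y (scale_of X \<eta> (plus_of X v (scale_of X \<epsilon> b))) =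
        plus_of X (plus_of X y (scale_of X \<eta> v)) (scale_of X (\<eta> * \<epsilon>) b)" if "b \<in> closed_unit_ball X" for b \<eta>
      using that yP v by (simp add: closed_unit_ball_def scale_plus scale_closed scale_scale plus_assoc)
    have *: "C \<inter> {plus_of X y (scale_of X \<eta> (plus_of X v (scale_of X \<epsilon> b))) |b. b \<in> closed_unit_ball X} \<noteq> {} \<longleftrightarrow>
        (\<exists>u\<in>C. norm_of X (minus_of u (plus_of X y (scale_of X \<eta> v))) \<le> \<eta> * \<epsilon>)" if "\<eta> > 0" for \<eta>
    proof -
      have "(\<exists>b. u = plus_of X y (scale_of X \<eta> (plus_of X v (scale_of X \<epsilon> b))) \<and> b \<in> closed_unit_ball X) \<longleftrightarrow>
          norm_of X (minus_of u (plus_of X y (scale_of X \<eta> v))) \<le> \<eta> * \<epsilon>" if "u \<in> C" for u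
      proof -
        have "u \<in> points X"
          using that C by blast
        then show ?thesis
          using mem_ball_iff[of "plus_of X y (scale_of X \<eta> v)" u "\<eta> * \<epsilon>"] \<open>\<eta> > 0\<close> \<epsilon> yP v
          by (simp add: plus_closed scale_closed eq cong: rev_conj_cong)
      qed
      then show ?thesis
        by blast
    qed
    \<comment> \<open>At step 0 the translated ball contains \<open>y\<close> itself. An element of
      the unit ball is obtained as \<open>scale_of X 0 x\<close>, since an \<open>nspace\<close>
      names no zero.\<close>
    have 0: "C \<inter> {plus_of X y (scale_of X 0 (plus_of X v (scale_of X \<epsilon> b))) |b. b \<in> closed_unit_ball X} \<noteq> {}"
    proof -
      have "scale_of X 0 x \<in> closed_unit_ball X"
        using x by (simp add: closed_unit_ball_def scale_closed norm_scale)
      moreover have "y = plus_of X y (scale_of X 0 (plus_of X v (scale_of X \<epsilon> (scale_of X 0 x))))"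
        using yP v x by (simp add: plus_scale_zero plus_closed scale_closed)
      ultimately have "\<exists>b. y = plus_of X y (scale_of X 0 (plus_of X v (scale_of X \<epsilon> b))) \<and> b \<in> closed_unit_ball X"
        by (intro exI[of _ "scale_of X 0 x"] conjI)
      then have "y \<in> C \<inter> {plus_of X y (scale_of X 0 (plus_of X v (scale_of X \<epsilon> b))) |b. b \<in> closed_unit_ball X}"
        using y by (intro IntI CollectI)
      then show ?thesis
        by (rule ex_in_conv[THEN iffD1, OF exI])
    qed
    define K where "K \<eta> = C \<inter> {plus_of X y (scale_of X \<eta> (plus_of X v (scale_of X \<epsilon> b))) |b. b \<in> closed_unit_ball X}" for \<eta>
    define Q where "Q \<eta> \<longleftrightarrow> (\<exists>u\<in>C. norm_of X (minus_of u (plus_of X y (scale_of X \<eta> v))) \<le> \<eta> * \<epsilon>)" for \<eta>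
    have K: "K 0 \<noteq> {}" "\<And>\<eta>. \<eta> > 0 \<Longrightarrow> K \<eta> \<noteq> {} \<longleftrightarrow> Q \<eta>"
      unfolding K_def Q_def by (rule 0, rule *)
    have "(\<forall>\<eta>\<in>{0..\<kappa>}. K \<eta> \<noteq> {}) \<longleftrightarrow> (\<forall>\<eta>. 0 < \<eta> \<longrightarrow> \<eta> \<le> \<kappa> \<longrightarrow> Q \<eta>)"
      using K by (metis (no_types) atLeastAtMost_iff less_eq_real_def)
    then show ?thesis
      by (simp only: K_def Q_def)
  qed
  have ball_filter_cong: "(\<forall>y\<in>{y \<in> C. P y}. K y) \<longleftrightarrow> (\<forall>y\<in>C. P y \<longrightarrow> Q y)"
    if "\<And>y. y \<in> C \<Longrightarrow> K y \<longleftrightarrow> Q y" for P K Q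
    using that by blast
  show ?thesis
    unfolding clarke_tangent_cone_def mem_Collect_eq
  proof (intro conj_cong refl all_cong1 imp_cong ex_cong1)
    fix \<epsilon> \<delta> \<kappa> :: real assume v: "v \<in> points X" and pos: "\<epsilon> > 0" "\<delta> > 0"
    show "(\<forall>y\<in>C \<inter> {plus_of X x (scale_of X \<delta> b) |b. b \<in> closed_unit_ball X}. \<forall>\<eta>\<in>{0..\<kappa>}.
          C \<inter> {plus_of X y (scale_of X \<eta> (plus_of X v (scale_of X \<epsilon> b))) |b. b \<in> closed_unit_ball X} \<noteq> {}) \<longleftrightarrow>
        (\<forall>y\<in>C. norm_of X (minus_of y x) \<le> \<delta> \<longrightarrow> (\<forall>\<eta>. 0 < \<eta> \<longrightarrow> \<eta> \<le> \<kappa> \<longrightarrow>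
          (\<exists>u\<in>C. norm_of X (minus_of u (plus_of X y (scale_of X \<eta> v))) \<le> \<eta> * \<epsilon>)))"
      unfolding 1[OF pos(2)] by (rule ball_filter_cong, rule 2[OF _ v pos(1)])
  qed
qed

end

lemma vec_nspace_prod:
  assumes "vec_nspace X mX" "vec_nspace Y mY"
  shows "vec_nspace (prod_nspace X Y) (\<lambda>(a, b) (a', b'). (mX a a', mY b b'))"
proof -
  interpret X: vec_nspace X mX by fact
  interpret Y: vec_nspace Y mY by fact
  show ?thesis
    by standard
      (auto simp: prod_nspace_def X.plus_closed Y.plus_closed X.scale_closed Y.scale_closed
        X.minus_closed Y.minus_closed X.plus_minus Y.plus_minus X.minus_plus Y.minus_plus X.plus_assoc
        Y.plus_assoc X.scale_plus Y.scale_plus X.scale_scale Y.scale_scale X.scale_one Y.scale_one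
        X.plus_scale_zero Y.plus_scale_zero X.norm_scale Y.norm_scale distrib_left)
qed

lemma vec_nspace_type: "vec_nspace type_nspace (-)"
  by standard (auto simp: type_nspace_def algebra_simps)

lemma norm_prod_le_sum: "norm w \<le> norm (fst w) + norm (snd w)"
  and sum_le_norm_prod: "norm (fst w) + norm (snd w) \<le> 2 * norm w"
proof -
  show "norm w \<le> norm (fst w) + norm (snd w)"
    using norm_Pair_le[of "fst w" "snd w"] by simp
  show "norm (fst w) + norm (snd w) \<le> 2 * norm w"
    using norm_fst_le[of "fst w" "snd w"] norm_snd_le[of "snd w" "fst w"] by simp
qed

text \<open>The sum norm of the cone and the Euclidean norm behind \<open>dist\<close> differ by a
  factor of at most 2, which the quantifiers over tolerances and scales absorb.\<close>

lemma clarke_tangent_cone_type_prod: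
  fixes x :: "'a::real_normed_vector \<times> 'b::real_normed_vector"
  shows "v \<in> clarke_tangent_cone (prod_nspace type_nspace type_nspace) C x \<longleftrightarrow>
    (\<forall>a>0. \<exists>b>0. tangent_good C x v a b)"
proof -
  interpret vec_nspace "prod_nspace (type_nspace :: 'a nspace) (type_nspace :: 'b nspace)"
    "\<lambda>(a, b) (a', b'). (a - a', b - b')"
    by (intro vec_nspace_prod vec_nspace_type)
  define N where "N w = norm (fst w) + norm (snd w)" for w :: "'a \<times> 'b"
  have N: "norm w \<le> N w" "N w \<le> 2 * norm w" for w
    unfolding N_def by (rule norm_prod_le_sum sum_le_norm_prod)+
  have nspace: "norm_of (prod_nspace type_nspace type_nspace) = N"
    "plus_of (prod_nspace type_nspace type_nspace) = ((+) :: 'a \<times> 'b \<Rightarrow> _)"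
    "scale_of (prod_nspace type_nspace type_nspace) = ((*\<^sub>R) :: _ \<Rightarrow> 'a \<times> 'b \<Rightarrow> _)"
    "points (prod_nspace type_nspace type_nspace) = (UNIV :: ('a \<times> 'b) set)"
    "(\<lambda>(a, b) (a', b'). (a - a', b - b')) = ((-) :: 'a \<times> 'b \<Rightarrow> _)"
    by (auto simp: prod_nspace_def type_nspace_def N_def fun_eq_iff)
  have iff: "v \<in> clarke_tangent_cone (prod_nspace type_nspace type_nspace) C x \<longleftrightarrow>
    (\<forall>\<epsilon>>0. \<exists>\<delta>>0. \<exists>\<kappa>>0. \<forall>y\<in>C. N (y - x) \<le> \<delta> \<longrightarrow> (\<forall>\<eta>. 0 < \<eta> \<longrightarrow> \<eta> \<le> \<kappa> \<longrightarrow>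
      (\<exists>u\<in>C. N (u - (y + \<eta> *\<^sub>R v)) \<le> \<eta> * \<epsilon>)))"
    using clarke_tangent_cone_iff[of C x v] unfolding nspace by simp
  show ?thesis
    unfolding iff
  proof safe
    fix a :: real assume "a > 0" and L: "\<forall>\<epsilon>>0. \<exists>\<delta>>0. \<exists>\<kappa>>0. \<forall>y\<in>C. N (y - x) \<le> \<delta> \<longrightarrow> (\<forall>\<eta>. 0 < \<eta> \<longrightarrow> \<eta> \<le> \<kappa> \<longrightarrow>
      (\<exists>u\<in>C. N (u - (y + \<eta> *\<^sub>R v)) \<le> \<eta> * \<epsilon>))"
    then obtain \<delta> \<kappa> where \<delta>: "\<delta> > 0" "\<kappa> > 0" and *: "\<And>y \<eta>. y \<in> C \<Longrightarrow> N (y - x) \<le> \<delta> \<Longrightarrow> 0 < \<eta> \<Longrightarrow> \<eta> \<le> \<kappa> \<Longrightarrow>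
      (\<exists>u\<in>C. N (u - (y + \<eta> *\<^sub>R v)) \<le> \<eta> * a)"
      by metis
    \<comment> \<open>Half of \<open>\<delta>\<close> pays for the factor 2 between the
      norms.\<close>
    have "tangent_good C x v a (min (\<delta> / 2) \<kappa>)"
      unfolding tangent_good_def
    proof (intro ballI allI impI)
      fix y \<eta> assume y: "y \<in> C" "dist y x < min (\<delta> / 2) \<kappa>" and \<eta>: "0 < \<eta>" "\<eta> < min (\<delta> / 2) \<kappa>"
      have "N (y - x) \<le> \<delta>"
        using y N(2)[of "y - x"] by (simp add: dist_norm)
      then obtain u where u: "u \<in> C" "N (u - (y + \<eta> *\<^sub>R v)) \<le> \<eta> * a"
        using *[of y \<eta>] y \<eta> by auto
      have "dist (y + \<eta> *\<^sub>R v) u \<le> \<eta> * a"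
        using u(2) N(1)[of "u - (y + \<eta> *\<^sub>R v)"] by (simp add: dist_norm norm_minus_commute)
      then show "infdist (y + \<eta> *\<^sub>R v) C \<le> \<eta> * a"
        using u(1) by (intro infdist_le2)
    qed
    then show "\<exists>b>0. tangent_good C x v a b"
      using \<delta> by (intro exI[of _ "min (\<delta> / 2) \<kappa>"]) auto
  next
    fix \<epsilon> :: real assume \<epsilon>: "\<epsilon> > 0" and R: "\<forall>a>0. \<exists>b>0. tangent_good C x v a b"
    \<comment> \<open>One factor 2 passes from the distance to a point that nearly attains it, the
      other from the Euclidean to the sum norm.\<close>
    then obtain b where b: "b > 0" "tangent_good C x v (\<epsilon> / 4) b"
      by (meson divide_pos_pos zero_less_numeral)
    show "\<exists>\<delta>>0. \<exists>\<kappa>>0. \<forall>y\<in>C. N (y - x) \<le> \<delta> \<longrightarrow> (\<forall>\<eta>. 0 < \<eta> \<longrightarrow> \<eta> \<le> \<kappa> \<longrightarrow>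
      (\<exists>u\<in>C. N (u - (y + \<eta> *\<^sub>R v)) \<le> \<eta> * \<epsilon>))"
    proof (intro exI[of _ "b / 2"] conjI ballI allI impI)
      fix y \<eta> assume y: "y \<in> C" "N (y - x) \<le> b / 2" and \<eta>: "0 < \<eta>" "\<eta> \<le> b / 2"
      have "dist y x < b"
        using y(2) N(1)[of "y - x"] b(1) unfolding dist_norm by linarith
      then have "infdist (y + \<eta> *\<^sub>R v) C \<le> \<eta> * (\<epsilon> / 4)"
        using b y(1) \<eta> unfolding tangent_good_def by (metis field_sum_of_halves less_add_same_cancel1 half_gt_zero order_le_less_trans)
      also have "\<dots> < \<eta> * \<epsilon> / 2"
        using \<eta> \<epsilon> by simp
      finally obtain u where u: "u \<in> C" "dist (y + \<eta> *\<^sub>R v) u < \<eta> * \<epsilon> / 2"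
        using y(1) infdist_less_iff[of C "y + \<eta> *\<^sub>R v" "\<eta> * \<epsilon> / 2"] by blast
      have "N (u - (y + \<eta> *\<^sub>R v)) \<le> 2 * dist (y + \<eta> *\<^sub>R v) u"
        using N(2)[of "u - (y + \<eta> *\<^sub>R v)"] by (simp add: dist_norm norm_minus_commute)
      also have "\<dots> \<le> \<eta> * \<epsilon>"
        using u(2) by simp
      finally show "\<exists>u\<in>C. N (u - (y + \<eta> *\<^sub>R v)) \<le> \<eta> * \<epsilon>"
        using u(1) by blast
    qed (use b in auto)
  qed
qed

section \<open>Lebesgue-Bochner spaces and their seminorms\<close>

lemma Lp_iff:
  assumes "p \<ge> 1"
  shows "f \<in> Lp M (ennreal p) \<longleftrightarrow> f \<in> borel_measurable M \<and> integrable M (\<lambda>t. norm (f t) powr p)"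
  using assms by (auto simp: Lp_def)

lemma Lp_measurable: "f \<in> Lp M p \<Longrightarrow> f \<in> borel_measurable M"
  by (simp add: Lp_def)

lemma Lp_bound:
  assumes p: "p \<ge> 1" and f: "f \<in> borel_measurable M" and g: "integrable M g"
    and le: "AE t in M. norm (f t) powr p \<le> g t"
  shows "f \<in> Lp M (ennreal p)"
  unfolding Lp_iff[OF p]
proof (intro conjI f)
  show "integrable M (\<lambda>t. norm (f t) powr p)"
    by (rule Bochner_Integration.integrable_bound[OF g]) (use f le in \<open>auto elim: eventually_mono\<close>)
qed

lemma Lp_mono:
  assumes p: "p \<ge> 1" and f: "f \<in> borel_measurable M" and g: "g \<in> Lp M (ennreal p)"
    and le: "AE t in M. norm (f t) \<le> norm (g t)"
  shows "f \<in> Lp M (ennreal p)"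
proof (rule Lp_bound[OF p f])
  show "integrable M (\<lambda>t. norm (g t) powr p)"
    using g by (simp add: Lp_iff[OF p])
  show "AE t in M. norm (f t) powr p \<le> norm (g t) powr p"
    using le by eventually_elim (use p in \<open>auto intro!: powr_mono2\<close>)
qed

text \<open>The sum is at most twice the larger norm. The constant is crude, but only integrability
  of the left side is drawn from it.\<close>

lemma norm_add_powr_le:
  assumes "p \<ge> 1"
  shows "norm (a + b) powr p \<le> 2 powr p * (norm a powr p + norm b powr p)"
proof -
  have "norm (a + b) \<le> 2 * max (norm a) (norm b)"
    using norm_triangle_ineq[of a b] by linarith
  then have "norm (a + b) powr p \<le> (2 * max (norm a) (norm b)) powr p"
    using assms by (intro powr_mono2) auto
  also have "\<dots> = 2 powr p * max (norm a) (norm b) powr p"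
    by (intro powr_mult)
  also have "max (norm a) (norm b) powr p \<le> norm a powr p + norm b powr p"
    by (cases "norm a \<le> norm b") (auto simp: max_def)
  finally show ?thesis
    by simp
qed

lemma Lp_add:
  fixes f g :: "'t \<Rightarrow> 'a::{real_normed_vector, second_countable_topology}"
  assumes p: "p \<ge> 1" and "f \<in> Lp M (ennreal p)" "g \<in> Lp M (ennreal p)"
  shows "(\<lambda>t. f t + g t) \<in> Lp M (ennreal p)"
proof (rule Lp_bound[OF p])
  show "(\<lambda>t. f t + g t) \<in> borel_measurable M"
    using assms by (auto dest!: Lp_measurable)
  show "integrable M (\<lambda>t. 2 powr p * (norm (f t) powr p + norm (g t) powr p))"
    using assms by (auto simp: Lp_iff[OF p])
qed (use norm_add_powr_le[OF p] in auto)

lemma Lp_scale: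
  fixes f :: "'t \<Rightarrow> 'a::real_normed_vector"
  assumes p: "p \<ge> 1" and f: "f \<in> Lp M (ennreal p)"
  shows "(\<lambda>t. c *\<^sub>R f t) \<in> Lp M (ennreal p)"
proof (rule Lp_bound[OF p])
  show "(\<lambda>t. c *\<^sub>R f t) \<in> borel_measurable M"
    using Lp_measurable[OF f] by measurable
  show "integrable M (\<lambda>t. \<bar>c\<bar> powr p * norm (f t) powr p)"
    using f by (auto simp: Lp_iff[OF p])
qed (auto simp: powr_mult)

lemma Lp_diff:
  fixes f g :: "'t \<Rightarrow> 'a::{real_normed_vector, second_countable_topology}"
  assumes p: "p \<ge> 1" and "f \<in> Lp M (ennreal p)" "g \<in> Lp M (ennreal p)"
  shows "(\<lambda>t. f t - g t) \<in> Lp M (ennreal p)"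
  using Lp_add[OF p assms(2) Lp_scale[OF p assms(3), of "-1"]] by simp

definition Lp_norm :: "'t measure \<Rightarrow> real \<Rightarrow> ('t \<Rightarrow> 'a::real_normed_vector) \<Rightarrow> real" where
  "Lp_norm M p f = (\<integral>t. norm (f t) powr p \<partial>M) powr (1 / p)"

lemma Lp_norm_scale:
  assumes "p \<ge> 1"
  shows "Lp_norm M p (\<lambda>t. c *\<^sub>R f t) = \<bar>c\<bar> * Lp_norm M p f"
  using assms by (simp add: Lp_norm_def powr_mult powr_powr)

lemma powr_inverse_le_iff:
  assumes "p \<ge> 1" "x \<ge> 0" "c \<ge> 0"
  shows "x powr (1 / p) \<le> c \<longleftrightarrow> x \<le> c powr (p::real)"
proof
  assume "x powr (1 / p) \<le> c"
  then have "(x powr (1 / p)) powr p \<le> c powr p"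
    using assms by (intro powr_mono2) auto
  then show "x \<le> c powr p"
    using assms by (simp add: powr_powr)
next
  assume "x \<le> c powr p"
  then have "x powr (1 / p) \<le> (c powr p) powr (1 / p)"
    using assms by (intro powr_mono2) auto
  then show "x powr (1 / p) \<le> c"
    using assms by (simp add: powr_powr)
qed

text \<open>Estimates are carried out on integrals of \<open>p\<close>-th powers, where pointwise
  bounds can be integrated; this passes between the two forms.\<close>

lemma Lp_norm_le_iff:
  assumes "p \<ge> 1" "c \<ge> 0"
  shows "Lp_norm M p f \<le> c \<longleftrightarrow> (\<integral>t. norm (f t) powr p \<partial>M) \<le> c powr p"
  unfolding Lp_norm_def by (rule powr_inverse_le_iff[OF assms(1) _ assms(2)]) simp

lemma Lp_norm_leI:
  assumes p: "p \<ge> 1" and f: "f \<in> borel_measurable M" and g: "integrable M g"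
    and le: "AE t in M. norm (f t) powr p \<le> g t" and c: "(\<integral>t. g t \<partial>M) \<le> c powr p" "c \<ge> 0"
  shows "f \<in> Lp M (ennreal p) \<and> Lp_norm M p f \<le> c"
proof
  show L: "f \<in> Lp M (ennreal p)"
    by (rule Lp_bound[OF p f g le])
  have "(\<integral>t. norm (f t) powr p \<partial>M) \<le> (\<integral>t. g t \<partial>M)"
    using L g le by (intro integral_mono_AE) (auto simp: Lp_iff[OF p])
  then show "Lp_norm M p f \<le> c"
    using Lp_norm_le_iff[OF p c(2)] c(1) by fastforce
qed

lemma Lp_norm_nonneg: "Lp_norm M p f \<ge> 0"
  by (simp add: Lp_norm_def)

lemma vec_nspace_Lp:
  assumes p: "p \<ge> 1"
  shows "vec_nspace (Lp_nspace M p :: ('t \<Rightarrow> 'a::{real_normed_vector, second_countable_topology}) nspace)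
    (\<lambda>f g t. f t - g t)"
proof
  fix x y :: "'t \<Rightarrow> 'a" and c
  assume "x \<in> points (Lp_nspace M p)"
  then have x: "x \<in> Lp M (ennreal p)"
    by (simp add: Lp_nspace_def)
  show "norm_of (Lp_nspace M p) (scale_of (Lp_nspace M p) c x) = \<bar>c\<bar> * norm_of (Lp_nspace M p) x"
    using Lp_norm_scale[OF p] by (simp add: Lp_nspace_def Lp_norm_def)
  show "scale_of (Lp_nspace M p) c x \<in> points (Lp_nspace M p)"
    using x Lp_scale[OF p] by (simp add: Lp_nspace_def)
  assume "y \<in> points (Lp_nspace M p)"
  then have y: "y \<in> Lp M (ennreal p)"
    by (simp add: Lp_nspace_def)
  show "plus_of (Lp_nspace M p) x y \<in> points (Lp_nspace M p)" "(\<lambda>t. y t - x t) \<in> points (Lp_nspace M p)"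
    using x y Lp_add[OF p] Lp_diff[OF p] by (simp_all add: Lp_nspace_def)
qed (auto simp: Lp_nspace_def algebra_simps)

text \<open>The two components of a pair are measured with different exponents; the smaller of the
  two roots of \<open>c / (A + 1)\<close> serves both. The summand 1 covers
  \<open>A = 0\<close>.\<close>

lemma ex_small_powr:
  fixes p r A c :: real
  assumes "p > 0" "r > 0" "A \<ge> 0" "c > 0"
  obtains s where "s > 0" "s powr p * A \<le> c" "s powr r * A \<le> c"
proof -
  define z where "z = c / (A + 1)"
  have z: "z > 0" "z * A \<le> c"
    using assms by (auto simp: z_def field_simps)
  define s where "s = min (z powr (1 / p)) (z powr (1 / r))"
  have s: "s > 0"
    using z by (simp add: s_def)
  have "s powr p \<le> (z powr (1 / p)) powr p" "s powr r \<le> (z powr (1 / r)) powr r"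
    using assms s unfolding s_def by (auto intro!: powr_mono2)
  then have "s powr p \<le> z" "s powr r \<le> z"
    using assms z by (simp_all add: powr_powr)
  then have "s powr p * A \<le> z * A" "s powr r * A \<le> z * A"
    using assms by (auto intro: mult_right_mono)
  then show ?thesis
    using s z by (intro that[of s]) auto
qed

lemma Sel_iff: "(a, b) \<in> Sel M p r S \<longleftrightarrow> a \<in> Lp M p \<and> b \<in> Lp M r \<and> (AE t in M. (a t, b t) \<in> S t)"
  by (simp add: Sel_def)

lemma clarke_tangent_cone_Lp_prod:
  fixes C :: "(('t \<Rightarrow> 'z::{real_normed_vector, second_countable_topology}) \<times>
    ('t \<Rightarrow> 'y::{real_normed_vector, second_countable_topology})) set"
  assumes p: "p \<ge> 1" and r: "r \<ge> 1" and C: "C \<subseteq> Lp M (ennreal p) \<times> Lp M (ennreal r)"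
    and x: "(x1, x2) \<in> C"
  shows "(v1, v2) \<in> clarke_tangent_cone (prod_nspace (Lp_nspace M p) (Lp_nspace M r)) C (x1, x2) \<longleftrightarrow>
    v1 \<in> Lp M (ennreal p) \<and> v2 \<in> Lp M (ennreal r) \<and> (\<forall>\<epsilon>>0. \<exists>\<delta>>0. \<exists>\<kappa>>0. \<forall>y1 y2. (y1, y2) \<in> C \<longrightarrow>
      Lp_norm M p (\<lambda>t. y1 t - x1 t) + Lp_norm M r (\<lambda>t. y2 t - x2 t) \<le> \<delta> \<longrightarrow>
      (\<forall>\<eta>. 0 < \<eta> \<longrightarrow> \<eta> \<le> \<kappa> \<longrightarrow> (\<exists>u1 u2. (u1, u2) \<in> C \<and>
        Lp_norm M p (\<lambda>t. u1 t - (y1 t + \<eta> *\<^sub>R v1 t)) + Lp_norm M r (\<lambda>t. u2 t - (y2 t + \<eta> *\<^sub>R v2 t)) \<le> \<eta> * \<epsilon>)))"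
proof -
  interpret vec_nspace "prod_nspace (Lp_nspace M p :: ('t \<Rightarrow> 'z) nspace) (Lp_nspace M r :: ('t \<Rightarrow> 'y) nspace)"
    "\<lambda>(a, b) (a', b'). (\<lambda>t. a t - a' t, \<lambda>t. b t - b' t)"
    using vec_nspace_prod[OF vec_nspace_Lp[OF p] vec_nspace_Lp[OF r]] .
  have pts: "points (prod_nspace (Lp_nspace M p) (Lp_nspace M r)) = Lp M (ennreal p) \<times> Lp M (ennreal r)"
    by (simp add: prod_nspace_def Lp_nspace_def)
  show ?thesis
    unfolding clarke_tangent_cone_iff[unfolded pts, OF C subsetD[OF C x]]
    by (simp add: prod_nspace_def Lp_nspace_def Lp_norm_def Ball_def Bex_def)
qed

section \<open>Tangent cone of a set of measurable selections\<close>

locale closed_multifunction = sigma_finite_measure M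
  for M :: "'t measure" +
  fixes C :: "'t \<Rightarrow> ('z::{banach, second_countable_topology} \<times> 'y::{banach, second_countable_topology}) set"
    and p r :: real
  assumes C: "measurable_closed_multifunction M C" and p: "1 \<le> p" and r: "1 \<le> r"
begin

abbreviation "SelC \<equiv> Sel M (ennreal p) (ennreal r) C"

abbreviation tcone :: "('t \<Rightarrow> 'z \<times> 'y) \<Rightarrow> 't \<Rightarrow> ('z \<times> 'y) set" where
  "tcone x t \<equiv> clarke_tangent_cone (prod_nspace type_nspace type_nspace) (C t) (x t)"

definition is_castaing :: "(nat \<Rightarrow> 't \<Rightarrow> 'z \<times> 'y) \<Rightarrow> bool" where
  "is_castaing c \<longleftrightarrow> (\<forall>n. c n \<in> borel_measurable M) \<and>
    (AE t in M. range (\<lambda>n. c n t) \<subseteq> C t \<and> C t \<subseteq> closure (range (\<lambda>n. c n t)))"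

text \<open>One representation is fixed for the whole locale, so that tangency at all points
  \<open>x\<close> is tested on the same sequence and outside the same null set.\<close>

definition castaing :: "nat \<Rightarrow> 't \<Rightarrow> 'z \<times> 'y" where
  "castaing = (SOME c. is_castaing c)"

lemma castaing_measurable[measurable]: "castaing n \<in> borel_measurable M"
  and AE_castaing: "AE t in M. range (\<lambda>n. castaing n t) \<subseteq> C t \<and> C t \<subseteq> closure (range (\<lambda>n. castaing n t))"
proof -
  obtain c :: "nat \<Rightarrow> 't \<Rightarrow> 'z \<times> 'y" where "\<And>n. c n \<in> borel_measurable M"
    "AE t in M. range (\<lambda>n. c n t) \<subseteq> C t \<and> C t \<subseteq> closure (range (\<lambda>n. c n t))"
    by (erule ex_Castaing_representation[OF C])
  then have "is_castaing c"
    unfolding is_castaing_def by (intro conjI allI)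
  then have "is_castaing castaing"
    unfolding castaing_def by (rule someI[of is_castaing])
  then show "castaing n \<in> borel_measurable M"
    "AE t in M. range (\<lambda>n. castaing n t) \<subseteq> C t \<and> C t \<subseteq> closure (range (\<lambda>n. castaing n t))"
    by (simp_all add: is_castaing_def)
qed

lemmas infdist_measurable[measurable] = borel_measurable_infdist_compose[OF C]

definition dense_good :: "('t \<Rightarrow> 'z \<times> 'y) \<Rightarrow> 't \<Rightarrow> 'z \<times> 'y \<Rightarrow> real \<Rightarrow> real \<Rightarrow> bool" where
  "dense_good x t w a b \<longleftrightarrow> (\<forall>n (q::rat). dist (castaing n t) (x t) < b \<longrightarrow> 0 < real_of_rat q \<longrightarrow>
     real_of_rat q < b \<longrightarrow> infdist (castaing n t + real_of_rat q *\<^sub>R w) (C t) \<le> real_of_rat q * a)"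

lemma dense_good_measurable[measurable]:
  assumes [measurable]: "x \<in> borel_measurable M" "v \<in> borel_measurable M" "a \<in> borel_measurable M"
  shows "Measurable.pred M (\<lambda>t. dense_good x t (v t) (a t) b)"
  unfolding dense_good_def by measurable

text \<open>The null set is that of \<open>AE_castaing\<close> and does not depend on
  \<open>x\<close>, \<open>w\<close>, \<open>a\<close> or \<open>b\<close>. The quantifiers can
  therefore stand inside, although they range over uncountable sets.\<close>

lemma AE_dense_good: "AE t in M. \<forall>x w a b. dense_good x t w a b \<longleftrightarrow> tangent_good (C t) (x t) w a b"
  using AE_castaing
proof eventually_elim
  case (elim t)
  then show ?case
    unfolding dense_good_def by (simp add: tangent_good_dense_iff[of "\<lambda>n. castaing n t" "C t"])
qed

text \<open>A perturbation bounded by \<open>e\<close> is small in both components at once. The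
  bound \<open>h t \<le> 1\<close> serves later to compare the weighted mass of a set with the
  integral of a function that is at least 1 on it.\<close>

lemma ex_weight:
  obtains h e :: "'t \<Rightarrow> real" where "h \<in> borel_measurable M" "e \<in> borel_measurable M" "integrable M h"
    "\<And>t. 0 < h t" "\<And>t. h t \<le> 1" "\<And>t. 0 < e t" "\<And>t. e t powr p \<le> h t" "\<And>t. e t powr r \<le> h t"
proof -
  obtain h :: "'t \<Rightarrow> real" where h[measurable]: "h \<in> borel_measurable M" and
    h': "\<And>x. h x > 0" "\<And>x. h x \<le> 1" "integrable M h"
    using obtain_positive_integrable_function by metis
  define e where "e t = min (h t powr (1 / p)) (h t powr (1 / r))" for t
  have [measurable]: "e \<in> borel_measurable M"
    unfolding e_def by measurable
  have e0: "0 < e t" for t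
    using h'(1)[of t] by (simp add: e_def)
  have "e t powr p \<le> (h t powr (1 / p)) powr p" "e t powr r \<le> (h t powr (1 / r)) powr r" for t
    using e0[of t] p r by (auto simp: e_def intro!: powr_mono2)
  then have "e t powr p \<le> h t" "e t powr r \<le> h t" for t
    using p r by (simp_all add: powr_powr abs_of_pos[OF h'(1)])
  then show ?thesis
    using that[of h e] h h' e0 by simp
qed

text \<open>Besides the points where tangency is not yet uniform there is a second bad set,
  depending on the competitor \<open>y\<close>: the \<open>t\<close> at which \<open>y t\<close> is
  far from \<open>x t\<close>. On \<open>G k\<close> the direction is bounded by \<open>k\<close>,
  so by Chebyshev's inequality staying at \<open>y t\<close> costs little there if \<open>y\<close>
  is close to \<open>x\<close> in norm. This is why \<open>\<delta>\<close> is chosen after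
  \<open>k\<close>.\<close>

lemma tangent_AE_imp:
  assumes x: "(x1, x2) \<in> SelC" and v1: "v1 \<in> Lp M (ennreal p)" and v2: "v2 \<in> Lp M (ennreal r)"
    and v: "AE t in M. (v1 t, v2 t) \<in> tcone (\<lambda>t. (x1 t, x2 t)) t"
  shows "(v1, v2) \<in> clarke_tangent_cone (prod_nspace (Lp_nspace M p) (Lp_nspace M r)) SelC (x1, x2)"
proof -
  have sub: "SelC \<subseteq> Lp M (ennreal p) \<times> Lp M (ennreal r)"
    by (auto simp: Sel_def)
  have x1: "x1 \<in> Lp M (ennreal p)" and x2: "x2 \<in> Lp M (ennreal r)"
    using x by (auto simp: Sel_iff)
  note [measurable] = Lp_measurable[OF x1] Lp_measurable[OF x2] Lp_measurable[OF v1] Lp_measurable[OF v2]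
  define x where "x t = (x1 t, x2 t)" for t
  define w where "w t = (v1 t, v2 t)" for t
  have [measurable]: "x \<in> borel_measurable M" "w \<in> borel_measurable M"
    unfolding x_def w_def by measurable
  obtain h e :: "'t \<Rightarrow> real" where [measurable]: "h \<in> borel_measurable M" "e \<in> borel_measurable M" and
    h: "integrable M h" "\<And>t. 0 < h t" "\<And>t. h t \<le> 1" and
    e: "\<And>t. 0 < e t" "\<And>t. e t powr p \<le> h t" "\<And>t. e t powr r \<le> h t"
    by (rule ex_weight) blast
  show ?thesis
    unfolding clarke_tangent_cone_Lp_prod[OF p r sub x]
  proof (intro conjI v1 v2 allI impI)
    fix \<epsilon> :: real assume \<epsilon>: "\<epsilon> > 0"
    \<comment> \<open>Each component may use \<open>\<epsilon> / 2\<close>. Its \<open>p\<close>-th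
      or \<open>r\<close>-th power is shared by three errors: the selection tolerance, the part of
      the direction outside \<open>G k\<close>, and the points where \<open>y t\<close> is far from
      \<open>x t\<close>.\<close>
    define \<tau> where "\<tau> = min ((\<epsilon> / 2) powr p) ((\<epsilon> / 2) powr r) / 3"
    have \<tau>: "\<tau> > 0" "3 * \<tau> \<le> (\<epsilon> / 2) powr p" "3 * \<tau> \<le> (\<epsilon> / 2) powr r"
      using \<epsilon> by (auto simp: \<tau>_def)
    obtain s where s: "s > 0" "s powr p * (\<integral>t. h t \<partial>M) \<le> \<tau>" "s powr r * (\<integral>t. h t \<partial>M) \<le> \<tau>"
      using ex_small_powr[of p r "\<integral>t. h t \<partial>M" \<tau>] p r \<tau>(1) h(2) by (auto simp: less_imp_le)
    \<comment> \<open>The tolerance shrinks with the weight so that its powers are integrable; only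
      \<open>s / 2\<close> is demanded, which leaves room to replace the distance by a point of the
      representation.\<close>
    define G where "G k = {t \<in> space M. dense_good x t (w t) (s / 2 * e t) (1 / Suc k) \<and> norm (w t) \<le> real k}" for k
    have [measurable]: "G k \<in> sets M" for k
      unfolding G_def by measurable
    have AE_G: "AE t in M. \<forall>\<^sub>F k in sequentially. t \<in> G k"
      using v AE_dense_good AE_space
    proof eventually_elim
      case (elim t)
      have "\<exists>b>0. tangent_good (C t) (x t) (w t) (s / 2 * e t) b"
        using elim(1) s(1) e(1)[of t] unfolding clarke_tangent_cone_type_prod x_def w_def by simp
      then obtain b where b: "b > 0" "tangent_good (C t) (x t) (w t) (s / 2 * e t) b"
        by blast
      obtain k0 where k0: "inverse (real (Suc k0)) < b"
        using reals_Archimedean[OF b(1)] by blast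
      have "t \<in> G k" if "k \<ge> max k0 (nat \<lceil>norm (w t)\<rceil>)" for k
      proof -
        have "1 / Suc k \<le> 1 / Suc k0"
          using that by (simp add: frac_le)
        then have "1 / Suc k \<le> b"
          using k0 by (simp add: inverse_eq_divide)
        then have "tangent_good (C t) (x t) (w t) (s / 2 * e t) (1 / Suc k)"
          using b(2) tangent_good_mono by blast
        moreover have "norm (w t) \<le> real k"
          using that by (simp add: nat_le_iff ceiling_le_iff)
        ultimately show ?thesis
          using elim(2,3) unfolding G_def by blast
      qed
      then show ?case
        unfolding eventually_sequentially by blast
    qed
    have lim: "(\<lambda>k. \<integral>t. indicator (- G k) t * norm (f t) powr q \<partial>M) \<longlonglongrightarrow> 0"
      if q: "q \<ge> 1" and f: "f \<in> Lp M (ennreal q)" for q and f :: "'t \<Rightarrow> 'c::real_normed_vector"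
    proof -
      note [measurable] = Lp_measurable[OF f]
      have "(\<lambda>k. \<integral>t. indicator (- G k) t * norm (f t) powr q \<partial>M) \<longlonglongrightarrow> (\<integral>t. 0 \<partial>M)"
      proof (rule integral_dominated_convergence)
        show "integrable M (\<lambda>t. norm (f t) powr q)"
          using f by (simp add: Lp_iff[OF q])
        show "AE t in M. (\<lambda>k. indicator (- G k) t * norm (f t) powr q) \<longlonglongrightarrow> 0"
          using AE_G
        proof eventually_elim
          case (elim t)
          show ?case
            by (rule tendsto_eventually) (use elim in eventually_elim, simp)
        qed
        show "AE t in M. norm (indicator (- G k) t * norm (f t) powr q) \<le> norm (f t) powr q" for k
          by (auto split: split_indicator)
        show "(\<lambda>t. indicator (- G k) t * norm (f t) powr q) \<in> borel_measurable M" for k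
          using sets.compl_sets[of "G k" M]
          by (intro borel_measurable_times) (auto simp: indicator_def intro!: measurable_If)
      qed simp
      then show ?thesis
        by simp
    qed
    have "\<forall>\<^sub>F k in sequentially. (\<integral>t. indicator (- G k) t * norm (v1 t) powr p \<partial>M) < \<tau> \<and>
        (\<integral>t. indicator (- G k) t * norm (v2 t) powr r \<partial>M) < \<tau>"
      using order_tendstoD(2)[OF lim[OF p v1] \<tau>(1)] order_tendstoD(2)[OF lim[OF r v2] \<tau>(1)]
      by eventually_elim simp
    then obtain k where k: "(\<integral>t. indicator (- G k) t * norm (v1 t) powr p \<partial>M) < \<tau>"
        "(\<integral>t. indicator (- G k) t * norm (v2 t) powr r \<partial>M) < \<tau>"
      unfolding eventually_sequentially by blast
    define b where "b = 1 / real (Suc k)"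
    have b: "b > 0"
      by (simp add: b_def)
    \<comment> \<open>\<open>K\<close> bounds both powers of the direction on \<open>G k\<close>,
      and \<open>z = 2 * \<delta> / b\<close> is the ratio that the Chebyshev estimate below
      produces.\<close>
    define K where "K = real k powr p + real k powr r"
    obtain z where z: "z > 0" "z powr p * K \<le> \<tau> / 2" "z powr r * K \<le> \<tau> / 2"
      using ex_small_powr[of p r K "\<tau> / 2"] p r \<tau>(1) by (auto simp: K_def)
    define \<delta> where "\<delta> = z * b / 2"
    have \<delta>: "\<delta> > 0" "2 * \<delta> / b = z"
      using z b by (auto simp: \<delta>_def)
    show "\<exists>\<delta>>0. \<exists>\<kappa>>0. \<forall>y1 y2. (y1, y2) \<in> SelC \<longrightarrow>
      Lp_norm M p (\<lambda>t. y1 t - x1 t) + Lp_norm M r (\<lambda>t. y2 t - x2 t) \<le> \<delta> \<longrightarrow>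
      (\<forall>\<eta>. 0 < \<eta> \<longrightarrow> \<eta> \<le> \<kappa> \<longrightarrow> (\<exists>u1 u2. (u1, u2) \<in> SelC \<and>
        Lp_norm M p (\<lambda>t. u1 t - (y1 t + \<eta> *\<^sub>R v1 t)) + Lp_norm M r (\<lambda>t. u2 t - (y2 t + \<eta> *\<^sub>R v2 t)) \<le> \<eta> * \<epsilon>))"
    proof (rule exI[of _ \<delta>], rule conjI[OF \<delta>(1)], rule exI[of _ "b / 2"], intro conjI allI impI)
      show "b / 2 > 0"
        using b by simp
      fix y1 y2 \<eta> assume y: "(y1, y2) \<in> SelC"
        and close: "Lp_norm M p (\<lambda>t. y1 t - x1 t) + Lp_norm M r (\<lambda>t. y2 t - x2 t) \<le> \<delta>"
        and \<eta>: "0 < \<eta>" "\<eta> \<le> b / 2"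
      have y1: "y1 \<in> Lp M (ennreal p)" and y2: "y2 \<in> Lp M (ennreal r)" and yC: "AE t in M. (y1 t, y2 t) \<in> C t"
        using y by (auto simp: Sel_iff)
      note [measurable] = Lp_measurable[OF y1] Lp_measurable[OF y2]
      define y where "y t = (y1 t, y2 t)" for t
      have [measurable]: "y \<in> borel_measurable M"
        unfolding y_def by measurable
      \<comment> \<open>If \<open>y t\<close> and \<open>x t\<close> are at distance at least
        \<open>b\<close>, one of their components differs by at least \<open>b / 2\<close>. Hence
        \<open>m\<close> is an integrable function that is at least 1 at these points.\<close>
      define m where "m t = (2 / b) powr p * norm (y1 t - x1 t) powr p + (2 / b) powr r * norm (y2 t - x2 t) powr r" for t
      have yx: "integrable M (\<lambda>t. norm (y1 t - x1 t) powr p)" "integrable M (\<lambda>t. norm (y2 t - x2 t) powr r)"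
        using Lp_diff[OF p y1 x1] Lp_diff[OF r y2 x2] by (simp_all add: Lp_iff[OF p] Lp_iff[OF r])
      then have m_int: "integrable M m"
        unfolding m_def by simp
      have m0: "m t \<ge> 0" for t
        by (simp add: m_def)
      have "Lp_norm M p (\<lambda>t. y1 t - x1 t) \<le> \<delta>" "Lp_norm M r (\<lambda>t. y2 t - x2 t) \<le> \<delta>"
        using close Lp_norm_nonneg[of M p "\<lambda>t. y1 t - x1 t"] Lp_norm_nonneg[of M r "\<lambda>t. y2 t - x2 t"] by auto
      then have "(\<integral>t. norm (y1 t - x1 t) powr p \<partial>M) \<le> \<delta> powr p" "(\<integral>t. norm (y2 t - x2 t) powr r \<partial>M) \<le> \<delta> powr r"
        using \<delta>(1) by (simp_all add: Lp_norm_le_iff[OF p] Lp_norm_le_iff[OF r])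
      then have "(\<integral>t. m t \<partial>M) \<le> (2 / b) powr p * \<delta> powr p + (2 / b) powr r * \<delta> powr r"
        unfolding m_def using yx by (simp add: add_mono mult_left_mono)
      also have "\<dots> = z powr p + z powr r"
        using \<delta> b by (simp flip: powr_mult)
      finally have m_le: "(\<integral>t. m t \<partial>M) \<le> z powr p + z powr r" .
      have m_small: "real k powr q * (\<integral>t. m t \<partial>M) \<le> \<tau>" if "q = p \<or> q = r" for q
      proof -
        have "real k powr q * (\<integral>t. m t \<partial>M) \<le> K * (z powr p + z powr r)"
          using that m_le m0 by (intro mult_mono) (auto simp: K_def)
        also have "\<dots> \<le> \<tau>"
          using z by (simp add: algebra_simps)
        finally show ?thesis .
      qed
      have m1: "m t \<ge> 1" if "dist (y t) (x t) \<ge> b" for t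
      proof -
        have "b \<le> norm (y1 t - x1 t) + norm (y2 t - x2 t)"
          using that norm_prod_le_sum[of "y t - x t"] by (simp add: dist_norm x_def y_def)
        then consider "1 \<le> 2 / b * norm (y1 t - x1 t)" | "1 \<le> 2 / b * norm (y2 t - x2 t)"
          using b by (auto simp: field_simps) linarith
        then show ?thesis
        proof cases
          case 1
          then have "1 \<le> (2 / b * norm (y1 t - x1 t)) powr p"
            using p by (intro ge_one_powr_ge_zero) auto
          also have "\<dots> = (2 / b) powr p * norm (y1 t - x1 t) powr p"
            using b by (intro powr_mult)
          finally show ?thesis
            by (simp add: m_def add_increasing2)
        next
          case 2
          then have "1 \<le> (2 / b * norm (y2 t - x2 t)) powr r"
            using r by (intro ge_one_powr_ge_zero) auto
          also have "\<dots> = (2 / b) powr r * norm (y2 t - x2 t) powr r"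
            using b by (intro powr_mult)
          finally show ?thesis
            by (simp add: m_def add_increasing)
        qed
      qed
      define near where "near n t \<longleftrightarrow> norm (castaing n t - (y t + \<eta> *\<^sub>R w t)) < \<eta> * (s * e t)" for n t
      define good where "good t \<longleftrightarrow> t \<in> G k \<and> dist (y t) (x t) < b" for t
      \<comment> \<open>At a good point the first member of the representation near the target is
        taken, a choice measurable in \<open>t\<close>. Elsewhere \<open>u\<close> stays at
        \<open>y t\<close>, which lies in \<open>C t\<close> almost everywhere, and the error is
        \<open>\<eta>\<close> times the direction.\<close>
      define u where "u t = (if good t then castaing (LEAST n. near n t) t else y t)" for t
      have [measurable]: "Measurable.pred M (near n)" for n
        unfolding near_def by measurable
      have [measurable]: "Measurable.pred M good"
        unfolding good_def by measurable
      have u_meas[measurable]: "u \<in> borel_measurable M"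
        unfolding u_def by measurable
      have AE_u: "AE t in M. u t \<in> C t \<and> (good t \<longrightarrow> norm (u t - (y t + \<eta> *\<^sub>R w t)) < \<eta> * (s * e t))"
        using yC AE_castaing AE_dense_good
      proof eventually_elim
        case (elim t)
        have yt: "y t \<in> C t"
          using elim by (simp add: y_def)
        have ex: "\<exists>n. near n t" if "good t"
        proof -
          have "tangent_good (C t) (x t) (w t) (s / 2 * e t) b"
            using that elim(3) unfolding good_def G_def b_def by blast
          then have "infdist (y t + \<eta> *\<^sub>R w t) (C t) \<le> \<eta> * (s / 2 * e t)"
            using that yt \<eta> b unfolding tangent_good_def good_def by simp
          also have "\<dots> < \<eta> * (s * e t)"
            using \<eta> s e(1)[of t] by simp
          finally have "\<exists>z\<in>C t. dist (y t + \<eta> *\<^sub>R w t) z < \<eta> * (s * e t)"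
            using yt infdist_less_iff[of "C t"] by blast
          then have "ball (y t + \<eta> *\<^sub>R w t) (\<eta> * (s * e t)) \<inter> closure (range (\<lambda>n. castaing n t)) \<noteq> {}"
            using elim by auto
          then have "ball (y t + \<eta> *\<^sub>R w t) (\<eta> * (s * e t)) \<inter> range (\<lambda>n. castaing n t) \<noteq> {}"
            using open_Int_closure_eq_empty[OF open_ball] by blast
          then show ?thesis
            by (auto simp: near_def dist_norm norm_minus_commute)
        qed
        show ?case
        proof (cases "good t")
          case True
          have "near (LEAST n. near n t) t"
            using ex[OF True] by (rule LeastI_ex[of "\<lambda>n. near n t"])
          moreover have "castaing (LEAST n. near n t) t \<in> C t"
            using elim(2) by blast
          ultimately show ?thesis
            using True by (simp add: u_def near_def)
        qed (use yt in \<open>simp add: u_def\<close>)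
      qed
      define d where "d t = u t - (y t + \<eta> *\<^sub>R w t)" for t
      have [measurable]: "d \<in> borel_measurable M"
        unfolding d_def by measurable
      \<comment> \<open>\<open>f\<close> stands for either projection and \<open>q\<close> for its
        exponent. The three summands on the right are the three errors that share
        \<open>\<tau>\<close>.\<close>
      have bound: "AE t in M. norm (f (d t)) powr q \<le>
          \<eta> powr q * (s powr q * h t + indicator (- G k) t * norm (f (w t)) powr q + real k powr q * m t)"
        if q: "q \<ge> 1" and eq: "\<And>t. e t powr q \<le> h t" and f: "\<And>a. norm (f a) \<le> norm a"
          "\<And>c a. f (c *\<^sub>R a) = c *\<^sub>R f a" for q and f :: "'z \<times> 'y \<Rightarrow> 'c::real_normed_vector"
        using AE_u AE_space
      proof eventually_elim
        case (elim t)
        show ?case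
        proof (cases "good t")
          case True
          then have "norm (f (d t)) \<le> \<eta> * (s * e t)"
            using elim f(1)[of "d t"] by (simp add: d_def)
          then have "norm (f (d t)) powr q \<le> (\<eta> * (s * e t)) powr q"
            using q by (intro powr_mono2) auto
          also have "\<dots> = \<eta> powr q * (s powr q * e t powr q)"
            by (simp add: powr_mult)
          also have "\<dots> \<le> \<eta> powr q * (s powr q * h t)"
            using eq by (intro mult_left_mono) auto
          also have "\<dots> \<le> \<eta> powr q * (s powr q * h t + indicator (- G k) t * norm (f (w t)) powr q + real k powr q * m t)"
            using m0[of t] by (intro mult_left_mono) auto
          finally show ?thesis .
        next
          case False
          then have "d t = (- \<eta>) *\<^sub>R w t"
            by (simp add: d_def u_def)
          then have "f (d t) = (- \<eta>) *\<^sub>R f (w t)"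
            by (simp only: f(2))
          then have "norm (f (d t)) powr q = \<eta> powr q * norm (f (w t)) powr q"
            using \<eta> by (simp add: powr_mult)
          also have "\<dots> \<le> \<eta> powr q * (s powr q * h t + indicator (- G k) t * norm (f (w t)) powr q + real k powr q * m t)"
          proof (rule mult_left_mono)
            show "norm (f (w t)) powr q \<le> s powr q * h t + indicator (- G k) t * norm (f (w t)) powr q + real k powr q * m t"
            proof (cases "t \<in> G k")
              case False
              then show ?thesis
                using m0[of t] h(2)[of t] by (simp add: less_imp_le)
            next
              case True
              then have "norm (f (w t)) \<le> real k"
                using f(1)[of "w t"] by (simp add: G_def)
              then have "norm (f (w t)) powr q \<le> real k powr q * 1"
                using q by (auto intro!: powr_mono2)
              also have "\<dots> \<le> real k powr q * m t"
                using m1[of t] True \<open>\<not> good t\<close> by (intro mult_left_mono) (auto simp: good_def)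
              finally show ?thesis
                using True h(2)[of t] by (simp add: less_imp_le add_increasing)
            qed
          qed simp
          finally show ?thesis .
        qed
      qed
      have concl: "(\<lambda>t. f (d t)) \<in> Lp M (ennreal q) \<and> Lp_norm M q (\<lambda>t. f (d t)) \<le> \<eta> * \<epsilon> / 2"
        if q: "q \<ge> 1" "q = p \<or> q = r" and eq: "\<And>t. e t powr q \<le> h t" and f: "\<And>a. norm (f a) \<le> norm a"
          "\<And>c a. f (c *\<^sub>R a) = c *\<^sub>R f a" and fm: "f \<in> borel_measurable borel"
          and fw: "(\<lambda>t. f (w t)) \<in> Lp M (ennreal q)"
          and small: "(\<integral>t. indicator (- G k) t * norm (f (w t)) powr q \<partial>M) < \<tau>"
        for q and f :: "'z \<times> 'y \<Rightarrow> 'c::real_normed_vector"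
      proof -
        have [measurable]: "(\<lambda>t. f (d t)) \<in> borel_measurable M"
          by (rule measurable_compose[OF _ fm]) measurable
        let ?g = "\<lambda>t. \<eta> powr q * (s powr q * h t + indicator (- G k) t * norm (f (w t)) powr q + real k powr q * m t)"
        have fwi: "integrable M (\<lambda>t. norm (f (w t)) powr q)"
          using fw by (simp add: Lp_iff[OF q(1)])
        \<comment> \<open>The complement \<open>- G k\<close> is taken in the whole type and need
          not belong to \<open>sets M\<close>; integrability is therefore obtained by subtracting
          the part on \<open>G k\<close>.\<close>
        have ind: "integrable M (\<lambda>t. indicator (- G k) t * norm (f (w t)) powr q)"
        proof -
          have "integrable M (\<lambda>t. norm (f (w t)) powr q - indicator (G k) t *\<^sub>R norm (f (w t)) powr q)"
            using fwi by (intro Bochner_Integration.integrable_diff integrable_mult_indicator) auto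
          moreover have "(\<lambda>t. norm (f (w t)) powr q - indicator (G k) t *\<^sub>R norm (f (w t)) powr q) =
              (\<lambda>t. indicator (- G k) t * norm (f (w t)) powr q)"
            by (auto simp: fun_eq_iff split: split_indicator)
          ultimately show ?thesis
            by simp
        qed
        have g: "integrable M ?g"
          using h(1) ind m_int by simp
        have B: "AE t in M. norm (f (d t)) powr q \<le> ?g t"
          by (rule bound) (use q eq f in auto)
        have "(\<integral>t. ?g t \<partial>M) = \<eta> powr q * (s powr q * (\<integral>t. h t \<partial>M) +
            (\<integral>t. indicator (- G k) t * norm (f (w t)) powr q \<partial>M) + real k powr q * (\<integral>t. m t \<partial>M))"
          using h(1) ind m_int by simp
        also have "\<dots> \<le> \<eta> powr q * (\<tau> + \<tau> + \<tau>)"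
          using s small m_small[of q] q by (intro mult_left_mono add_mono) auto
        also have "\<dots> \<le> \<eta> powr q * (\<epsilon> / 2) powr q"
          using \<tau> q by (intro mult_left_mono) auto
        also have "\<dots> = (\<eta> * \<epsilon> / 2) powr q"
          by (simp flip: powr_mult)
        finally show ?thesis
          using \<eta> \<epsilon> by (intro Lp_norm_leI[OF q(1) _ g B]) auto
      qed
      have fst_m: "(fst :: 'z \<times> 'y \<Rightarrow> 'z) \<in> borel_measurable borel"
        and snd_m: "(snd :: 'z \<times> 'y \<Rightarrow> 'y) \<in> borel_measurable borel"
        using borel_measurable_fst[of "\<lambda>w. w" borel] borel_measurable_snd[of "\<lambda>w. w" borel] by simp_all
      have 1: "(\<lambda>t. fst (d t)) \<in> Lp M (ennreal p) \<and> Lp_norm M p (\<lambda>t. fst (d t)) \<le> \<eta> * \<epsilon> / 2"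
        by (rule concl) (use p e v1 k in \<open>auto simp: w_def norm_fst_le fst_m\<close>)
      have 2: "(\<lambda>t. snd (d t)) \<in> Lp M (ennreal r) \<and> Lp_norm M r (\<lambda>t. snd (d t)) \<le> \<eta> * \<epsilon> / 2"
        by (rule concl) (use r e v2 k in \<open>auto simp: w_def norm_snd_le snd_m\<close>)
      have d12: "fst (d t) = fst (u t) - (y1 t + \<eta> *\<^sub>R v1 t)" "snd (d t) = snd (u t) - (y2 t + \<eta> *\<^sub>R v2 t)" for t
        by (simp_all add: d_def y_def w_def)
      have "(\<lambda>t. fst (u t)) \<in> Lp M (ennreal p)" "(\<lambda>t. snd (u t)) \<in> Lp M (ennreal r)"
        using Lp_add[OF p conjunct1[OF 1] Lp_add[OF p y1 Lp_scale[OF p v1, of \<eta>]]]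
          Lp_add[OF r conjunct1[OF 2] Lp_add[OF r y2 Lp_scale[OF r v2, of \<eta>]]] by (simp_all add: d12)
      moreover have "AE t in M. (fst (u t), snd (u t)) \<in> C t"
        using AE_u by eventually_elim simp
      ultimately have "(\<lambda>t. fst (u t), \<lambda>t. snd (u t)) \<in> SelC"
        by (simp add: Sel_iff)
      moreover have "Lp_norm M p (\<lambda>t. fst (u t) - (y1 t + \<eta> *\<^sub>R v1 t)) +
          Lp_norm M r (\<lambda>t. snd (u t) - (y2 t + \<eta> *\<^sub>R v2 t)) \<le> \<eta> * \<epsilon>"
        using 1 2 by (simp add: d12)
      ultimately show "\<exists>u1 u2. (u1, u2) \<in> SelC \<and>
        Lp_norm M p (\<lambda>t. u1 t - (y1 t + \<eta> *\<^sub>R v1 t)) + Lp_norm M r (\<lambda>t. u2 t - (y2 t + \<eta> *\<^sub>R v2 t)) \<le> \<eta> * \<epsilon>"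
        by blast
    qed
  qed
qed

text \<open>By monotonicity in both parameters it suffices to consider reciprocals of positive
  integers. Membership in the tangent cone then has the quantifier form of the selection theorem,
  outside one null set for all \<open>x\<close> and \<open>w\<close>.\<close>

lemma AE_dense_good_tcone:
  "AE t in M. \<forall>x w. (\<forall>j. \<exists>k. dense_good x t w (1 / real (Suc j)) (1 / real (Suc k))) \<longleftrightarrow> w \<in> tcone x t"
  using AE_dense_good
proof eventually_elim
  case (elim t)
  show ?case
  proof (intro allI iffI)
    fix x w assume R: "\<forall>j. \<exists>k. dense_good x t w (1 / real (Suc j)) (1 / real (Suc k))"
    show "w \<in> tcone x t"
      unfolding clarke_tangent_cone_type_prod
    proof (intro allI impI)
      fix a :: real assume "a > 0"
      then obtain j where j: "inverse (real (Suc j)) < a"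
        using reals_Archimedean by blast
      obtain k where "tangent_good (C t) (x t) w (1 / real (Suc j)) (1 / real (Suc k))"
        using R elim by blast
      then have "tangent_good (C t) (x t) w a (1 / real (Suc k))"
        using j tangent_good_mono'[of "C t" "x t" w "1 / real (Suc j)" _ a] by (simp add: inverse_eq_divide)
      then show "\<exists>b>0. tangent_good (C t) (x t) w a b"
        by (intro exI[of _ "1 / real (Suc k)"]) simp
    qed
  next
    fix x w j assume "w \<in> tcone x t"
    moreover have "1 / real (Suc j) > 0"
      by simp
    ultimately obtain b where b: "b > 0" "tangent_good (C t) (x t) w (1 / real (Suc j)) b"
      unfolding clarke_tangent_cone_type_prod by blast
    obtain k where "inverse (real (Suc k)) < b"
      using reals_Archimedean[OF b(1)] by blast
    then have "tangent_good (C t) (x t) w (1 / real (Suc j)) (1 / real (Suc k))"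
      using tangent_good_mono[OF b(2), of "1 / real (Suc k)"] by (simp add: inverse_eq_divide)
    then show "\<exists>k. dense_good x t w (1 / real (Suc j)) (1 / real (Suc k))"
      using elim by blast
  qed
qed

text \<open>If tangency failed on a set \<open>A\<close> of positive weighted mass, moving
  \<open>x\<close> within \<open>z * e t\<close> to failing points would give a selection
  \<open>y\<close> close to \<open>x\<close> in norm. Every selection near
  \<open>y + \<eta> v\<close> would then miss by a multiple of \<open>\<eta>\<close> on a large part
  of \<open>A\<close>, which the tolerance \<open>\<epsilon>\<close> excludes.\<close>

lemma tangent_imp_AE:
  assumes x: "(x1, x2) \<in> SelC"
    and v: "(v1, v2) \<in> clarke_tangent_cone (prod_nspace (Lp_nspace M p) (Lp_nspace M r)) SelC (x1, x2)"
  shows "AE t in M. (v1 t, v2 t) \<in> tcone (\<lambda>t. (x1 t, x2 t)) t"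
proof -
  have sub: "SelC \<subseteq> Lp M (ennreal p) \<times> Lp M (ennreal r)"
    by (auto simp: Sel_def)
  have x1: "x1 \<in> Lp M (ennreal p)" and x2: "x2 \<in> Lp M (ennreal r)" and xC: "AE t in M. (x1 t, x2 t) \<in> C t"
    using x by (auto simp: Sel_iff)
  have v1: "v1 \<in> Lp M (ennreal p)" and v2: "v2 \<in> Lp M (ennreal r)"
    and tang: "\<forall>\<epsilon>>0. \<exists>\<delta>>0. \<exists>\<kappa>>0. \<forall>y1 y2. (y1, y2) \<in> SelC \<longrightarrow>
      Lp_norm M p (\<lambda>t. y1 t - x1 t) + Lp_norm M r (\<lambda>t. y2 t - x2 t) \<le> \<delta> \<longrightarrow>
      (\<forall>\<eta>. 0 < \<eta> \<longrightarrow> \<eta> \<le> \<kappa> \<longrightarrow> (\<exists>u1 u2. (u1, u2) \<in> SelC \<and>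
        Lp_norm M p (\<lambda>t. u1 t - (y1 t + \<eta> *\<^sub>R v1 t)) + Lp_norm M r (\<lambda>t. u2 t - (y2 t + \<eta> *\<^sub>R v2 t)) \<le> \<eta> * \<epsilon>))"
    using v unfolding clarke_tangent_cone_Lp_prod[OF p r sub x] by blast+
  note [measurable] = Lp_measurable[OF x1] Lp_measurable[OF x2] Lp_measurable[OF v1] Lp_measurable[OF v2]
  define x where "x t = (x1 t, x2 t)" for t
  define w where "w t = (v1 t, v2 t)" for t
  have [measurable]: "x \<in> borel_measurable M" "w \<in> borel_measurable M"
    unfolding x_def w_def by measurable
  obtain h e :: "'t \<Rightarrow> real" where [measurable]: "h \<in> borel_measurable M" "e \<in> borel_measurable M" and
    h: "integrable M h" "\<And>t. 0 < h t" "\<And>t. h t \<le> 1" and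
    e: "\<And>t. 0 < e t" "\<And>t. e t powr p \<le> h t" "\<And>t. e t powr r \<le> h t"
    by (rule ex_weight) blast
  have "AE t in M. \<exists>k. dense_good x t (w t) a (1 / real (Suc k))" if a: "a > 0" for a
  proof -
    define A where "A = {t \<in> space M. \<forall>k. \<not> dense_good x t (w t) a (1 / real (Suc k))}"
    have [measurable]: "A \<in> sets M"
      unfolding A_def by measurable
    define \<beta> where "\<beta> = (\<integral>t. indicator A t * h t \<partial>M)"
    have int_h: "integrable M (\<lambda>t. indicator B t * h t)" if [measurable]: "B \<in> sets M" for B
      by (rule Bochner_Integration.integrable_bound[OF h(1)])
        (auto split: split_indicator)
    have "\<not> \<beta> > 0"
    proof
      assume \<beta>: "\<beta> > 0"
      \<comment> \<open>At the tolerance \<open>s * a / 4\<close> tangency bounds the mass of the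
        failing set by \<open>s powr p + s powr r\<close>, hence by \<open>\<beta> / 4\<close>,
        whereas that set is chosen with mass above \<open>\<beta> / 2\<close>.\<close>
      obtain s where s: "s > 0" "s powr p * 1 \<le> \<beta> / 8" "s powr r * 1 \<le> \<beta> / 8"
        using ex_small_powr[of p r 1 "\<beta> / 8"] p r \<beta> by auto
      define \<epsilon> where "\<epsilon> = s * a / 4"
      have "\<epsilon> > 0"
        using s a by (simp add: \<epsilon>_def)
      from tang[rule_format, OF this] obtain \<delta> \<kappa> where \<delta>: "\<delta> > 0" and \<kappa>: "\<kappa> > 0" and
        "\<forall>y1 y2. (y1, y2) \<in> SelC \<longrightarrow>
          Lp_norm M p (\<lambda>t. y1 t - x1 t) + Lp_norm M r (\<lambda>t. y2 t - x2 t) \<le> \<delta> \<longrightarrow>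
          (\<forall>\<eta>. 0 < \<eta> \<longrightarrow> \<eta> \<le> \<kappa> \<longrightarrow> (\<exists>u1 u2. (u1, u2) \<in> SelC \<and>
            Lp_norm M p (\<lambda>t. u1 t - (y1 t + \<eta> *\<^sub>R v1 t)) +
            Lp_norm M r (\<lambda>t. u2 t - (y2 t + \<eta> *\<^sub>R v2 t)) \<le> \<eta> * \<epsilon>))"
        by (elim exE conjE)
      note * = this(3)[rule_format]
      obtain z where z: "z > 0" "z powr p * (\<integral>t. h t \<partial>M) \<le> min ((\<delta> / 2) powr p) ((\<delta> / 2) powr r)"
          "z powr r * (\<integral>t. h t \<partial>M) \<le> min ((\<delta> / 2) powr p) ((\<delta> / 2) powr r)"
        using ex_small_powr[of p r "\<integral>t. h t \<partial>M" "min ((\<delta> / 2) powr p) ((\<delta> / 2) powr r)"] p r \<delta> h(2)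
        by (auto simp: less_imp_le)
      \<comment> \<open>Failing points are sought in the representation, so that the first one
        depends measurably on \<open>t\<close>. The bound \<open>z * e t\<close> keeps all the
        displacements together within \<open>\<delta>\<close> in norm.\<close>
      define far where "far m n t \<longleftrightarrow> dist (castaing n t) (x t) < z * e t \<and>
          infdist (castaing n t + (1 / real (Suc m)) *\<^sub>R w t) (C t) > (1 / real (Suc m)) * (a / 2)" for m n t
      have [measurable]: "Measurable.pred M (far m n)" for m n
        unfolding far_def by measurable
      define B where "B m = {t \<in> A. \<exists>n. far m n t}" for m
      have B_sets[measurable]: "B m \<in> sets M" for m
      proof -
        have "B m = {t \<in> space M. t \<in> A \<and> (\<exists>n. far m n t)}"
          using sets.sets_into_space[of A M] by (auto simp: B_def)
        then show ?thesis
          by simp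
      qed
      have AE_B: "AE t in M. t \<in> A \<longrightarrow> (\<forall>\<^sub>F m in sequentially. t \<in> B m)"
        using AE_castaing AE_dense_good
      proof eventually_elim
        case (elim t)
        show ?case
        proof
          assume tA: "t \<in> A"
          have "\<not> tangent_good (C t) (x t) (w t) a b" if b: "b > 0" for b
          proof
            assume good: "tangent_good (C t) (x t) (w t) a b"
            obtain k where "inverse (real (Suc k)) < b"
              using reals_Archimedean[OF b] by blast
            then have "tangent_good (C t) (x t) (w t) a (1 / real (Suc k))"
              using good tangent_good_mono[of "C t" "x t" "w t" a b "1 / real (Suc k)"] by (simp add: inverse_eq_divide)
            then show False
              using tA elim(2) unfolding A_def by blast
          qed
          from not_tangent_good_scales[OF this a, of "z * e t"] obtain h0 where h0: "h0 > 0"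
            "\<And>\<eta>. 0 < \<eta> \<Longrightarrow> \<eta> \<le> h0 \<Longrightarrow>
              \<exists>y\<in>C t. dist y (x t) < z * e t \<and> infdist (y + \<eta> *\<^sub>R w t) (C t) > \<eta> * (a / 2)"
            using z(1) e(1)[of t] by auto
          obtain m0 where m0: "inverse (real (Suc m0)) < h0"
            using reals_Archimedean[OF h0(1)] by blast
          have "t \<in> B m" if "m \<ge> m0" for m
          proof -
            let ?\<eta> = "1 / real (Suc m)"
            have "?\<eta> \<le> 1 / real (Suc m0)"
              using that by (simp add: frac_le)
            then have "?\<eta> \<le> h0"
              using m0 by (simp add: inverse_eq_divide)
            then obtain y where y: "y \<in> C t" "dist y (x t) < z * e t" "infdist (y + ?\<eta> *\<^sub>R w t) (C t) > ?\<eta> * (a / 2)"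
              using h0(2)[of ?\<eta>] by auto
            \<comment> \<open>Failure at a fixed step is open in the point, so the dense sequence
              meets it.\<close>
            define U where "U = {y. dist y (x t) < z * e t} \<inter> {y. ?\<eta> * (a / 2) < infdist (y + ?\<eta> *\<^sub>R w t) (C t)}"
            have "open U"
              unfolding U_def by (intro open_Int open_Collect_less continuous_intros)
            moreover have "y \<in> U \<inter> closure (range (\<lambda>n. castaing n t))"
              using y elim(1) by (auto simp: U_def)
            ultimately have "U \<inter> range (\<lambda>n. castaing n t) \<noteq> {}"
              using open_Int_closure_eq_empty[of U] by blast
            then obtain n where "castaing n t \<in> U"
              by blast
            then have "far m n t"
              by (simp add: U_def far_def)
            then show ?thesis
              using tA by (auto simp: B_def)
          qed
          then show "\<forall>\<^sub>F m in sequentially. t \<in> B m"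
            unfolding eventually_sequentially by blast
        qed
      qed
      have "(\<lambda>m. \<integral>t. indicator (B m) t * h t \<partial>M) \<longlonglongrightarrow> \<beta>"
        unfolding \<beta>_def
      proof (rule integral_dominated_convergence[OF _ _ h(1)])
        show "AE t in M. (\<lambda>m. indicator (B m) t * h t) \<longlonglongrightarrow> indicator A t * h t"
          using AE_B
        proof eventually_elim
          case (elim t)
          have BA: "t \<in> B m \<Longrightarrow> t \<in> A" for m
            by (auto simp: B_def)
          show ?case
          proof (cases "t \<in> A")
            case True
            then have "\<forall>\<^sub>F m in sequentially. t \<in> B m"
              using elim by blast
            then have "\<forall>\<^sub>F m in sequentially. indicator (B m) t * h t = indicator A t * h t"
              by eventually_elim (use True in simp)
            then show ?thesis
              by (rule tendsto_eventually)
          next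
            case False
            then have "t \<notin> B m" for m
              using BA by blast
            then show ?thesis
              using False by simp
          qed
        qed
        show "AE t in M. norm (indicator (B m) t * h t) \<le> h t" for m
          using h(2) by (auto split: split_indicator simp: less_imp_le)
      qed (auto intro!: borel_measurable_times)
      then have "\<forall>\<^sub>F m in sequentially. \<beta> / 2 < (\<integral>t. indicator (B m) t * h t \<partial>M)"
        by (rule order_tendstoD) (use \<beta> in simp)
      then obtain m1 where m1: "\<And>m. m \<ge> m1 \<Longrightarrow> \<beta> / 2 < (\<integral>t. indicator (B m) t * h t \<partial>M)"
        unfolding eventually_sequentially by blast
      obtain m2 where m2: "inverse (real (Suc m2)) < \<kappa>"
        using reals_Archimedean[OF \<kappa>] by blast
      \<comment> \<open>The bound \<open>\<kappa>\<close> is imposed by tangency in the function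
        space, after \<open>z\<close> has no further influence on it; failure must therefore be
        available at one common step below any given bound. This is what the iteration of small
        steps provides.\<close>
      define m where "m = max m1 m2"
      define \<eta> where "\<eta> = 1 / real (Suc m)"
      have "1 / real (Suc m) \<le> 1 / real (Suc m2)"
        by (simp add: m_def frac_le)
      then have \<eta>: "0 < \<eta>" "\<eta> \<le> \<kappa>"
        using m2 by (auto simp: \<eta>_def inverse_eq_divide)
      have Bm: "\<beta> / 2 < (\<integral>t. indicator (B m) t * h t \<partial>M)"
        using m1[of m] by (simp add: m_def)
      define y where "y t = (if t \<in> B m then castaing (LEAST n. far m n t) t else x t)" for t
      have [measurable]: "y \<in> borel_measurable M"
        unfolding y_def by measurable
      have far_y: "far m (LEAST n. far m n t) t" if "t \<in> B m" for t
        by (rule LeastI_ex[of "\<lambda>n. far m n t"]) (use that in \<open>auto simp: B_def\<close>)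
      have y_close: "norm (y t - x t) \<le> z * e t" for t
        using far_y[of t] z(1) e(1)[of t] by (auto simp: y_def far_def dist_norm less_imp_le)
      have yC: "AE t in M. y t \<in> C t"
        using AE_castaing xC
      proof eventually_elim
        case (elim t)
        have "castaing (LEAST n. far m n t) t \<in> C t"
          using elim(1) by blast
        then show ?case
          using elim(2) by (simp add: y_def x_def)
      qed
      have concl: "(\<lambda>t. f (y t) - f (x t)) \<in> Lp M (ennreal q) \<and> Lp_norm M q (\<lambda>t. f (y t) - f (x t)) \<le> \<delta> / 2"
        if q: "q \<ge> 1" and eq: "\<And>t. e t powr q \<le> h t" and f: "\<And>a b. norm (f a - f b) \<le> norm (a - b)"
          and fm: "f \<in> borel_measurable borel"
          and zq: "z powr q * (\<integral>t. h t \<partial>M) \<le> (\<delta> / 2) powr q"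
        for q and f :: "'z \<times> 'y \<Rightarrow> 'c::{real_normed_vector, second_countable_topology}"
      proof -
        have [measurable]: "(\<lambda>t. f (y t)) \<in> borel_measurable M" "(\<lambda>t. f (x t)) \<in> borel_measurable M"
          by (rule measurable_compose[OF _ fm], measurable)+
        have B: "norm (f (y t) - f (x t)) powr q \<le> z powr q * h t" for t
        proof -
          have "norm (f (y t) - f (x t)) powr q \<le> (z * e t) powr q"
            using f[of "y t" "x t"] y_close[of t] q by (intro powr_mono2) auto
          also have "\<dots> = z powr q * e t powr q"
            by (rule powr_mult)
          also have "\<dots> \<le> z powr q * h t"
            using eq by (intro mult_left_mono) auto
          finally show ?thesis .
        qed
        have g: "integrable M (\<lambda>t. z powr q * h t)"
          using h(1) by simp
        show ?thesis
          by (rule Lp_norm_leI[OF q _ g]) (use B zq \<delta> in auto)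
      qed
      have fst_m: "(fst :: 'z \<times> 'y \<Rightarrow> 'z) \<in> borel_measurable borel"
        and snd_m: "(snd :: 'z \<times> 'y \<Rightarrow> 'y) \<in> borel_measurable borel"
        using borel_measurable_fst[of "\<lambda>w. w" borel] borel_measurable_snd[of "\<lambda>w. w" borel] by simp_all
      have fst_le: "norm (fst a - fst b) \<le> norm (a - b)" and snd_le: "norm (snd a - snd b) \<le> norm (a - b)"
        for a b :: "'z \<times> 'y"
        using norm_fst_le[of "fst a - fst b" "snd a - snd b"] norm_snd_le[of "snd a - snd b" "fst a - fst b"]
        by (simp_all add: minus_prod_def)
      have 1: "(\<lambda>t. fst (y t) - fst (x t)) \<in> Lp M (ennreal p) \<and> Lp_norm M p (\<lambda>t. fst (y t) - fst (x t)) \<le> \<delta> / 2"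
        by (rule concl) (use p e z fst_m fst_le in auto)
      have 2: "(\<lambda>t. snd (y t) - snd (x t)) \<in> Lp M (ennreal r) \<and> Lp_norm M r (\<lambda>t. snd (y t) - snd (x t)) \<le> \<delta> / 2"
        by (rule concl) (use r e z snd_m snd_le in auto)
      have "(\<lambda>t. fst (y t)) \<in> Lp M (ennreal p)" "(\<lambda>t. snd (y t)) \<in> Lp M (ennreal r)"
        using Lp_add[OF p conjunct1[OF 1] x1] Lp_add[OF r conjunct1[OF 2] x2] by (simp_all add: x_def)
      then have ySel: "(\<lambda>t. fst (y t), \<lambda>t. snd (y t)) \<in> SelC"
        using yC by (simp add: Sel_iff)
      have "Lp_norm M p (\<lambda>t. fst (y t) - x1 t) + Lp_norm M r (\<lambda>t. snd (y t) - x2 t) \<le> \<delta>"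
        using 1 2 by (simp add: x_def)
      from *[OF ySel this \<eta>] obtain u1 u2 where u: "(u1, u2) \<in> SelC" and
        u_le: "Lp_norm M p (\<lambda>t. u1 t - (fst (y t) + \<eta> *\<^sub>R v1 t)) +
            Lp_norm M r (\<lambda>t. u2 t - (snd (y t) + \<eta> *\<^sub>R v2 t)) \<le> \<eta> * \<epsilon>"
        by blast
      define d1 where "d1 t = u1 t - (fst (y t) + \<eta> *\<^sub>R v1 t)" for t
      define d2 where "d2 t = u2 t - (snd (y t) + \<eta> *\<^sub>R v2 t)" for t
      have u12: "u1 \<in> Lp M (ennreal p)" "u2 \<in> Lp M (ennreal r)" and uC: "AE t in M. (u1 t, u2 t) \<in> C t"
        using u by (auto simp: Sel_iff)
      have d1: "d1 \<in> Lp M (ennreal p)" and d2: "d2 \<in> Lp M (ennreal r)"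
        unfolding d1_def d2_def using ySel u12
        by (auto simp: Sel_iff intro!: Lp_diff Lp_add Lp_scale p r v1 v2)
      have d_le: "(\<integral>t. norm (d1 t) powr p \<partial>M) \<le> (\<eta> * \<epsilon>) powr p" "(\<integral>t. norm (d2 t) powr r \<partial>M) \<le> (\<eta> * \<epsilon>) powr r"
      proof -
        have "Lp_norm M p d1 \<le> \<eta> * \<epsilon>" "Lp_norm M r d2 \<le> \<eta> * \<epsilon>"
          using u_le Lp_norm_nonneg[of M p d1] Lp_norm_nonneg[of M r d2] unfolding d1_def d2_def by auto
        then show "(\<integral>t. norm (d1 t) powr p \<partial>M) \<le> (\<eta> * \<epsilon>) powr p" "(\<integral>t. norm (d2 t) powr r \<partial>M) \<le> (\<eta> * \<epsilon>) powr r"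
          using Lp_norm_le_iff[OF p, of "\<eta> * \<epsilon>" M d1] Lp_norm_le_iff[OF r, of "\<eta> * \<epsilon>" M d2] \<eta> \<open>\<epsilon> > 0\<close> by auto
      qed
      \<comment> \<open>On \<open>B m\<close> one of the two components misses by at least
        \<open>\<eta> * a / 4\<close>, the reciprocal of \<open>c\<close>. Since
        \<open>c * (\<eta> * \<epsilon>) = s\<close>, the step \<open>\<eta>\<close> cancels from
        the final estimate.\<close>
      define c where "c = 4 / (\<eta> * a)"
      have c: "c > 0" "c * (\<eta> * \<epsilon>) = s"
        using \<eta> a by (auto simp: c_def \<epsilon>_def)
      have pt: "AE t in M. indicator (B m) t * h t \<le> c powr p * norm (d1 t) powr p + c powr r * norm (d2 t) powr r"
        using uC
      proof eventually_elim
        case (elim t)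
        show ?case
        proof (cases "t \<in> B m")
          case False
          then show ?thesis by simp
        next
          case True
          have "\<eta> * (a / 2) < infdist (y t + \<eta> *\<^sub>R w t) (C t)"
            using far_y[OF True] True by (simp add: far_def y_def \<eta>_def)
          also have "\<dots> \<le> dist (y t + \<eta> *\<^sub>R w t) (u1 t, u2 t)"
            by (rule infdist_le[OF elim])
          also have "\<dots> = norm (d1 t, d2 t)"
          proof -
            have "(u1 t, u2 t) - (y t + \<eta> *\<^sub>R w t) = (d1 t, d2 t)"
              by (simp add: d1_def d2_def w_def prod_eq_iff)
            then show ?thesis
              by (metis dist_norm norm_minus_commute)
          qed
          also have "\<dots> \<le> norm (d1 t) + norm (d2 t)"
            by (rule norm_Pair_le)
          finally have "\<eta> * a / 4 \<le> norm (d1 t) \<or> \<eta> * a / 4 \<le> norm (d2 t)"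
            by (simp add: field_simps) linarith
          then consider "1 \<le> c * norm (d1 t)" | "1 \<le> c * norm (d2 t)"
            using \<eta> a by (auto simp: c_def field_simps)
          then have "1 \<le> c powr p * norm (d1 t) powr p + c powr r * norm (d2 t) powr r"
          proof cases
            case 1
            then have "1 \<le> (c * norm (d1 t)) powr p"
              using p by (intro ge_one_powr_ge_zero) auto
            then show ?thesis
              by (simp add: powr_mult add_increasing2)
          next
            case 2
            then have "1 \<le> (c * norm (d2 t)) powr r"
              using r by (intro ge_one_powr_ge_zero) auto
            then show ?thesis
              by (simp add: powr_mult add_increasing)
          qed
          then show ?thesis
            using True h(3)[of t] by simp
        qed
      qed
      have d_int: "integrable M (\<lambda>t. norm (d1 t) powr p)" "integrable M (\<lambda>t. norm (d2 t) powr r)"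
        using d1 d2 by (simp_all add: Lp_iff[OF p] Lp_iff[OF r])
      have "(\<integral>t. indicator (B m) t * h t \<partial>M) \<le> (\<integral>t. c powr p * norm (d1 t) powr p + c powr r * norm (d2 t) powr r \<partial>M)"
        using d_int int_h pt by (intro integral_mono_AE) auto
      also have "\<dots> \<le> c powr p * (\<eta> * \<epsilon>) powr p + c powr r * (\<eta> * \<epsilon>) powr r"
        using d_int d_le by (simp add: add_mono mult_left_mono)
      also have "\<dots> = s powr p + s powr r"
        using c by (simp flip: powr_mult)
      also have "\<dots> \<le> \<beta> / 4"
        using s by simp
      finally show False
        using Bm \<beta> by linarith
    qed
    then have "(\<integral>t. indicator A t * h t \<partial>M) = 0"
      using h(2) by (simp add: \<beta>_def not_less order_antisym integral_nonneg_AE less_imp_le)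
    then have "AE t in M. indicator A t * h t = 0"
      using integral_nonneg_eq_0_iff_AE[OF int_h[of A]] h(2) by (simp add: less_imp_le)
    then show ?thesis
      using AE_space
    proof eventually_elim
      case (elim t)
      then have "t \<notin> A"
        using h(2)[of t] by (auto simp: indicator_def)
      then show ?case
        using elim by (simp add: A_def)
    qed
  qed
  then have "AE t in M. \<forall>j. \<exists>k. dense_good x t (w t) (1 / real (Suc j)) (1 / real (Suc k))"
    by (simp add: AE_all_countable)
  then show ?thesis
    using AE_dense_good_tcone
  proof eventually_elim
    case (elim t)
    then have "w t \<in> tcone x t"
      by blast
    then show ?case
      by (simp add: x_def w_def)
  qed
qed

theorem tangent_cone_Sel:
  assumes x: "(x1, x2) \<in> SelC"
  shows "clarke_tangent_cone (prod_nspace (Lp_nspace M p) (Lp_nspace M r)) SelC (x1, x2) =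
    Sel M (ennreal p) (ennreal r) (tcone (\<lambda>t. (x1 t, x2 t)))"
proof (intro set_eqI)
  fix v :: "('t \<Rightarrow> 'z) \<times> ('t \<Rightarrow> 'y)"
  obtain v1 v2 where v: "v = (v1, v2)"
    by fastforce
  have "v1 \<in> Lp M (ennreal p)" "v2 \<in> Lp M (ennreal r)"
    if "(v1, v2) \<in> clarke_tangent_cone (prod_nspace (Lp_nspace M p) (Lp_nspace M r)) SelC (x1, x2)"
    using that by (auto simp: clarke_tangent_cone_def prod_nspace_def Lp_nspace_def)
  then show "v \<in> clarke_tangent_cone (prod_nspace (Lp_nspace M p) (Lp_nspace M r)) SelC (x1, x2) \<longleftrightarrow>
      v \<in> Sel M (ennreal p) (ennreal r) (tcone (\<lambda>t. (x1 t, x2 t)))"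
    using tangent_imp_AE[OF x] tangent_AE_imp[OF x] unfolding v Sel_iff by blast
qed

end

section \<open>Hahn-Banach and separability of the dual\<close>

definition sublinear :: "('a::real_vector \<Rightarrow> real) \<Rightarrow> bool" where
  "sublinear q \<longleftrightarrow> (\<forall>x y. q (x + y) \<le> q x + q y) \<and> (\<forall>c\<ge>0. \<forall>x. q (c *\<^sub>R x) = c * q x)"

lemma sublinear_add: "sublinear q \<Longrightarrow> q (x + y) \<le> q x + q y"
  and sublinear_scale: "sublinear q \<Longrightarrow> c \<ge> 0 \<Longrightarrow> q (c *\<^sub>R x) = c * q x"
  and sublinear_0: "sublinear q \<Longrightarrow> q 0 = 0"
  and sublinear_neg: "sublinear q \<Longrightarrow> - q (- x) \<le> q x"
proof -
  assume q: "sublinear q"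
  show "q (x + y) \<le> q x + q y" "c \<ge> 0 \<Longrightarrow> q (c *\<^sub>R x) = c * q x"
    using q by (auto simp: sublinear_def)
  have "q (0 *\<^sub>R 0) = 0 * q 0"
    using q unfolding sublinear_def by blast
  then show 0: "q 0 = 0"
    by simp
  have "q (x + - x) \<le> q x + q (- x)"
    using q unfolding sublinear_def by blast
  with 0 show "- q (- x) \<le> q x"
    by simp
qed

text \<open>Equality for positive \<open>c\<close> follows by applying the inequality to
  \<open>1 / c\<close> as well.\<close>

lemma sublinearI:
  assumes add: "\<And>x y. q (x + y) \<le> q x + q y" and scale: "\<And>c x. c > 0 \<Longrightarrow> q (c *\<^sub>R x) \<le> c * q x"
    and 0: "q 0 = 0"
  shows "sublinear q"
  unfolding sublinear_def
proof (intro conjI allI impI add)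
  fix c :: real and x assume "c \<ge> 0"
  show "q (c *\<^sub>R x) = c * q x"
  proof (cases "c = 0")
    case False
    with \<open>c \<ge> 0\<close> have c: "c > 0"
      by simp
    have "q x = q ((1 / c) *\<^sub>R (c *\<^sub>R x))"
      using c by simp
    also have "\<dots> \<le> (1 / c) * q (c *\<^sub>R x)"
      using c by (intro scale) simp
    finally have "c * q x \<le> q (c *\<^sub>R x)"
      using c by (simp add: field_simps)
    then show ?thesis
      using scale[OF c, of x] by simp
  qed (simp add: 0)
qed

text \<open>For sublinear \<open>q\<close> this is the largest sublinear functional below
  \<open>q\<close> whose value at \<open>- y\<close> is at most \<open>- q y\<close>. A linear
  functional below it therefore attains \<open>q y\<close> at \<open>y\<close>; and a minimal
  \<open>q\<close> coincides with it, which forces additivity.\<close>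

definition sublinear_push :: "('a::real_vector \<Rightarrow> real) \<Rightarrow> 'a \<Rightarrow> 'a \<Rightarrow> real" where
  "sublinear_push q y x = (INF t\<in>{0..}. q (x + t *\<^sub>R y) - t * q y)"

lemma
  assumes q: "sublinear q"
  shows sublinear_sublinear_push: "sublinear (sublinear_push q y)"
    and sublinear_push_le: "t \<ge> 0 \<Longrightarrow> sublinear_push q y x \<le> q (x + t *\<^sub>R y) - t * q y"
proof -
  \<comment> \<open>The bound does not depend on \<open>t\<close>, so the infimum is taken over a
    set that is bounded below.\<close>
  have lower: "q (x + t *\<^sub>R y) - t * q y \<ge> - q (- x)" if "t \<ge> 0" for x t
    using sublinear_add[OF q, of "x + t *\<^sub>R y" "- x"] sublinear_scale[OF q that, of y] by simp
  have bdd: "bdd_below ((\<lambda>t. q (x + t *\<^sub>R y) - t * q y) ` {0..})" for x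
    by (rule bdd_belowI2[where m="- q (- x)"]) (use lower in auto)
  show le: "sublinear_push q y x \<le> q (x + t *\<^sub>R y) - t * q y" if "t \<ge> 0" for t x
    unfolding sublinear_push_def using that by (intro cINF_lower bdd) auto
  have ge: "a \<le> sublinear_push q y x" if "\<And>t. t \<ge> 0 \<Longrightarrow> a \<le> q (x + t *\<^sub>R y) - t * q y" for a x
    unfolding sublinear_push_def using that by (intro cINF_greatest) auto
  show "sublinear (sublinear_push q y)"
  proof (rule sublinearI)
    fix x z
    have "sublinear_push q y (x + z) - (q (z + t *\<^sub>R y) - t * q y) \<le> sublinear_push q y x"
      if t: "t \<ge> 0" for t
    proof (rule ge)
      fix s :: real assume s: "s \<ge> 0"
      have "sublinear_push q y (x + z) \<le> q ((x + z) + (s + t) *\<^sub>R y) - (s + t) * q y"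
        using s t by (intro le) simp
      also have "(x + z) + (s + t) *\<^sub>R y = (x + s *\<^sub>R y) + (z + t *\<^sub>R y)"
        by (simp add: algebra_simps)
      also have "q \<dots> \<le> q (x + s *\<^sub>R y) + q (z + t *\<^sub>R y)"
        by (rule sublinear_add[OF q])
      finally show "sublinear_push q y (x + z) - (q (z + t *\<^sub>R y) - t * q y) \<le> q (x + s *\<^sub>R y) - s * q y"
        by (simp add: algebra_simps)
    qed
    then have "sublinear_push q y (x + z) - sublinear_push q y x \<le> sublinear_push q y z"
      by (intro ge) (simp add: algebra_simps)
    then show "sublinear_push q y (x + z) \<le> sublinear_push q y x + sublinear_push q y z"
      by simp
  next
    fix c :: real and x assume c: "c > 0"
    have "sublinear_push q y (c *\<^sub>R x) / c \<le> sublinear_push q y x"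
    proof (rule ge)
      fix t :: real assume t: "t \<ge> 0"
      have "sublinear_push q y (c *\<^sub>R x) \<le> q (c *\<^sub>R x + (c * t) *\<^sub>R y) - (c * t) * q y"
        using c t by (intro le) simp
      also have "c *\<^sub>R x + (c * t) *\<^sub>R y = c *\<^sub>R (x + t *\<^sub>R y)"
        by (simp add: algebra_simps)
      also have "q \<dots> = c * q (x + t *\<^sub>R y)"
        using c by (intro sublinear_scale[OF q]) simp
      finally show "sublinear_push q y (c *\<^sub>R x) / c \<le> q (x + t *\<^sub>R y) - t * q y"
        using c by (simp add: field_simps)
    qed
    then show "sublinear_push q y (c *\<^sub>R x) \<le> c * sublinear_push q y x"
      using c by (simp add: field_simps)
  next
    have "sublinear_push q y 0 \<le> 0"
      using le[of 0 0] by (simp add: sublinear_0[OF q])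
    moreover have "0 \<le> sublinear_push q y 0"
      by (rule ge) (simp add: sublinear_scale[OF q])
    ultimately show "sublinear_push q y 0 = 0"
      by simp
  qed
qed

text \<open>The linear functionals below \<open>p\<close> are the minimal sublinear functionals below \<open>p\<close>, so Zorn's lemma can be
  applied to total functions and no partially defined functionals are needed.\<close>

theorem Hahn_Banach_sublinear:
  assumes p: "sublinear p"
  obtains f where "linear f" "\<And>x. f x \<le> p x"
proof -
  define A where "A = {q. sublinear q \<and> (\<forall>x. q x \<le> p x)}"
  \<comment> \<open>The pointwise order is reversed, so that a maximal element in Zorn's lemma is a
    minimal functional.\<close>
  define P where "P a b \<longleftrightarrow> (\<forall>x. b x \<le> a x)" for a b :: "'a \<Rightarrow> real"
  have "\<exists>m\<in>A. \<forall>a\<in>A. P m a \<longrightarrow> a = m"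
  proof (rule predicate_Zorn)
    show "partial_order_on A (relation_of P A)"
      unfolding partial_order_on_def preorder_on_def refl_on_def trans_def antisym_def relation_of_def P_def
      by (auto intro!: ext order.antisym intro: order.trans)
  next
    fix C assume C: "C \<in> Chains (relation_of P A)"
    then have CA: "C \<subseteq> A" and cmp: "\<And>a b. a \<in> C \<Longrightarrow> b \<in> C \<Longrightarrow> P a b \<or> P b a"
      unfolding Chains_def relation_of_def by auto
    show "\<exists>u\<in>A. \<forall>a\<in>C. P a u"
    proof (cases "C = {}")
      case True
      then show ?thesis
        using p by (auto simp: A_def)
    next
      case False
      define u where "u x = (INF q\<in>C. q x)" for x
      have lower: "- p (- x) \<le> q x" if "q \<in> C" for q x
      proof -
        have "q (- x) \<le> p (- x)" "- q (- x) \<le> q x"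
          using that CA sublinear_neg[of q x] unfolding A_def by auto
        then show ?thesis
          by linarith
      qed
      have u_le: "u x \<le> q x" if "q \<in> C" for q x
        unfolding u_def using that lower by (intro cINF_lower bdd_belowI2[where m="- p (- x)"])
      have u_ge: "a \<le> u x" if "\<And>q. q \<in> C \<Longrightarrow> a \<le> q x" for a x
        unfolding u_def using that False by (intro cINF_greatest)
      have sub: "sublinear q" "q x \<le> p x" if "q \<in> C" for q x
        using that CA by (auto simp: A_def)
      have "sublinear u"
      proof (rule sublinearI)
        fix x y
        have "u (x + y) - q2 y \<le> u x" if q2: "q2 \<in> C" for q2
        proof (rule u_ge)
          fix q1 assume q1: "q1 \<in> C"
          \<comment> \<open>Of two members of a chain the smaller one is below both, so a single
            functional controls both arguments; this is where the chain condition enters.\<close>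
          then obtain q where q: "q \<in> C" "q x \<le> q1 x" "q y \<le> q2 y"
            using cmp[OF q1 q2] q2 by (auto simp: P_def)
          have "u (x + y) \<le> q x + q y"
            using u_le[OF q(1), of "x + y"] sublinear_add[OF sub(1)[OF q(1)], of x y] by linarith
          then show "u (x + y) - q2 y \<le> q1 x"
            using q by linarith
        qed
        then have "u (x + y) - u x \<le> u y"
          by (intro u_ge) (simp add: algebra_simps)
        then show "u (x + y) \<le> u x + u y"
          by simp
      next
        fix c :: real and x assume c: "c > 0"
        have "u (c *\<^sub>R x) / c \<le> u x"
        proof (rule u_ge)
          fix q assume q: "q \<in> C"
          show "u (c *\<^sub>R x) / c \<le> q x"
            using u_le[OF q, of "c *\<^sub>R x"] sublinear_scale[OF sub(1)[OF q], of c x] c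
            by (simp add: field_simps)
        qed
        then show "u (c *\<^sub>R x) \<le> c * u x"
          using c by (simp add: field_simps)
      next
        have "q 0 = 0" if "q \<in> C" for q
          using sublinear_0[OF sub(1)[OF that]] .
        then show "u 0 = 0"
          using u_ge[of 0 0] u_le[of _ 0] False by (metis all_not_in_conv order_antisym order_refl)
      qed
      moreover have "u x \<le> p x" for x
        using False u_le sub(2) by (meson ex_in_conv order_trans)
      ultimately have "u \<in> A"
        by (auto simp: A_def)
      then show ?thesis
        using u_le by (auto simp: P_def)
    qed
  qed
  then obtain m where m: "m \<in> A" "\<And>a. a \<in> A \<Longrightarrow> (\<forall>x. a x \<le> m x) \<Longrightarrow> a = m"
    unfolding P_def by blast
  have sub: "sublinear m" and mp: "\<And>x. m x \<le> p x"
    using m(1) by (auto simp: A_def)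
  have add: "m (x + y) = m x + m y" for x y
  proof -
    have le: "sublinear_push m y z \<le> m z" for z
      using sublinear_push_le[OF sub, of 0 y z] by simp
    then have "sublinear_push m y \<in> A"
      using sublinear_sublinear_push[OF sub, of y] mp unfolding A_def by (auto intro: order.trans)
    \<comment> \<open>By minimality the modified functional is \<open>m\<close> itself; its defining
      bound at \<open>t = 1\<close> is then the missing half of additivity.\<close>
    then have "sublinear_push m y = m"
      using m(2) le by blast
    then have "m x \<le> m (x + y) - m y"
      using sublinear_push_le[OF sub, of 1 y x] by simp
    then show ?thesis
      using sublinear_add[OF sub, of x y] by simp
  qed
  have neg: "m (- x) = - m x" for x
    using add[of x "- x"] sublinear_0[OF sub] by simp
  have "m (c *\<^sub>R x) = c *\<^sub>R m x" for c x
  proof (cases "c \<ge> 0")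
    case True
    then show ?thesis
      by (simp add: sublinear_scale[OF sub])
  next
    case False
    then have "m ((- c) *\<^sub>R x) = (- c) * m x"
      by (intro sublinear_scale[OF sub]) simp
    then show ?thesis
      using neg[of "c *\<^sub>R x"] by simp
  qed
  then have "linear m"
    using add by (intro linearI)
  then show ?thesis
    using that mp by blast
qed

text \<open>Domination by \<open>sublinear_push p y\<close> instead of \<open>p\<close> bounds the
  value at \<open>- y\<close> and so forces the value at \<open>y\<close>. The hypothesis
  \<open>p x \<le> norm x\<close> makes the functional continuous.\<close>

lemma Hahn_Banach_attaining:
  assumes p: "sublinear p" and le: "\<And>x. p x \<le> norm x"
  obtains f :: "'a::real_normed_vector \<Rightarrow>\<^sub>L real" where "\<And>x. f x \<le> p x" "f y \<ge> p y" "norm f \<le> 1"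
proof -
  obtain f where f: "linear f" "\<And>x. f x \<le> sublinear_push p y x"
    using Hahn_Banach_sublinear[OF sublinear_sublinear_push[OF p, of y]] by blast
  have fp: "f x \<le> p x" for x
    using f(2)[of x] sublinear_push_le[OF p, of 0 y x] by simp
  have "f (- y) \<le> - p y"
    using f(2)[of "- y"] sublinear_push_le[OF p, of 1 y "- y"] by (simp add: sublinear_0[OF p])
  then have fy: "f y \<ge> p y"
    using linear_neg[OF f(1), of y] by simp
  have bound: "\<bar>f x\<bar> \<le> norm x" for x
    using fp[of x] fp[of "- x"] le[of x] le[of "- x"] linear_neg[OF f(1), of x] by auto
  have bl: "bounded_linear f"
    using f(1) bound by (intro bounded_linear_intro[where K=1]) (auto simp: linear_add linear_scale)
  show ?thesis
    using fp fy bound norm_blinfun_bound[of 1 "Blinfun f"]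
    by (intro that[of "Blinfun f"]) (auto simp: bounded_linear_Blinfun_apply[OF bl])
qed

lemma ex_norming_functional:
  fixes y :: "'a::real_normed_vector"
  obtains f :: "'a \<Rightarrow>\<^sub>L real" where "norm f \<le> 1" "f y \<ge> norm y"
  by (rule Hahn_Banach_attaining[of norm y]) (auto intro!: sublinearI norm_triangle_ineq)

text \<open>The distance to \<open>V\<close> is sublinear, vanishes on \<open>V\<close> and is
  positive at \<open>y\<close>; a functional below it that attains its value at \<open>y\<close> has
  the required properties.\<close>

lemma ex_functional_vanishing_on_subspace:
  fixes V :: "'a::real_normed_vector set"
  assumes V: "subspace V" and y: "y \<notin> closure V"
  obtains f :: "'a \<Rightarrow>\<^sub>L real" where "\<And>x. x \<in> V \<Longrightarrow> f x = 0" "f y \<noteq> 0"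
proof -
  let ?p = "\<lambda>x. infdist x V"
  have ne: "V \<noteq> {}"
    using subspace_0[OF V] by blast
  have ge: "a \<le> ?p x" if "\<And>v. v \<in> V \<Longrightarrow> a \<le> dist x v" for a x
    using that ne by (auto simp: infdist_notempty intro: cINF_greatest)
  have p: "sublinear ?p"
  proof (rule sublinearI)
    fix x z
    have "?p (x + z) - dist z w \<le> ?p x" if w: "w \<in> V" for w
    proof (rule ge)
      fix v assume v: "v \<in> V"
      have "?p (x + z) \<le> dist (x + z) (v + w)"
        using v w V by (intro infdist_le subspace_add)
      also have "\<dots> \<le> dist x v + dist z w"
        by (rule dist_triangle_add)
      finally show "?p (x + z) - dist z w \<le> dist x v"
        by simp
    qed
    then have "?p (x + z) - ?p x \<le> ?p z"
      by (intro ge) (simp add: algebra_simps)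
    then show "?p (x + z) \<le> ?p x + ?p z"
      by simp
  next
    fix c :: real and x assume c: "c > 0"
    have "?p (c *\<^sub>R x) / c \<le> ?p x"
    proof (rule ge)
      fix v assume "v \<in> V"
      then have "?p (c *\<^sub>R x) \<le> dist (c *\<^sub>R x) (c *\<^sub>R v)"
        using V by (intro infdist_le subspace_scale)
      also have "\<dots> = c * dist x v"
        using c norm_scaleR[of c "x - v"] by (simp add: dist_norm scaleR_diff_right)
      finally show "?p (c *\<^sub>R x) / c \<le> dist x v"
        using c by (simp add: field_simps)
    qed
    then show "?p (c *\<^sub>R x) \<le> c * ?p x"
      using c by (simp add: field_simps)
  next
    show "?p 0 = 0"
      using subspace_0[OF V] by simp
  qed
  have le: "?p x \<le> norm x" for x
    using infdist_le[OF subspace_0[OF V], of x] by simp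
  obtain f :: "'a \<Rightarrow>\<^sub>L real" where f: "\<And>x. f x \<le> ?p x" "f y \<ge> ?p y"
    using Hahn_Banach_attaining[OF p le, of y] by blast
  have "f x = 0" if "x \<in> V" for x
    using f(1)[of x] f(1)[of "- x"] that subspace_neg[OF V that] by (simp add: blinfun.minus_right)
  moreover have "?p y \<noteq> 0"
    using y ne by (simp add: in_closure_iff_infdist_zero)
  then have "f y \<noteq> 0"
    using f(2) infdist_nonneg[of y V] by linarith
  ultimately show ?thesis
    by (rule that)
qed

section \<open>Rational spans and separability of the dual\<close>

definition rational_span :: "(nat \<Rightarrow> 'a::real_vector) \<Rightarrow> 'a set" where
  "rational_span d = range (\<lambda>l. sum_list (map (\<lambda>(q, n). real_of_rat q *\<^sub>R d n) l))"

lemma countable_rational_span: "countable (rational_span d)"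
  unfolding rational_span_def by (rule countable_image) simp

lemma rational_span_base: "d n \<in> rational_span d"
  unfolding rational_span_def by (rule range_eqI[of _ _ "[(1, n)]"]) simp

lemma rational_span_add:
  assumes "x \<in> rational_span d" "y \<in> rational_span d"
  shows "x + y \<in> rational_span d"
proof -
  obtain l m where "x = sum_list (map (\<lambda>(q, n). real_of_rat q *\<^sub>R d n) l)"
    "y = sum_list (map (\<lambda>(q, n). real_of_rat q *\<^sub>R d n) m)"
    using assms unfolding rational_span_def by blast
  then show ?thesis
    unfolding rational_span_def by (intro range_eqI[of _ _ "l @ m"]) simp
qed

lemma rational_span_scale:
  assumes "x \<in> rational_span d"
  shows "real_of_rat c *\<^sub>R x \<in> rational_span d"
proof -
  obtain l where l: "x = sum_list (map (\<lambda>(q, n). real_of_rat q *\<^sub>R d n) l)"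
    using assms unfolding rational_span_def by blast
  have "real_of_rat c *\<^sub>R sum_list (map (\<lambda>(q, n). real_of_rat q *\<^sub>R d n) l) =
      sum_list (map (\<lambda>(q, n). real_of_rat q *\<^sub>R d n) (map (\<lambda>(q, n). (c * q, n)) l))"
    by (induction l) (auto simp: scaleR_add_right of_rat_mult)
  then show ?thesis
    unfolding rational_span_def l by (intro range_eqI)
qed

lemma ex_rational_sequence:
  obtains q :: "nat \<Rightarrow> rat" where "(\<lambda>n. real_of_rat (q n)) \<longlonglongrightarrow> c"
proof -
  have "\<exists>q. c < real_of_rat q \<and> real_of_rat q < c + inverse (real (Suc n))" for n
    using of_rat_dense[of c "c + inverse (real (Suc n))"] by auto
  then obtain q where q: "\<And>n. c < real_of_rat (q n)" "\<And>n. real_of_rat (q n) < c + inverse (real (Suc n))"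
    by metis
  have "(\<lambda>n. real_of_rat (q n)) \<longlonglongrightarrow> c"
  proof (rule tendsto_sandwich[of "\<lambda>_. c"])
    show "(\<lambda>n. c + inverse (real (Suc n))) \<longlonglongrightarrow> c"
      using tendsto_add[OF tendsto_const LIMSEQ_inverse_real_of_nat, of c] by simp
  qed (use q in \<open>auto intro!: always_eventually less_imp_le\<close>)
  then show ?thesis
    by (rule that)
qed

lemma subspace_closure_rational_span:
  fixes d :: "nat \<Rightarrow> 'a::real_normed_vector"
  shows "subspace (closure (rational_span d))"
  unfolding subspace_def
proof (intro conjI ballI allI)
  show "0 \<in> closure (rational_span d)"
    using rational_span_scale[OF rational_span_base[of d 0], of 0] closure_subset by auto
next
  fix x y assume "x \<in> closure (rational_span d)" "y \<in> closure (rational_span d)"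
  then obtain f g where "\<And>n. f n \<in> rational_span d" "f \<longlonglongrightarrow> x" "\<And>n. g n \<in> rational_span d" "g \<longlonglongrightarrow> y"
    unfolding closure_sequential by blast
  then show "x + y \<in> closure (rational_span d)"
    unfolding closure_sequential
    by (intro exI[of _ "\<lambda>n. f n + g n"]) (auto intro: rational_span_add tendsto_add)
next
  fix c x assume "x \<in> closure (rational_span d)"
  then obtain f where f: "\<And>n. f n \<in> rational_span d" "f \<longlonglongrightarrow> x"
    unfolding closure_sequential by blast
  obtain q where "(\<lambda>n. real_of_rat (q n)) \<longlonglongrightarrow> c"
    by (rule ex_rational_sequence)
  with f show "c *\<^sub>R x \<in> closure (rational_span d)"
    unfolding closure_sequential
    by (intro exI[of _ "\<lambda>n. real_of_rat (q n) *\<^sub>R f n"]) (auto intro: rational_span_scale tendsto_scaleR)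
qed

text \<open>Functionals norming a dense sequence have a dense rational span. Otherwise Hahn-Banach
  in the dual gives a nonzero element of the bidual that annihilates them; by reflexivity it is
  evaluation at some nonzero \<open>z\<close>, and a dense point near \<open>z\<close> has a norming
  functional that cannot vanish at \<open>z\<close>.\<close>

theorem reflexive_imp_separable_dual:
  assumes "reflexive TYPE('z::{real_normed_vector, second_countable_topology})"
  obtains D :: "nat \<Rightarrow> ('z::{real_normed_vector, second_countable_topology} \<Rightarrow>\<^sub>L real)" where "\<And>f e. e > 0 \<Longrightarrow> \<exists>n. dist f (D n) < e"
proof -
  obtain d :: "nat \<Rightarrow> 'z" where d: "\<And>w e. e > 0 \<Longrightarrow> \<exists>n. dist w (d n) < e"
    by (erule ex_dense_sequence)
  have "\<exists>f :: 'z \<Rightarrow>\<^sub>L real. norm f \<le> 1 \<and> blinfun_apply f (d n) \<ge> norm (d n)" for n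
    using ex_norming_functional[of "d n"] by blast
  then obtain x :: "nat \<Rightarrow> 'z \<Rightarrow>\<^sub>L real" where x: "\<And>n. norm (x n) \<le> 1" "\<And>n. blinfun_apply (x n) (d n) \<ge> norm (d n)"
    by metis
  have dense: "closure (rational_span x) = UNIV"
  proof (rule ccontr)
    assume "closure (rational_span x) \<noteq> UNIV"
    then obtain y where "y \<notin> closure (rational_span x)"
      by blast
    then obtain F :: "('z \<Rightarrow>\<^sub>L real) \<Rightarrow>\<^sub>L real"
      where F: "\<And>f. f \<in> closure (rational_span x) \<Longrightarrow> F f = 0" "F y \<noteq> 0"
      using ex_functional_vanishing_on_subspace[OF subspace_closure_rational_span[of x], of y]
      by (metis closure_closure)
    obtain z where z: "F = bidual_embedding z"
      using assms unfolding reflexive_def by (metis surjD)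
    have "z \<noteq> 0"
      using F(2) z by auto
    \<comment> \<open>The dense point then has norm above two thirds of \<open>norm z\<close>, while
      vanishing of \<open>x n\<close> at \<open>z\<close> bounds its norm by
      \<open>norm (d n - z)\<close>, less than one third.\<close>
    obtain n where n: "dist z (d n) < norm z / 3"
      using d[of "norm z / 3" z] \<open>z \<noteq> 0\<close> by auto
    have "x n \<in> closure (rational_span x)"
      using rational_span_base[of x n] closure_subset by blast
    then have "x n z = 0"
      using F(1)[of "x n"] z by simp
    then have "norm (d n) \<le> x n (d n - z)"
      using x(2)[of n] by (simp add: blinfun.diff_right)
    also have "\<dots> \<le> norm (x n (d n - z))"
      by simp
    also have "\<dots> \<le> norm (x n) * norm (d n - z)"
      by (rule norm_blinfun)
    also have "\<dots> \<le> 1 * norm (d n - z)"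
      by (intro mult_right_mono x) simp
    finally have "norm (d n) \<le> norm z / 3"
      using n by (simp add: dist_norm norm_minus_commute)
    moreover have "norm z \<le> norm (d n) + dist z (d n)"
      by (simp add: dist_norm norm_minus_commute norm_triangle_sub)
    moreover have "norm z > 0"
      using \<open>z \<noteq> 0\<close> by simp
    ultimately show False
      using n by linarith
  qed
  show ?thesis
  proof
    fix f :: "'z \<Rightarrow>\<^sub>L real" and e :: real assume "e > 0"
    then obtain g where "g \<in> rational_span x" "dist g f < e"
      using dense closure_approachable[of f "rational_span x"] by auto
    then show "\<exists>n. dist f (from_nat_into (rational_span x) n) < e"
      using from_nat_into_surj[OF countable_rational_span, of g x] by (auto simp: dist_commute)
  qed
qed

section \<open>The dual of a Lebesgue-Bochner space\<close>

lemma AE_le_of_integral_le: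
  fixes u v :: "'a \<Rightarrow> real"
  assumes u: "integrable M u" and v: "integrable M v"
    and le: "\<And>E. E \<in> sets M \<Longrightarrow> (\<integral>t. indicator E t * u t \<partial>M) \<le> (\<integral>t. indicator E t * v t \<partial>M)"
  shows "AE t in M. u t \<le> v t"
proof -
  note [measurable] = borel_measurable_integrable[OF u] borel_measurable_integrable[OF v]
  define E where "E = {t \<in> space M. v t < u t}"
  have [measurable]: "E \<in> sets M"
    unfolding E_def by measurable
  have iu: "integrable M (\<lambda>t. indicator E t * u t)" "integrable M (\<lambda>t. indicator E t * v t)"
    using integrable_mult_indicator[OF _ u, of E] integrable_mult_indicator[OF _ v, of E] by simp_all
  define d where "d t = indicator E t * u t - indicator E t * v t" for t
  have d: "integrable M d"
    unfolding d_def using iu by simp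
  have d0: "AE t in M. 0 \<le> d t"
    by (auto simp: d_def E_def split: split_indicator)
  have "(\<integral>t. d t \<partial>M) \<le> 0"
    unfolding d_def using iu le[of E] by simp
  then have "(\<integral>t. d t \<partial>M) = 0"
    using integral_nonneg_AE[OF d0] by linarith
  then have "AE t in M. d t = 0"
    using integral_nonneg_eq_0_iff_AE[OF d d0] by simp
  then show ?thesis
    using AE_space by eventually_elim (auto simp: d_def E_def split: split_indicator_asm)
qed

lemma AE_eq_of_integral_eq:
  fixes u v :: "'a \<Rightarrow> real"
  assumes "integrable M u" "integrable M v"
    and "\<And>E. E \<in> sets M \<Longrightarrow> (\<integral>t. indicator E t * u t \<partial>M) = (\<integral>t. indicator E t * v t \<partial>M)"
  shows "AE t in M. u t = v t"
  using AE_le_of_integral_le[of M u v] AE_le_of_integral_le[of M v u] assms by auto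

text \<open>Finite additivity with continuity at the empty set is what functionals on L^p provide,
  and it amounts to countable additivity. Finiteness of \<open>m (space M)\<close> makes the
  extended density finite almost everywhere.\<close>

lemma (in sigma_finite_measure) Radon_Nikodym_real:
  fixes m :: "'a set \<Rightarrow> real"
  assumes nonneg: "\<And>E. E \<in> sets M \<Longrightarrow> 0 \<le> m E"
    and add: "\<And>A B. A \<in> sets M \<Longrightarrow> B \<in> sets M \<Longrightarrow> A \<inter> B = {} \<Longrightarrow> m (A \<union> B) = m A + m B"
    and cont: "\<And>A. range A \<subseteq> sets M \<Longrightarrow> decseq A \<Longrightarrow> (\<Inter>i. A i) = {} \<Longrightarrow> (\<lambda>i. m (A i)) \<longlonglongrightarrow> 0"
    and null: "\<And>E. E \<in> null_sets M \<Longrightarrow> m E = 0"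
  obtains f where "\<And>t. 0 \<le> f t" "integrable M f"
    "\<And>E. E \<in> sets M \<Longrightarrow> m E = (\<integral>t. indicator E t * f t \<partial>M)"
proof -
  define N where "N = measure_of (space M) (sets M) (\<lambda>E. ennreal (m E))"
  have sets_N[simp, measurable_cong]: "sets N = sets M"
    by (simp add: N_def)
  have pos: "positive (sets M) (\<lambda>E. ennreal (m E))"
    using null[of "{}"] by (simp add: positive_def)
  have "countably_additive (sets M) (\<lambda>E. ennreal (m E))"
  proof (rule sets.empty_continuous_imp_countably_additive[OF pos])
    show "additive (sets M) (\<lambda>E. ennreal (m E))"
      unfolding additive_def using add nonneg by auto
    fix A :: "nat \<Rightarrow> 'a set" assume "range A \<subseteq> sets M" "decseq A" "(\<Inter>i. A i) = {}"
    from tendsto_ennrealI[OF cont[OF this]] show "(\<lambda>i. ennreal (m (A i))) \<longlonglongrightarrow> 0"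
      by simp
  qed simp
  then have emeasure_N: "emeasure N E = ennreal (m E)" if "E \<in> sets M" for E
    using that pos unfolding N_def by (intro emeasure_measure_of_sigma sets.sigma_algebra_axioms)
  have "absolutely_continuous M N"
    unfolding absolutely_continuous_def
    using null emeasure_N by (auto intro!: null_setsI simp: null_setsD2)
  then obtain f where f[measurable]: "f \<in> borel_measurable M" and fN: "density M f = N"
    using Radon_Nikodym[of N] by auto
  have int_f: "(\<integral>\<^sup>+t. f t * indicator E t \<partial>M) = ennreal (m E)" if "E \<in> sets M" for E
    using emeasure_N[OF that] emeasure_density[OF f that] fN by simp
  have "(\<integral>\<^sup>+t. f t \<partial>M) = (\<integral>\<^sup>+t. f t * indicator (space M) t \<partial>M)"
    by (rule nn_integral_cong) simp
  then have "(\<integral>\<^sup>+t. f t \<partial>M) \<noteq> \<infinity>"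
    using int_f[of "space M"] by simp
  then have fin: "AE t in M. f t \<noteq> \<infinity>"
    by (rule nn_integral_noteq_infinite[OF f])
  have int_g: "has_bochner_integral M (\<lambda>t. indicator E t * enn2real (f t)) (m E)" if E: "E \<in> sets M" for E
  proof (rule has_bochner_integral_nn_integral)
    note [measurable] = E
    show "(\<lambda>t. indicator E t * enn2real (f t)) \<in> borel_measurable M"
      by measurable
    have "(\<integral>\<^sup>+t. ennreal (indicator E t * enn2real (f t)) \<partial>M) = (\<integral>\<^sup>+t. f t * indicator E t \<partial>M)"
      using fin by (intro nn_integral_cong_AE, eventually_elim)
        (auto split: split_indicator simp: top.not_eq_extremum)
    then show "(\<integral>\<^sup>+t. ennreal (indicator E t * enn2real (f t)) \<partial>M) = ennreal (m E)"
      using int_f[OF E] by simp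
  qed (use nonneg[OF E] in auto)
  have "integrable M (\<lambda>t. indicator (space M) t * enn2real (f t))"
    using int_g[of "space M"] by (simp add: has_bochner_integral_iff)
  then have "integrable M (\<lambda>t. enn2real (f t))"
    by (rule Bochner_Integration.integrable_cong[THEN iffD1, rotated 2]) auto
  then show ?thesis
    using int_g by (intro that[of "\<lambda>t. enn2real (f t)"]) (auto simp: has_bochner_integral_iff)
qed

text \<open>Scalar densities are linear in \<open>z\<close> only almost everywhere, with null sets
  depending on the vectors. At a fixed good \<open>t\<close> they define a functional on a countable
  set closed under rational combinations; the Lipschitz bound extends it to the whole space.\<close>

lemma blinfun_extension_rational:
  fixes D :: "'z::real_normed_vector set" and u :: "'z \<Rightarrow> real"
  assumes dense: "closure D = UNIV"
    and D_add: "\<And>x y. x \<in> D \<Longrightarrow> y \<in> D \<Longrightarrow> x + y \<in> D"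
    and D_scale: "\<And>c x. x \<in> D \<Longrightarrow> real_of_rat c *\<^sub>R x \<in> D"
    and add: "\<And>x y. x \<in> D \<Longrightarrow> y \<in> D \<Longrightarrow> u (x + y) = u x + u y"
    and scale: "\<And>c x. x \<in> D \<Longrightarrow> u (real_of_rat c *\<^sub>R x) = real_of_rat c * u x"
    and bound: "\<And>x. x \<in> D \<Longrightarrow> \<bar>u x\<bar> \<le> G * norm x" and G: "G \<ge> 0"
  shows "\<exists>F :: 'z \<Rightarrow>\<^sub>L real. (\<forall>x\<in>D. blinfun_apply F x = u x) \<and> norm F \<le> G"
proof -
  have dist: "dist (u x) (u y) \<le> G * dist x y" if "x \<in> D" "y \<in> D" for x y
  proof -
    have y: "- y \<in> D" "u (- y) = - u y"
      using D_scale[OF that(2), of "-1"] scale[OF that(2), of "-1"] by (simp_all add: of_rat_minus)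
    show ?thesis
      using bound[OF D_add[OF that(1) y(1)]] add[OF that(1) y(1)] y(2) by (simp add: dist_norm)
  qed
  have "uniformly_continuous_on D u"
    unfolding uniformly_continuous_on_def
  proof (intro allI impI)
    fix e :: real assume "e > 0"
    show "\<exists>d>0. \<forall>x\<in>D. \<forall>x'\<in>D. dist x' x < d \<longrightarrow> dist (u x') (u x) < e"
    proof (intro exI[of _ "e / (G + 1)"] conjI ballI impI)
      show "e / (G + 1) > 0"
        using \<open>e > 0\<close> G by simp
      fix x x' assume x: "x \<in> D" "x' \<in> D" "dist x' x < e / (G + 1)"
      have "dist (u x') (u x) \<le> G * dist x' x"
        using x by (intro dist)
      also have "\<dots> \<le> (G + 1) * dist x' x"
        by (intro mult_right_mono) auto
      also have "\<dots> < e"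
        using x(3) G by (simp add: field_simps)
      finally show "dist (u x') (u x) < e" .
    qed
  qed
  then obtain g where g: "uniformly_continuous_on (closure D) g" "\<And>x. x \<in> D \<Longrightarrow> u x = g x"
    by (rule uniformly_continuous_on_extension_on_closure) blast
  have cont: "isCont g x" for x
    using uniformly_continuous_imp_continuous[OF g(1)] dense by (simp add: continuous_on_eq_continuous_at)
  have seq: "\<exists>s. (\<forall>n. s n \<in> D) \<and> s \<longlonglongrightarrow> x" for x
    using dense closure_sequential[of x D] by auto
  have g_add: "g (x + y) = g x + g y" for x y
  proof -
    obtain s t where s: "\<And>n. s n \<in> D" "s \<longlonglongrightarrow> x" and t: "\<And>n. t n \<in> D" "t \<longlonglongrightarrow> y"
      using seq by metis
    have "(\<lambda>n. g (s n + t n)) \<longlonglongrightarrow> g (x + y)"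
      by (intro isCont_tendsto_compose[OF cont] tendsto_add s t)
    moreover have "(\<lambda>n. g (s n) + g (t n)) \<longlonglongrightarrow> g x + g y"
      by (intro tendsto_add isCont_tendsto_compose[OF cont] s t)
    moreover have "g (s n + t n) = g (s n) + g (t n)" for n
      using add[OF s(1) t(1), of n n] g(2) s(1) t(1) D_add by metis
    ultimately show ?thesis
      using LIMSEQ_unique by simp
  qed
  have g_scale: "g (c *\<^sub>R x) = c *\<^sub>R g x" for c x
  proof -
    obtain s where s: "\<And>n. s n \<in> D" "s \<longlonglongrightarrow> x"
      using seq by metis
    obtain q where q: "(\<lambda>n. real_of_rat (q n)) \<longlonglongrightarrow> c"
      by (rule ex_rational_sequence)
    have "(\<lambda>n. g (real_of_rat (q n) *\<^sub>R s n)) \<longlonglongrightarrow> g (c *\<^sub>R x)"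
      by (intro isCont_tendsto_compose[OF cont] tendsto_scaleR s q)
    moreover have "(\<lambda>n. real_of_rat (q n) * g (s n)) \<longlonglongrightarrow> c * g x"
      by (intro tendsto_mult isCont_tendsto_compose[OF cont] s q)
    moreover have "g (real_of_rat (q n) *\<^sub>R s n) = real_of_rat (q n) * g (s n)" for n
      using scale[OF s(1), of "q n" n] g(2) s(1) D_scale by metis
    ultimately show ?thesis
      using LIMSEQ_unique by simp
  qed
  have g_bound: "\<bar>g x\<bar> \<le> G * norm x" for x
  proof -
    obtain s where s: "\<And>n. s n \<in> D" "s \<longlonglongrightarrow> x"
      using seq by metis
    have 1: "(\<lambda>n. \<bar>g (s n)\<bar>) \<longlonglongrightarrow> \<bar>g x\<bar>"
      by (intro tendsto_rabs isCont_tendsto_compose[OF cont] s)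
    have 2: "(\<lambda>n. G * norm (s n)) \<longlonglongrightarrow> G * norm x"
      by (intro tendsto_intros s)
    show ?thesis
      by (rule LIMSEQ_le[OF 1 2]) (use bound[OF s(1)] g(2)[OF s(1)] in auto)
  qed
  have bl: "bounded_linear g"
    using g_add g_scale g_bound by (intro bounded_linear_intro[where K=G]) (auto simp: mult.commute)
  have "norm (Blinfun g) \<le> G"
    using G g_bound by (intro norm_blinfun_bound) (auto simp: bounded_linear_Blinfun_apply[OF bl])
  then show ?thesis
    using g(2) by (intro exI[of _ "Blinfun g"]) (auto simp: bounded_linear_Blinfun_apply[OF bl])
qed

lemma norm_blinfun_le_iff_dense:
  fixes F :: "'z::real_normed_vector \<Rightarrow>\<^sub>L real"
  assumes dense: "\<And>w e. e > 0 \<Longrightarrow> \<exists>n. dist w (d n) < e" and a: "a \<ge> 0"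
  shows "norm F \<le> a \<longleftrightarrow> (\<forall>n. \<bar>blinfun_apply F (d n)\<bar> \<le> a * norm (d n :: 'z))"
proof
  assume "norm F \<le> a"
  then have "norm F * norm (d n) \<le> a * norm (d n)" for n
    by (intro mult_right_mono) auto
  then show "\<forall>n. \<bar>blinfun_apply F (d n)\<bar> \<le> a * norm (d n)"
    using norm_blinfun[of F] by (auto intro: order.trans)
next
  assume R: "\<forall>n. \<bar>blinfun_apply F (d n)\<bar> \<le> a * norm (d n)"
  show "norm F \<le> a"
  proof (rule norm_blinfun_bound[OF a])
    fix x
    have "x \<in> closure (range d)"
      unfolding closure_approachable using dense[of _ x] by (auto simp: dist_commute)
    moreover have "closed {x. norm (blinfun_apply F x) \<le> a * norm x}"
      by (intro closed_Collect_le continuous_intros)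
    ultimately show "norm (blinfun_apply F x) \<le> a * norm x"
      using R closure_minimal[of "range d" "{x. norm (blinfun_apply F x) \<le> a * norm x}"] by auto
  qed
qed

text \<open>A form of Pettis' theorem. Closed balls of the dual are described by countably many
  evaluations at dense points, and with a dense sequence \<open>D\<close> in the dual every open set
  is a countable union of such balls. Separability enters as an explicit sequence because it comes
  from reflexivity and not from a type class.\<close>

lemma borel_measurable_blinfunI:
  fixes \<xi> :: "'t \<Rightarrow> 'z::{real_normed_vector, second_countable_topology} \<Rightarrow>\<^sub>L real"
  assumes meas: "\<And>z. (\<lambda>t. blinfun_apply (\<xi> t) z) \<in> borel_measurable M"
    and D: "\<And>f e. e > 0 \<Longrightarrow> \<exists>n::nat. dist f (D n :: 'z \<Rightarrow>\<^sub>L real) < e"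
  shows "\<xi> \<in> borel_measurable M"
proof (rule borel_measurableI)
  obtain d :: "nat \<Rightarrow> 'z" where d: "\<And>w e. e > 0 \<Longrightarrow> \<exists>n. dist w (d n) < e"
    by (erule ex_dense_sequence)
  have near: "{t \<in> space M. dist (\<xi> t) (D n) \<le> a} \<in> sets M" if a: "a \<ge> 0" for n a
  proof -
    have "{t \<in> space M. dist (\<xi> t) (D n) \<le> a} =
        {t \<in> space M. \<forall>i. \<bar>blinfun_apply (\<xi> t) (d i) - blinfun_apply (D n) (d i)\<bar> \<le> a * norm (d i)}"
      using norm_blinfun_le_iff_dense[OF d a] by (auto simp: dist_norm blinfun.diff_left)
    also have "\<dots> \<in> sets M"
      using meas by measurable
    finally show ?thesis .
  qed
  fix U :: "('z \<Rightarrow>\<^sub>L real) set" assume U: "open U"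
  have "\<xi> -` U \<inter> space M = (\<Union>(n, k)\<in>{(n, k). cball (D n) (1 / real (Suc k)) \<subseteq> U}.
      {t \<in> space M. dist (\<xi> t) (D n) \<le> 1 / real (Suc k)})" (is "?L = ?R")
  proof
    show "?R \<subseteq> ?L"
      by (auto simp: dist_commute subset_iff)
    show "?L \<subseteq> ?R"
    proof
      fix t assume t: "t \<in> ?L"
      then obtain e where e: "e > 0" "ball (\<xi> t) e \<subseteq> U"
        using U open_contains_ball by blast
      obtain k where k: "inverse (real (Suc k)) < e / 2"
        using reals_Archimedean[of "e / 2"] e by auto
      obtain n where n: "dist (\<xi> t) (D n) < 1 / real (Suc k)"
        using D[of "1 / real (Suc k)" "\<xi> t"] by auto
      have "cball (D n) (1 / real (Suc k)) \<subseteq> U"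
      proof
        fix f assume "f \<in> cball (D n) (1 / real (Suc k))"
        then have "dist (\<xi> t) f < e"
          using n k dist_triangle[of "\<xi> t" f "D n"] by (simp add: inverse_eq_divide)
        then show "f \<in> U"
          using e by auto
      qed
      then show "t \<in> ?R"
        using t n by (intro UN_I[of "(n, k)"]) auto
    qed
  qed
  also have "\<dots> \<in> sets M"
    by (rule sets.countable_UN''[OF countableI_type]) (auto intro!: near)
  finally show "\<xi> -` U \<inter> space M \<in> sets M" .
qed

section \<open>Pairing with dual-valued functions: Hoelder's inequality and its converse\<close>

lemma borel_measurable_blinfun_apply:
  fixes \<xi> :: "'t \<Rightarrow> 'z::{real_normed_vector, second_countable_topology} \<Rightarrow>\<^sub>L real"
  assumes "\<And>z. (\<lambda>t. blinfun_apply (\<xi> t) z) \<in> borel_measurable M" and "a \<in> borel_measurable M"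
  shows "(\<lambda>t. blinfun_apply (\<xi> t) (a t)) \<in> borel_measurable M"
  by (rule borel_measurable_Caratheodory_compose[where g="\<lambda>t. blinfun_apply (\<xi> t)"])
    (simp_all add: assms blinfun.bounded_linear_right linear_continuous_on)

lemma borel_measurable_blinfun_point:
  fixes \<xi> :: "'t \<Rightarrow> 'z::real_normed_vector \<Rightarrow>\<^sub>L real"
  assumes "\<xi> \<in> borel_measurable M"
  shows "(\<lambda>t. blinfun_apply (\<xi> t) z) \<in> borel_measurable M"
proof -
  have "(\<lambda>f :: 'z \<Rightarrow>\<^sub>L real. blinfun_apply f z) \<in> borel_measurable borel"
    by (intro borel_measurable_continuous_onI linear_continuous_on blinfun.bounded_linear_left)
  then show ?thesis
    by (rule measurable_compose[OF assms])
qed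

lemma Lp_conjugate_cases:
  assumes p: "1 \<le> p" and \<xi>: "\<xi> \<in> Lp M (conjugate_exponent p)"
  obtains K where "p = 1" "AE t in M. norm (\<xi> t) \<le> K"
  | q where "p > 1" "q > 1" "1 / p + 1 / q = 1" "integrable M (\<lambda>t. norm (\<xi> t) powr q)"
proof (cases "p = 1")
  case True
  then show ?thesis
    using that(1) \<xi> by (auto simp: conjugate_exponent_def Lp_def)
next
  case False
  then have "p > 1"
    using p by simp
  then show ?thesis
    using that(2)[of "p / (p - 1)"] \<xi> by (auto simp: conjugate_exponent_def Lp_def field_simps)
qed

text \<open>Both cases of the exponent yield a pointwise bound of the form
  \<open>D * norm x powr p + G t\<close>, by boundedness or by Young's inequality. It bounds the
  functional on the unit ball, and homogeneity does the rest; the constant \<open>K\<close> is not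
  the norm of \<open>\<xi>\<close> in general.\<close>

lemma Holder_Lp:
  fixes \<xi> :: "'t \<Rightarrow> 'z::{real_normed_vector, second_countable_topology} \<Rightarrow>\<^sub>L real"
  assumes p: "1 \<le> p" and \<xi>: "\<xi> \<in> Lp M (conjugate_exponent p)"
  obtains K where "\<And>a. a \<in> Lp M (ennreal p) \<Longrightarrow> integrable M (\<lambda>t. blinfun_apply (\<xi> t) (a t))"
    "\<And>a. a \<in> Lp M (ennreal p) \<Longrightarrow> \<bar>\<integral>t. blinfun_apply (\<xi> t) (a t) \<partial>M\<bar> \<le> K * Lp_norm M p a"
proof -
  note [measurable] = Lp_measurable[OF \<xi>]
  have meas[measurable]: "(\<lambda>t. blinfun_apply (\<xi> t) (a t)) \<in> borel_measurable M" if "a \<in> Lp M (ennreal p)" for a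
    by (rule borel_measurable_blinfun_apply[OF borel_measurable_blinfun_point[OF Lp_measurable[OF \<xi>]]
      Lp_measurable[OF that]])
  obtain D G where D: "0 \<le> D" and G: "integrable M G"
    and le: "AE t in M. \<forall>x. norm (blinfun_apply (\<xi> t) x) \<le> D * norm x powr p + G t"
    using p \<xi>
  proof (cases rule: Lp_conjugate_cases)
    case (1 K)
    have "AE t in M. \<forall>x. norm (blinfun_apply (\<xi> t) x) \<le> \<bar>K\<bar> * norm x powr p + 0"
      using 1(2)
    proof (eventually_elim, intro allI)
      fix t and x :: 'z assume "norm (\<xi> t) \<le> K"
      then have "norm (\<xi> t) * norm x \<le> \<bar>K\<bar> * norm x"
        by (intro mult_right_mono) auto
      then show "norm (blinfun_apply (\<xi> t) x) \<le> \<bar>K\<bar> * norm x powr p + 0"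
        using norm_blinfun[of "\<xi> t" x] 1(1) by simp
    qed
    then show ?thesis
      by (intro that[of "\<bar>K\<bar>" "\<lambda>_. 0"]) auto
  next
    case (2 q)
    have "norm (blinfun_apply (\<xi> t) x) \<le> 1 / p * norm x powr p + norm (\<xi> t) powr q / q" for t x
      using norm_blinfun[of "\<xi> t" x] Youngs_inequality[of p q "norm x" "norm (\<xi> t)"] 2
      by (simp add: mult.commute)
    then show ?thesis
      using 2 by (intro that[of "1 / p" "\<lambda>t. norm (\<xi> t) powr q / q"]) auto
  qed
  have powr_int: "integrable M (\<lambda>t. norm (a t) powr p)" if "a \<in> Lp M (ennreal p)" for a :: "'t \<Rightarrow> 'z"
    using that by (simp add: Lp_iff[OF p])
  have int: "integrable M (\<lambda>t. blinfun_apply (\<xi> t) (a t))" if a: "a \<in> Lp M (ennreal p)" for a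
  proof (rule Bochner_Integration.integrable_bound[OF _ meas[OF a]])
    show "integrable M (\<lambda>t. D * norm (a t) powr p + G t)"
      using powr_int[OF a] G by simp
    show "AE t in M. norm (blinfun_apply (\<xi> t) (a t)) \<le> norm (D * norm (a t) powr p + G t)"
      using le by eventually_elim (auto intro: order.trans[OF _ abs_ge_self])
  qed
  have unit: "\<bar>\<integral>t. blinfun_apply (\<xi> t) (b t) \<partial>M\<bar> \<le> D + (\<integral>t. G t \<partial>M)"
    if b: "b \<in> Lp M (ennreal p)" and b1: "Lp_norm M p b \<le> 1" for b
  proof -
    have "\<bar>\<integral>t. blinfun_apply (\<xi> t) (b t) \<partial>M\<bar> \<le> (\<integral>t. norm (blinfun_apply (\<xi> t) (b t)) \<partial>M)"
      using integral_norm_bound[of M "\<lambda>t. blinfun_apply (\<xi> t) (b t)"] by simp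
    also have "\<dots> \<le> (\<integral>t. D * norm (b t) powr p + G t \<partial>M)"
      using int[OF b] powr_int[OF b] G le by (intro integral_mono_AE) auto
    also have "\<dots> \<le> D * 1 + (\<integral>t. G t \<partial>M)"
      using powr_int[OF b] G D b1 Lp_norm_le_iff[OF p, of 1 M b] by (simp add: mult_left_le)
    finally show ?thesis
      by simp
  qed
  show ?thesis
  proof (rule that[of "D + (\<integral>t. G t \<partial>M)", OF int])
    fix a :: "'t \<Rightarrow> 'z" assume a: "a \<in> Lp M (ennreal p)"
    define N where "N = Lp_norm M p a"
    show "\<bar>\<integral>t. blinfun_apply (\<xi> t) (a t) \<partial>M\<bar> \<le> (D + (\<integral>t. G t \<partial>M)) * Lp_norm M p a"
    proof (cases "N = 0")
      \<comment> \<open>The norm is only a seminorm on functions, so normalising leaves out the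
        functions that vanish almost everywhere.\<close>
      case True
      then have "(\<integral>t. norm (a t) powr p \<partial>M) = 0"
        by (simp add: N_def Lp_norm_def)
      then have "AE t in M. a t = 0"
        using integral_nonneg_eq_0_iff_AE[OF powr_int[OF a]] by simp
      then have "(\<integral>t. blinfun_apply (\<xi> t) (a t) \<partial>M) = 0"
        by (intro integral_eq_zero_AE, eventually_elim) simp
      then show ?thesis
        using True by (simp add: N_def)
    next
      case False
      then have N: "N > 0"
        using Lp_norm_nonneg[of M p a] by (simp add: N_def)
      have "Lp_norm M p (\<lambda>t. (1 / N) *\<^sub>R a t) \<le> 1"
        using Lp_norm_scale[OF p, of M "1 / N" a] N by (simp add: N_def)
      from unit[OF Lp_scale[OF p a] this] show ?thesis
        using N by (simp add: blinfun.scaleR_right abs_mult N_def[symmetric] field_simps)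
    qed
  qed
qed

text \<open>The weight \<open>h0\<close> makes the bounded test functions \<open>w\<close> multiples of elements of \<open>L\<^sup>p\<close>.\<close>

lemma converse_Holder:
  fixes \<rho> h0 :: "'t \<Rightarrow> real"
  assumes p: "1 \<le> p" and [measurable]: "\<rho> \<in> borel_measurable M" "h0 \<in> borel_measurable M"
    and h0: "\<And>t. 0 < h0 t" and \<rho>: "\<And>t. 0 \<le> \<rho> t" and int: "integrable M (\<lambda>t. h0 t * \<rho> t)"
    and hp: "integrable M (\<lambda>t. h0 t powr p)"
    and le: "\<And>w n. w \<in> borel_measurable M \<Longrightarrow> (\<And>t. 0 \<le> w t) \<Longrightarrow> (\<And>t. w t \<le> real n) \<Longrightarrow>
      (\<integral>t. w t * (h0 t * \<rho> t) \<partial>M) \<le> K * (\<integral>t. (w t * h0 t) powr p \<partial>M) powr (1 / p)"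
  shows "\<rho> \<in> Lp M (conjugate_exponent p)"
proof (cases "p = 1")
  case True
  \<comment> \<open>For exponent 1 indicators of measurable sets are enough as test
    functions.\<close>
  have "AE t in M. h0 t * \<rho> t \<le> K * h0 t"
  proof (rule AE_le_of_integral_le[OF int])
    have h: "integrable M h0"
      using hp h0 True by (simp add: less_imp_le)
    show "integrable M (\<lambda>t. K * h0 t)"
      using h by simp
    fix E assume [measurable]: "E \<in> sets M"
    have "(\<integral>t. indicator E t * (h0 t * \<rho> t) \<partial>M) \<le> K * (\<integral>t. (indicator E t * h0 t) powr p \<partial>M) powr (1 / p)"
      by (rule le[of _ 1]) (auto split: split_indicator)
    also have "\<dots> = (\<integral>t. indicator E t * (K * h0 t) \<partial>M)"
    proof -
      have "(\<integral>t. indicator E t * h0 t \<partial>M) \<ge> 0"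
        using h0 by (intro integral_nonneg_AE) (auto simp: less_imp_le)
      moreover have "(\<integral>t. (indicator E t * h0 t) powr p \<partial>M) = (\<integral>t. indicator E t * h0 t \<partial>M)"
        using h0 True by (intro Bochner_Integration.integral_cong) (auto simp: less_imp_le)
      moreover have "(\<integral>t. indicator E t * (K * h0 t) \<partial>M) = K * (\<integral>t. indicator E t * h0 t \<partial>M)"
        by (simp flip: integral_mult_right_zero add: ac_simps)
      ultimately show ?thesis
        using True by simp
    qed
    finally show "(\<integral>t. indicator E t * (h0 t * \<rho> t) \<partial>M) \<le> (\<integral>t. indicator E t * (K * h0 t) \<partial>M)" .
  qed
  then have "AE t in M. norm (\<rho> t) \<le> K"
    by eventually_elim (use h0 \<rho> in \<open>simp add: mult.commute\<close>)
  then show ?thesis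
    using True by (auto simp: conjugate_exponent_def Lp_def)
next
  case False
  with p have p1: "p > 1"
    by simp
  define q where "q = p / (p - 1)"
  have q: "q > 1" "(q - 1) * p = q" "1 - 1 / p = 1 / q"
    using p1 by (auto simp: q_def field_simps)
  \<comment> \<open>The test function behind \<open>f n\<close> is the extremal one of Hoelder's
    inequality, \<open>\<rho> powr (q - 1) / h0\<close>, cut off where it exceeds \<open>n\<close>.
    Since \<open>(q - 1) * p = q\<close>, both integrals in the hypothesis become the integral
    \<open>I\<close> of \<open>f n\<close>, and \<open>I \<le> K * I powr (1 / p)\<close> bounds
    \<open>I\<close> independently of \<open>n\<close>.\<close>
  define f where "f n t = (if \<rho> t powr (q - 1) \<le> real n * h0 t then \<rho> t powr q else 0)" for n :: nat and t
  have [measurable]: "f n \<in> borel_measurable M" for n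
    unfolding f_def by measurable
  have f0: "f n t \<ge> 0" for n t
    by (simp add: f_def)
  have f_int: "integrable M (f n)" and f_le: "(\<integral>t. f n t \<partial>M) \<le> \<bar>K\<bar> powr q" for n
  proof -
    define w where "w t = (if \<rho> t powr (q - 1) \<le> real n * h0 t then \<rho> t powr (q - 1) / h0 t else 0)" for t
    have [measurable]: "w \<in> borel_measurable M"
      unfolding w_def by measurable
    have w: "0 \<le> w t" "w t \<le> real n" for t
      using h0[of t] by (auto simp: w_def field_simps)
    have 1: "w t * (h0 t * \<rho> t) = f n t" for t
    proof -
      have "\<rho> t powr (q - 1) * \<rho> t = \<rho> t powr q"
        using powr_mult_base[OF \<rho>[of t], of "q - 1"] by (simp add: mult.commute)
      then show ?thesis
        using h0[of t] by (simp add: w_def f_def)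
    qed
    have 2: "(w t * h0 t) powr p = f n t" for t
      using h0[of t] q(2) by (simp add: w_def f_def powr_powr)
    show fi: "integrable M (f n)"
    proof (rule Bochner_Integration.integrable_bound[of M "\<lambda>t. real n * (h0 t * \<rho> t)"])
      show "AE t in M. norm (f n t) \<le> norm (real n * (h0 t * \<rho> t))"
      proof (rule AE_I2)
        fix t
        have "w t * (h0 t * \<rho> t) \<le> real n * (h0 t * \<rho> t)"
          using w[of t] h0[of t] \<rho>[of t] by (intro mult_right_mono) auto
        then show "norm (f n t) \<le> norm (real n * (h0 t * \<rho> t))"
          using f0[of n t] h0[of t] \<rho>[of t] by (simp add: 1 abs_mult)
      qed
    qed (use int in simp_all)
    define I where "I = (\<integral>t. f n t \<partial>M)"
    have "I \<le> K * I powr (1 / p)"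
      using le[of w n] w unfolding I_def 1 2 by simp
    also have "\<dots> \<le> \<bar>K\<bar> * I powr (1 / p)"
      by (intro mult_right_mono) auto
    finally have IK: "I \<le> \<bar>K\<bar> * I powr (1 / p)" .
    show "(\<integral>t. f n t \<partial>M) \<le> \<bar>K\<bar> powr q"
    proof (cases "I > 0")
      case True
      have "I = I powr (1 / q) * I powr (1 / p)"
        using True q(3) by (simp add: powr_add[symmetric] flip: q(3))
      with IK have "I powr (1 / q) * I powr (1 / p) \<le> \<bar>K\<bar> * I powr (1 / p)"
        by simp
      then have "I powr (1 / q) \<le> \<bar>K\<bar>"
        using True by simp
      then show ?thesis
        using powr_inverse_le_iff[of q I "\<bar>K\<bar>"] q(1) True by (simp add: I_def)
    next
      case False
      then show ?thesis
        by (simp add: I_def order.trans[of _ 0])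
    qed
  qed
  have lim: "(\<lambda>n. f n t) \<longlonglongrightarrow> \<rho> t powr q" for t
  proof (rule tendsto_eventually)
    obtain n0 :: nat where "\<rho> t powr (q - 1) / h0 t \<le> real n0"
      using real_arch_simple by blast
    then have n0: "\<rho> t powr (q - 1) \<le> real n0 * h0 t"
      using h0[of t] by (simp add: field_simps)
    have "f n t = \<rho> t powr q" if "n \<ge> n0" for n
    proof -
      have "real n0 * h0 t \<le> real n * h0 t"
        using that h0[of t] by (intro mult_right_mono) auto
      then show ?thesis
        using n0 by (simp add: f_def)
    qed
    then show "\<forall>\<^sub>F n in sequentially. f n t = \<rho> t powr q"
      unfolding eventually_sequentially by blast
  qed
  have "(\<integral>\<^sup>+t. ennreal (\<rho> t powr q) \<partial>M) = (\<integral>\<^sup>+t. liminf (\<lambda>n. ennreal (f n t)) \<partial>M)"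
    using lim by (intro nn_integral_cong) (metis lim_imp_Liminf tendsto_ennrealI trivial_limit_sequentially)
  also have "\<dots> \<le> liminf (\<lambda>n. \<integral>\<^sup>+t. ennreal (f n t) \<partial>M)"
    by (rule nn_integral_liminf) simp
  also have "\<dots> \<le> liminf (\<lambda>n. ennreal (\<bar>K\<bar> powr q))"
  proof (rule Liminf_mono, rule always_eventually, rule allI)
    fix n
    have "(\<integral>\<^sup>+t. ennreal (f n t) \<partial>M) = ennreal (\<integral>t. f n t \<partial>M)"
      using f_int f0 by (intro nn_integral_eq_integral) auto
    then show "(\<integral>\<^sup>+t. ennreal (f n t) \<partial>M) \<le> ennreal (\<bar>K\<bar> powr q)"
      using f_le by (simp add: ennreal_leI)
  qed
  also have "\<dots> < \<infinity>"
    by (simp add: Liminf_const)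
  finally have "integrable M (\<lambda>t. \<rho> t powr q)"
    by (intro integrableI_nonneg) auto
  then show ?thesis
    using False \<rho> p1 by (auto simp: conjugate_exponent_def Lp_def q_def)
qed

section \<open>Functionals on a Lebesgue-Bochner space: variation and densities\<close>

locale Lp_functional = sigma_finite_measure M
  for M :: "'t measure" +
  fixes p K :: real and h0 :: "'t \<Rightarrow> real"
    and \<phi> :: "('t \<Rightarrow> 'z::{real_normed_vector, second_countable_topology}) \<Rightarrow> real"
  assumes p: "1 \<le> p"
    and \<phi>_add: "\<And>f g. f \<in> Lp M (ennreal p) \<Longrightarrow> g \<in> Lp M (ennreal p) \<Longrightarrow> \<phi> (\<lambda>t. f t + g t) = \<phi> f + \<phi> g"
    and \<phi>_scale: "\<And>c f. f \<in> Lp M (ennreal p) \<Longrightarrow> \<phi> (\<lambda>t. c *\<^sub>R f t) = c * \<phi> f"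
    and \<phi>_bound: "\<And>f. f \<in> Lp M (ennreal p) \<Longrightarrow> \<bar>\<phi> f\<bar> \<le> K * Lp_norm M p f"
    and K: "0 \<le> K"
    and h0_meas[measurable]: "h0 \<in> borel_measurable M"
    and h0_pos: "\<And>t. 0 < h0 t"
    and h0_int: "integrable M (\<lambda>t. h0 t powr p)"
begin

lemma \<phi>_diff:
  assumes "f \<in> Lp M (ennreal p)" "g \<in> Lp M (ennreal p)"
  shows "\<phi> (\<lambda>t. f t - g t) = \<phi> f - \<phi> g"
  using \<phi>_add[OF assms(1) Lp_scale[OF p assms(2), of "-1"]] \<phi>_scale[OF assms(2), of "-1"] by simp

lemma \<phi>_zero: "\<phi> (\<lambda>t. 0) = 0"
proof -
  have "(\<lambda>t. 0) \<in> Lp M (ennreal p)"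
    by (simp add: Lp_iff[OF p])
  from \<phi>_scale[OF this, of 0] show ?thesis
    by simp
qed

text \<open>The functional acts on functions and not on classes; the bound by the seminorm makes it
  insensitive to null sets.\<close>

lemma \<phi>_cong_AE:
  assumes f: "f \<in> Lp M (ennreal p)" and g: "g \<in> Lp M (ennreal p)" and eq: "AE t in M. f t = g t"
  shows "\<phi> f = \<phi> g"
proof -
  have "(\<integral>t. norm (f t - g t) powr p \<partial>M) = 0"
    using eq by (intro integral_eq_zero_AE, eventually_elim) simp
  then have "Lp_norm M p (\<lambda>t. f t - g t) = 0"
    by (simp add: Lp_norm_def)
  then show ?thesis
    using \<phi>_bound[OF Lp_diff[OF p f g]] \<phi>_diff[OF f g] by simp
qed

lemma Lp_dominated:
  assumes "f \<in> borel_measurable M" "integrable M (\<lambda>t. G t powr p)" "AE t in M. norm (f t) \<le> G t"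
  shows "f \<in> Lp M (ennreal p)"
proof (rule Lp_bound[OF p assms(1,2)])
  show "AE t in M. norm (f t) powr p \<le> G t powr p"
    using assms(3) by eventually_elim (use p in \<open>auto intro!: powr_mono2\<close>)
qed

lemma \<phi>_tendsto:
  assumes f[measurable]: "\<And>n. f n \<in> borel_measurable M" "f' \<in> borel_measurable M"
    and lim: "AE t in M. (\<lambda>n. f n t) \<longlonglongrightarrow> f' t"
    and le: "\<And>n. AE t in M. norm (f n t) \<le> G t"
    and G: "integrable M (\<lambda>t. G t powr p)"
  shows "(\<lambda>n. \<phi> (f n)) \<longlonglongrightarrow> \<phi> f'"
proof -
  have AE_le: "AE t in M. \<forall>n. norm (f n t) \<le> G t"
    using le by (simp add: AE_all_countable)
  have le': "AE t in M. norm (f' t) \<le> G t"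
    using AE_le lim
  proof eventually_elim
    case (elim t)
    show ?case
      by (rule LIMSEQ_le_const2[OF tendsto_norm[OF elim(2)]]) (use elim(1) in auto)
  qed
  have fL: "f n \<in> Lp M (ennreal p)" and fL': "f' \<in> Lp M (ennreal p)" for n
    using Lp_dominated[OF f(1) G le] Lp_dominated[OF f(2) G le'] by auto
  have "(\<lambda>n. \<integral>t. norm (f n t - f' t) powr p \<partial>M) \<longlonglongrightarrow> (\<integral>t. 0 \<partial>M)"
  proof (rule integral_dominated_convergence)
    show "integrable M (\<lambda>t. 2 powr p * G t powr p)"
      using G by simp
    show "AE t in M. (\<lambda>n. norm (f n t - f' t) powr p) \<longlonglongrightarrow> 0"
      using lim
    proof eventually_elim
      case (elim t)
      have "(\<lambda>n. norm (f n t - f' t)) \<longlonglongrightarrow> 0"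
        using elim by (simp add: LIM_zero tendsto_norm_zero)
      then show ?case
        by (rule tendsto_zero_powrI) (use p in auto)
    qed
    show "AE t in M. norm (norm (f n t - f' t) powr p) \<le> 2 powr p * G t powr p" for n
      using AE_le le'
    proof eventually_elim
      case (elim t)
      have "norm (f n t - f' t) \<le> 2 * G t"
        using norm_triangle_ineq4[of "f n t" "f' t"] elim by (smt (verit))
      then have "norm (f n t - f' t) powr p \<le> (2 * G t) powr p"
        using p by (intro powr_mono2) auto
      then show ?case
        by (simp add: powr_mult)
    qed
  qed simp_all
  then have "(\<lambda>n. (\<integral>t. norm (f n t - f' t) powr p \<partial>M) powr (1 / p)) \<longlonglongrightarrow> 0"
    using p by (intro tendsto_zero_powrI[where b="1 / p"]) auto
  then have "(\<lambda>n. K * Lp_norm M p (\<lambda>t. f n t - f' t)) \<longlonglongrightarrow> 0"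
    unfolding Lp_norm_def by (rule tendsto_mult_right_zero)
  then have "(\<lambda>n. \<phi> (f n) - \<phi> f') \<longlonglongrightarrow> 0"
    by (rule Lim_null_comparison[rotated])
      (use \<phi>_bound[OF Lp_diff[OF p fL fL']] \<phi>_diff[OF fL fL'] in simp)
  then show ?thesis
    by (rule LIM_zero_cancel)
qed

text \<open>A pointwise bound, unlike a bound on the norm in L^p, allows functions on disjoint sets
  to be chosen independently. This is what makes the supremum of \<open>\<phi>\<close> over
  \<open>adm E\<close> additive in \<open>E\<close>.\<close>

definition adm :: "'t set \<Rightarrow> ('t \<Rightarrow> 'z) set" where
  "adm E = {a \<in> borel_measurable M. \<forall>t\<in>space M. norm (a t) \<le> indicator E t * h0 t}"

text \<open>The variation of the vector measure induced by \<open>\<phi>\<close>, with the weight \<open>h0\<close> to make it finite.\<close>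

definition var :: "'t set \<Rightarrow> real" where
  "var E = (SUP a\<in>adm E. \<phi> a)"

lemma h0_le_E: "integrable M (\<lambda>t. (indicator E t * h0 t) powr p)" if "E \<in> sets M"
proof -
  have "(\<lambda>t. (indicator E t * h0 t) powr p) = (\<lambda>t. indicator E t *\<^sub>R h0 t powr p)"
    by (auto simp: fun_eq_iff split: split_indicator)
  then show ?thesis
    using integrable_mult_indicator[OF that h0_int] by simp
qed

lemma adm_Lp: "a \<in> adm E \<Longrightarrow> E \<in> sets M \<Longrightarrow> a \<in> Lp M (ennreal p)"
  by (rule Lp_dominated[OF _ h0_le_E]) (auto simp: adm_def)

lemma adm_bound:
  assumes a: "a \<in> adm E" and E: "E \<in> sets M"
  shows "\<phi> a \<le> K * (\<integral>t. (indicator E t * h0 t) powr p \<partial>M) powr (1 / p)"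
proof -
  have "\<phi> a \<le> K * Lp_norm M p a"
    using \<phi>_bound[OF adm_Lp[OF a E]] by simp
  also have "\<dots> \<le> K * (\<integral>t. (indicator E t * h0 t) powr p \<partial>M) powr (1 / p)"
  proof (intro mult_left_mono K)
    have "(\<integral>t. norm (a t) powr p \<partial>M) \<le> (\<integral>t. (indicator E t * h0 t) powr p \<partial>M)"
      using adm_Lp[OF a E] h0_le_E[OF E] a p
      by (intro integral_mono) (auto simp: Lp_iff[OF p] adm_def intro!: powr_mono2)
    then show "Lp_norm M p a \<le> (\<integral>t. (indicator E t * h0 t) powr p \<partial>M) powr (1 / p)"
      unfolding Lp_norm_def using p by (intro powr_mono2) auto
  qed
  finally show ?thesis .
qed

lemma zero_adm: "(\<lambda>t. 0) \<in> adm E"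
  using h0_pos by (auto simp: adm_def less_imp_le)

lemma
  assumes E: "E \<in> sets M"
  shows \<phi>_le_var: "a \<in> adm E \<Longrightarrow> \<phi> a \<le> var E"
    and var_le: "(\<And>a. a \<in> adm E \<Longrightarrow> \<phi> a \<le> c) \<Longrightarrow> var E \<le> c"
  unfolding var_def using adm_bound[OF _ E] zero_adm[of E]
  by (auto intro!: cSUP_upper bdd_aboveI2 cSUP_least)

lemma var_nonneg: "E \<in> sets M \<Longrightarrow> 0 \<le> var E"
  using \<phi>_le_var[OF _ zero_adm[of E]] \<phi>_zero by simp

lemma var_add:
  assumes A: "A \<in> sets M" and B: "B \<in> sets M" and AB: "A \<inter> B = {}"
  shows "var (A \<union> B) = var A + var B"
proof (rule antisym)
  note [measurable] = A B
  show "var (A \<union> B) \<le> var A + var B"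
  proof (rule var_le)
    fix a assume a: "a \<in> adm (A \<union> B)"
    then have [measurable]: "a \<in> borel_measurable M"
      by (simp add: adm_def)
    have 1: "(\<lambda>t. indicator A t *\<^sub>R a t) \<in> adm A" and 2: "(\<lambda>t. indicator B t *\<^sub>R a t) \<in> adm B"
      using a by (auto simp: adm_def split: split_indicator)
    have AB_eq: "indicator A t *\<^sub>R a t + indicator B t *\<^sub>R a t = a t" if "t \<in> space M" for t
      using a AB that by (auto simp: adm_def split: split_indicator split_indicator_asm)
    have ab: "a \<in> Lp M (ennreal p)"
      using adm_Lp[OF a] by simp
    have sumL: "(\<lambda>t. indicator A t *\<^sub>R a t + indicator B t *\<^sub>R a t) \<in> Lp M (ennreal p)"
      using Lp_add[OF p adm_Lp[OF 1 A] adm_Lp[OF 2 B]] .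
    have "\<phi> a = \<phi> (\<lambda>t. indicator A t *\<^sub>R a t + indicator B t *\<^sub>R a t)"
      using ab sumL by (rule \<phi>_cong_AE) (use AB_eq in auto)
    also have "\<dots> = \<phi> (\<lambda>t. indicator A t *\<^sub>R a t) + \<phi> (\<lambda>t. indicator B t *\<^sub>R a t)"
      by (rule \<phi>_add[OF adm_Lp[OF 1 A] adm_Lp[OF 2 B]])
    also have "\<dots> \<le> var A + var B"
      by (intro add_mono \<phi>_le_var 1 2 A B)
    finally show "\<phi> a \<le> var A + var B" .
  qed simp
  have "\<phi> a + \<phi> b \<le> var (A \<union> B)" if a: "a \<in> adm A" and b: "b \<in> adm B" for a b
  proof -
    have "(\<lambda>t. a t + b t) \<in> adm (A \<union> B)"
      unfolding adm_def
    proof (intro CollectI conjI ballI)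
      show "(\<lambda>t. a t + b t) \<in> borel_measurable M"
        using a b by (auto simp: adm_def)
      fix t assume "t \<in> space M"
      then have "norm (a t) \<le> indicator A t * h0 t" "norm (b t) \<le> indicator B t * h0 t"
        using a b by (auto simp: adm_def)
      then show "norm (a t + b t) \<le> indicator (A \<union> B) t * h0 t"
        using norm_triangle_ineq[of "a t" "b t"] AB by (auto split: split_indicator split_indicator_asm)
    qed
    then show ?thesis
      using \<phi>_add[OF adm_Lp[OF a A] adm_Lp[OF b B]] \<phi>_le_var[of "A \<union> B" "\<lambda>t. a t + b t"] by simp
  qed
  then have "var A \<le> var (A \<union> B) - \<phi> b" if "b \<in> adm B" for b
    using that by (intro var_le A) (simp add: le_diff_eq)
  then have "var B \<le> var (A \<union> B) - var A"
    by (intro var_le B) (simp add: le_diff_eq add.commute)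
  then show "var A + var B \<le> var (A \<union> B)"
    by simp
qed

lemma var_null: "E \<in> null_sets M \<Longrightarrow> var E = 0"
proof -
  assume E: "E \<in> null_sets M"
  have "(\<integral>t. (indicator E t * h0 t) powr p \<partial>M) = 0"
    using AE_not_in[OF E] by (intro integral_eq_zero_AE, eventually_elim) simp
  then have "var E \<le> 0"
    using adm_bound[of _ E] E by (intro var_le) auto
  then show ?thesis
    using var_nonneg[of E] E by auto
qed

text \<open>By \<open>adm_bound\<close> the variation is controlled by the seminorm of the weight on
  \<open>A i\<close>, which tends to 0 by dominated convergence.\<close>

lemma var_tendsto:
  assumes A: "range A \<subseteq> sets M" "(\<Inter>i. A i) = {}" "decseq A"
  shows "(\<lambda>i. var (A i)) \<longlonglongrightarrow> 0"
proof -
  have [measurable]: "A i \<in> sets M" for i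
    using A by auto
  have "(\<lambda>i. \<integral>t. (indicator (A i) t * h0 t) powr p \<partial>M) \<longlonglongrightarrow> (\<integral>t. 0 \<partial>M)"
  proof (rule integral_dominated_convergence[OF _ _ h0_int])
    show "AE t in M. (\<lambda>i. (indicator (A i) t * h0 t) powr p) \<longlonglongrightarrow> 0"
    proof (rule AE_I2, rule tendsto_eventually)
      fix t
      obtain i0 where "t \<notin> A i0"
        using A(2) by blast
      then have "t \<notin> A i" if "i \<ge> i0" for i
        using that A(3) unfolding decseq_def by blast
      then show "\<forall>\<^sub>F i in sequentially. (indicator (A i) t * h0 t) powr p = 0"
        unfolding eventually_sequentially by (intro exI[of _ i0]) simp
    qed
    show "AE t in M. norm ((indicator (A i) t * h0 t) powr p) \<le> h0 t powr p" for i
      by (auto split: split_indicator)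
  qed simp_all
  then have "(\<lambda>i. (\<integral>t. (indicator (A i) t * h0 t) powr p \<partial>M) powr (1 / p)) \<longlonglongrightarrow> 0"
    using p by (intro tendsto_zero_powrI[where b="1 / p"]) auto
  then have lim: "(\<lambda>i. K * (\<integral>t. (indicator (A i) t * h0 t) powr p \<partial>M) powr (1 / p)) \<longlonglongrightarrow> 0"
    by (rule tendsto_mult_right_zero)
  show ?thesis
    by (rule Lim_null_comparison[OF _ lim], rule always_eventually)
      (use var_nonneg var_le adm_bound in \<open>simp add: abs_of_nonneg\<close>)
qed

text \<open>The weight keeps the function in L^p even when \<open>E\<close> has infinite measure,
  and for nonzero \<open>z\<close> division by \<open>norm z\<close> makes it admissible. The set
  function \<open>\<phi> (unit_fun E z)\<close> is thus dominated by
  \<open>norm z * var E\<close>.\<close>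

definition unit_fun :: "'t set \<Rightarrow> 'z \<Rightarrow> 't \<Rightarrow> 'z" where
  "unit_fun E z t = indicator E t *\<^sub>R (h0 t *\<^sub>R z)"

lemma unit_fun_Lp: "E \<in> sets M \<Longrightarrow> unit_fun E z \<in> Lp M (ennreal p)"
proof -
  assume E: "E \<in> sets M"
  then have 1: "(\<lambda>t. indicator E t *\<^sub>R (h0 t *\<^sub>R z)) \<in> borel_measurable M"
    by measurable
  have "integrable M (\<lambda>t. norm z powr p * (indicator E t * h0 t) powr p)"
    using h0_le_E[OF E] by simp
  then show ?thesis
    unfolding unit_fun_def
    by (rule Lp_bound[OF p 1]) (use h0_pos in \<open>auto simp: powr_mult abs_of_pos ac_simps split: split_indicator\<close>)
qed

lemma \<phi>_unit_fun_le:
  assumes E: "E \<in> sets M"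
  shows "\<bar>\<phi> (unit_fun E z)\<bar> \<le> norm z * var E"
proof -
  have le: "\<phi> (unit_fun E z) \<le> norm z * var E" for z
  proof (cases "z = 0")
    case True
    then have "unit_fun E z = (\<lambda>t. 0)"
      by (simp add: unit_fun_def fun_eq_iff)
    then show ?thesis
      using True \<phi>_zero by simp
  next
    case False
    have "(\<lambda>t. (1 / norm z) *\<^sub>R unit_fun E z t) \<in> adm E"
      unfolding adm_def
    proof (intro CollectI conjI ballI)
      show "(\<lambda>t. (1 / norm z) *\<^sub>R unit_fun E z t) \<in> borel_measurable M"
        using Lp_measurable[OF unit_fun_Lp[OF E, of z]] by measurable
      show "norm ((1 / norm z) *\<^sub>R unit_fun E z t) \<le> indicator E t * h0 t" for t
        using False by (simp add: unit_fun_def abs_of_pos[OF h0_pos] less_imp_le[OF h0_pos] split: split_indicator)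
    qed
    from \<phi>_le_var[OF E this] show ?thesis
      using False unfolding \<phi>_scale[OF unit_fun_Lp[OF E]] by (simp add: field_simps)
  qed
  have "unit_fun E (- z) = (\<lambda>t. (- 1) *\<^sub>R unit_fun E z t)"
    by (simp add: unit_fun_def fun_eq_iff)
  then have "\<phi> (unit_fun E (- z)) = - \<phi> (unit_fun E z)"
    using \<phi>_scale[OF unit_fun_Lp[OF E], of "-1" z] by simp
  then show ?thesis
    using le[of z] le[of "- z"] by (simp add: abs_le_iff)
qed

lemma unit_fun_Un:
  assumes "A \<in> sets M" "B \<in> sets M" "A \<inter> B = {}"
  shows "\<phi> (unit_fun (A \<union> B) z) = \<phi> (unit_fun A z) + \<phi> (unit_fun B z)"
proof -
  have "unit_fun (A \<union> B) z = (\<lambda>t. unit_fun A z t + unit_fun B z t)"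
    using assms(3) by (auto simp: unit_fun_def fun_eq_iff split: split_indicator)
  then show ?thesis
    using \<phi>_add[OF unit_fun_Lp[OF assms(1)] unit_fun_Lp[OF assms(2)], of z z] by simp
qed

text \<open>\<open>g\<close> is the density of the variation and \<open>X z\<close> that of the
  scalar measure in the direction \<open>z\<close>. Inequalities and identities between set
  functions pass to densities, but only almost everywhere: the null sets depend on \<open>z\<close>,
  \<open>w\<close> and \<open>c\<close>, so \<open>X\<close> need not yet be linear at any single
  \<open>t\<close>.\<close>

lemma ex_densities:
  obtains g :: "'t \<Rightarrow> real" and X :: "'z \<Rightarrow> 't \<Rightarrow> real"
  where "\<And>t. 0 \<le> g t" "integrable M g" "\<And>z. integrable M (X z)"
    "\<And>z E. E \<in> sets M \<Longrightarrow> \<phi> (unit_fun E z) = (\<integral>t. indicator E t * X z t \<partial>M)"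
    "\<And>z. AE t in M. \<bar>X z t\<bar> \<le> g t * norm z"
    "\<And>z w. AE t in M. X (z + w) t = X z t + X w t"
    "\<And>c z. AE t in M. X (c *\<^sub>R z) t = c * X z t"
proof -
  obtain g where g: "\<And>t. 0 \<le> g t" "integrable M g"
    "\<And>E. E \<in> sets M \<Longrightarrow> var E = (\<integral>t. indicator E t * g t \<partial>M)"
    by (rule Radon_Nikodym_real[of var, OF var_nonneg var_add var_tendsto var_null]) blast+
  have ind: "integrable M (\<lambda>t. indicator E t * f t)" if "E \<in> sets M" "integrable M f" for E and f :: "'t \<Rightarrow> real"
    using integrable_mult_indicator[OF that] by simp
  have "\<exists>x. integrable M x \<and> (\<forall>E\<in>sets M. \<phi> (unit_fun E z) = (\<integral>t. indicator E t * x t \<partial>M))" for z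
  proof -
    \<comment> \<open>Adding \<open>norm z * var E\<close> makes the signed set function
      nonnegative; the density \<open>norm z * g t\<close> is subtracted again below.\<close>
    obtain f where f: "integrable M f"
      "\<And>E. E \<in> sets M \<Longrightarrow> norm z * var E + \<phi> (unit_fun E z) = (\<integral>t. indicator E t * f t \<partial>M)"
    proof (rule Radon_Nikodym_real[of "\<lambda>E. norm z * var E + \<phi> (unit_fun E z)"])
      show "0 \<le> norm z * var E + \<phi> (unit_fun E z)" if "E \<in> sets M" for E
        using \<phi>_unit_fun_le[OF that, of z] by simp
      show "norm z * var (A \<union> B) + \<phi> (unit_fun (A \<union> B) z) =
          norm z * var A + \<phi> (unit_fun A z) + (norm z * var B + \<phi> (unit_fun B z))"
        if "A \<in> sets M" "B \<in> sets M" "A \<inter> B = {}" for A B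
        using var_add[OF that] unit_fun_Un[OF that] by (simp add: algebra_simps)
      show "norm z * var E + \<phi> (unit_fun E z) = 0" if "E \<in> null_sets M" for E
        using \<phi>_unit_fun_le[of E z] var_null[OF that] that by auto
      show "(\<lambda>i. norm z * var (A i) + \<phi> (unit_fun (A i) z)) \<longlonglongrightarrow> 0"
        if A: "range A \<subseteq> sets M" "decseq A" "(\<Inter>i. A i) = {}" for A
      proof -
        have v: "(\<lambda>i. norm z * var (A i)) \<longlonglongrightarrow> 0"
          using var_tendsto[OF A(1,3,2)] by (rule tendsto_mult_right_zero)
        have "(\<lambda>i. \<phi> (unit_fun (A i) z)) \<longlonglongrightarrow> 0"
          by (rule Lim_null_comparison[OF _ v], rule always_eventually)
            (use \<phi>_unit_fun_le A(1) in auto)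
        with v show ?thesis
          using tendsto_add by fastforce
      qed
    qed blast
    show ?thesis
    proof (intro exI[of _ "\<lambda>t. f t - norm z * g t"] conjI ballI)
      show "integrable M (\<lambda>t. f t - norm z * g t)"
        using f(1) g(2) by simp
      fix E assume E: "E \<in> sets M"
      have "(\<integral>t. indicator E t * (f t - norm z * g t) \<partial>M) =
          (\<integral>t. indicator E t * f t - norm z * (indicator E t * g t) \<partial>M)"
        by (simp add: algebra_simps)
      also have "\<dots> = (\<integral>t. indicator E t * f t \<partial>M) - norm z * (\<integral>t. indicator E t * g t \<partial>M)"
        using ind[OF E f(1)] ind[OF E g(2)] by simp
      also have "\<dots> = \<phi> (unit_fun E z)"
        using f(2)[OF E] g(3)[OF E] by simp
      finally show "\<phi> (unit_fun E z) = (\<integral>t. indicator E t * (f t - norm z * g t) \<partial>M)"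
        by simp
    qed
  qed
  then obtain X where X: "\<And>z. integrable M (X z)"
    "\<And>z E. E \<in> sets M \<Longrightarrow> \<phi> (unit_fun E z) = (\<integral>t. indicator E t * X z t \<partial>M)"
    by metis
  have gz: "integrable M (\<lambda>t. g t * norm z)" "(\<integral>t. indicator E t * (g t * norm z) \<partial>M) = norm z * var E"
    if "E \<in> sets M" for z :: 'z and E
  proof -
    show "integrable M (\<lambda>t. g t * norm z)"
      using g(2) by simp
    have "(\<integral>t. indicator E t * (g t * norm z) \<partial>M) = (\<integral>t. norm z * (indicator E t * g t) \<partial>M)"
      by (simp add: ac_simps)
    then show "(\<integral>t. indicator E t * (g t * norm z) \<partial>M) = norm z * var E"
      using g(3)[OF that] by simp
  qed
  have "AE t in M. \<bar>X z t\<bar> \<le> g t * norm z" for z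
  proof -
    have "AE t in M. X z t \<le> g t * norm z"
      by (rule AE_le_of_integral_le[OF X(1)])
        (use gz \<phi>_unit_fun_le[of _ z] X(2)[of _ z] g(2) in \<open>auto simp: abs_le_iff\<close>)
    moreover have "AE t in M. - X z t \<le> g t * norm z"
      by (rule AE_le_of_integral_le)
        (use gz \<phi>_unit_fun_le[of _ z] X(1) X(2)[of _ z] g(2) in \<open>auto simp: abs_le_iff\<close>)
    ultimately show ?thesis
      by eventually_elim (simp add: abs_le_iff)
  qed
  moreover have "AE t in M. X (z + w) t = X z t + X w t" for z w
  proof (rule AE_eq_of_integral_eq)
    fix E assume E: "E \<in> sets M"
    have "unit_fun E (z + w) = (\<lambda>t. unit_fun E z t + unit_fun E w t)"
      by (simp add: unit_fun_def fun_eq_iff scaleR_add_right)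
    then have "\<phi> (unit_fun E (z + w)) = \<phi> (unit_fun E z) + \<phi> (unit_fun E w)"
      using \<phi>_add[OF unit_fun_Lp[OF E] unit_fun_Lp[OF E], of z w] by simp
    then show "(\<integral>t. indicator E t * X (z + w) t \<partial>M) = (\<integral>t. indicator E t * (X z t + X w t) \<partial>M)"
      using X ind[OF E] E by (simp add: distrib_left)
  qed (use X in auto)
  moreover have "AE t in M. X (c *\<^sub>R z) t = c * X z t" for c z
  proof (rule AE_eq_of_integral_eq)
    fix E assume E: "E \<in> sets M"
    have "unit_fun E (c *\<^sub>R z) = (\<lambda>t. c *\<^sub>R unit_fun E z t)"
      by (simp add: unit_fun_def fun_eq_iff ac_simps)
    then have "\<phi> (unit_fun E (c *\<^sub>R z)) = c * \<phi> (unit_fun E z)"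
      using \<phi>_scale[OF unit_fun_Lp[OF E], of c z] by simp
    moreover have "(\<integral>t. indicator E t * (c * X z t) \<partial>M) = c * (\<integral>t. indicator E t * X z t \<partial>M)"
      by (simp flip: integral_mult_right_zero add: ac_simps)
    ultimately show "(\<integral>t. indicator E t * X (c *\<^sub>R z) t \<partial>M) = (\<integral>t. indicator E t * (c * X z t) \<partial>M)"
      using X E by simp
  qed (use X in auto)
  ultimately show ?thesis
    using that[of g X] g(1,2) X by blast
qed

text \<open>Restricted to the rational span of a dense sequence, linearity and boundedness of the
  scalar densities are countably many conditions and hold together at almost every \<open>t\<close>.
  Reflexivity enters through separability of the dual, which turns measurability of all evaluations
  into Borel measurability.\<close>

lemma ex_operator_density:
  assumes refl: "reflexive TYPE('z)"
  obtains \<eta> :: "'t \<Rightarrow> 'z \<Rightarrow>\<^sub>L real" and g where "\<eta> \<in> borel_measurable M" "integrable M g"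
    "\<And>t. norm (\<eta> t) \<le> g t"
    "\<And>E z. E \<in> sets M \<Longrightarrow> \<phi> (unit_fun E z) = (\<integral>t. indicator E t * blinfun_apply (\<eta> t) z \<partial>M)"
proof -
  obtain d :: "nat \<Rightarrow> 'z" where d: "\<And>w e. e > 0 \<Longrightarrow> \<exists>n. dist w (d n) < e"
    by (erule ex_dense_sequence)
  define e where "e = from_nat_into (rational_span d)"
  have range_e: "range e = rational_span d"
    unfolding e_def using countable_rational_span rational_span_base[of d] by (intro range_from_nat_into) auto
  have dense: "closure (rational_span d) = UNIV"
  proof -
    have "x \<in> closure (rational_span d)" for x
      unfolding closure_approachable
    proof (intro allI impI)
      fix r :: real assume "r > 0"
      then obtain n where "dist x (d n) < r"
        using d by blast
      then show "\<exists>y\<in>rational_span d. dist y x < r"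
        using rational_span_base[of d n] by (auto simp: dist_commute)
    qed
    then show ?thesis
      by blast
  qed
  have seq: "\<exists>s. (\<lambda>n. e (s n)) \<longlonglongrightarrow> x" for x
  proof -
    obtain f where f: "\<And>n. f n \<in> range e" "f \<longlonglongrightarrow> x"
      using dense closure_sequential[of x "rational_span d"] range_e by auto
    from f(1) have "\<forall>n. \<exists>i. f n = e i"
      by blast
    from choice[OF this] obtain s where "\<forall>n. f n = e (s n)"
      by blast
    then have "f = (\<lambda>n. e (s n))"
      by (simp add: fun_eq_iff)
    then show ?thesis
      using f(2) by blast
  qed
  obtain g and X :: "'z \<Rightarrow> 't \<Rightarrow> real"
    where g: "\<And>t. 0 \<le> g t" "integrable M g" and X: "\<And>z. integrable M (X z)"
    and \<phi>X: "\<And>z E. E \<in> sets M \<Longrightarrow> \<phi> (unit_fun E z) = (\<integral>t. indicator E t * X z t \<partial>M)"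
    and X_bound: "\<And>z. AE t in M. \<bar>X z t\<bar> \<le> g t * norm z"
    and X_add: "\<And>z w. AE t in M. X (z + w) t = X z t + X w t"
    and X_scale: "\<And>c z. AE t in M. X (c *\<^sub>R z) t = c * X z t"
    by (rule ex_densities) blast
  note [measurable] = borel_measurable_integrable[OF X] borel_measurable_integrable[OF g(2)]
  define good where "good t \<longleftrightarrow> (\<forall>i. \<bar>X (e i) t\<bar> \<le> g t * norm (e i)) \<and>
      (\<forall>i j. X (e i + e j) t = X (e i) t + X (e j) t) \<and>
      (\<forall>c i. X (real_of_rat c *\<^sub>R e i) t = real_of_rat c * X (e i) t)" for t
  have [measurable]: "Measurable.pred M good"
    unfolding good_def by measurable
  have AE_good: "AE t in M. good t"
    unfolding good_def using X_bound X_add X_scale by (simp add: AE_all_countable)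
  define P where "P t F \<longleftrightarrow> (\<forall>z\<in>rational_span d. blinfun_apply F z = X z t) \<and> norm F \<le> g t" for t F
  \<comment> \<open>The choice is harmless: a bounded functional is determined by its values on the
    dense rational span, and measurability is derived from these values.\<close>
  define \<eta> where "\<eta> t = (if good t then (SOME F. P t F) else 0)" for t
  have \<eta>P: "P t (\<eta> t)" if "good t" for t
  proof -
    have "\<exists>F. P t F"
      unfolding P_def
    proof (rule blinfun_extension_rational[OF dense rational_span_add rational_span_scale _ _ _ g(1)])
      fix x y assume "x \<in> rational_span d" "y \<in> rational_span d"
      then obtain i j where "x = e i" "y = e j"
        using range_e by blast
      then show "X (x + y) t = X x t + X y t"
        using that by (simp add: good_def)
    next
      fix c x assume "x \<in> rational_span d"
      then obtain i where "x = e i"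
        using range_e by blast
      then show "X (real_of_rat c *\<^sub>R x) t = real_of_rat c * X x t" "\<bar>X x t\<bar> \<le> g t * norm x"
        using that by (simp_all add: good_def)
    qed
    then show ?thesis
      using that unfolding \<eta>_def by (simp add: someI_ex)
  qed
  have \<eta>e: "blinfun_apply (\<eta> t) (e i) = (if good t then X (e i) t else 0)" for t i
    using \<eta>P[of t] range_e by (auto simp: P_def \<eta>_def)
  have \<eta>g: "norm (\<eta> t) \<le> g t" for t
    using \<eta>P[of t] g(1)[of t] by (cases "good t") (auto simp: P_def \<eta>_def)
  have \<eta>_point: "(\<lambda>t. blinfun_apply (\<eta> t) z) \<in> borel_measurable M" for z
  proof -
    obtain s where s: "(\<lambda>n. e (s n)) \<longlonglongrightarrow> z"
      using seq by blast
    show ?thesis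
    proof (rule borel_measurable_LIMSEQ_metric)
      show "(\<lambda>t. blinfun_apply (\<eta> t) (e (s n))) \<in> borel_measurable M" for n
        unfolding \<eta>e by measurable
      show "(\<lambda>n. blinfun_apply (\<eta> t) (e (s n))) \<longlonglongrightarrow> blinfun_apply (\<eta> t) z" for t
        by (intro tendsto_intros s)
    qed
  qed
  obtain Ds :: "nat \<Rightarrow> 'z \<Rightarrow>\<^sub>L real" where "\<And>f r. r > 0 \<Longrightarrow> \<exists>n. dist f (Ds n) < r"
    by (erule reflexive_imp_separable_dual[OF refl])
  then have \<eta>_meas: "\<eta> \<in> borel_measurable M"
    using borel_measurable_blinfunI[OF \<eta>_point] by blast
  \<comment> \<open>A vector outside the rational span has its own null set. The bound for
    \<open>X z - X (e i)\<close> compares it with all \<open>e i\<close> at once, and approximation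
    by the \<open>e i\<close> gives equality.\<close>
  have AE_eq: "AE t in M. X z t = blinfun_apply (\<eta> t) z" for z
  proof -
    have "AE t in M. \<bar>X z t - X (e i) t\<bar> \<le> g t * norm (z - e i)" for i
      using X_bound[of "z + (- 1) *\<^sub>R e i"] X_add[of z "(- 1) *\<^sub>R e i"] X_scale[of "- 1" "e i"]
      by eventually_elim simp
    then have "AE t in M. \<forall>i. \<bar>X z t - X (e i) t\<bar> \<le> g t * norm (z - e i)"
      by (simp add: AE_all_countable)
    then show ?thesis
      using AE_good
    proof eventually_elim
      case (elim t)
      obtain s where s: "(\<lambda>n. e (s n)) \<longlonglongrightarrow> z"
        using seq by blast
      have "(\<lambda>n. g t * norm (z - e (s n))) \<longlonglongrightarrow> g t * norm (z - z)"
        by (intro tendsto_intros s)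
      then have "(\<lambda>n. X z t - blinfun_apply (\<eta> t) (e (s n))) \<longlonglongrightarrow> 0"
        by (intro Lim_null_comparison[of "\<lambda>n. X z t - blinfun_apply (\<eta> t) (e (s n))" "\<lambda>n. g t * norm (z - e (s n))"])
          (use elim in \<open>auto simp: \<eta>e\<close>)
      moreover have "(\<lambda>n. X z t - blinfun_apply (\<eta> t) (e (s n))) \<longlonglongrightarrow> X z t - blinfun_apply (\<eta> t) z"
        by (intro tendsto_intros s)
      ultimately show ?case
        using LIMSEQ_unique by fastforce
    qed
  qed
  have "\<phi> (unit_fun E z) = (\<integral>t. indicator E t * blinfun_apply (\<eta> t) z \<partial>M)" if [measurable]: "E \<in> sets M" for E z
  proof -
    note [measurable] = \<eta>_point
    have "(\<integral>t. indicator E t * X z t \<partial>M) = (\<integral>t. indicator E t * blinfun_apply (\<eta> t) z \<partial>M)"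
      using AE_eq[of z] by (intro integral_cong_AE) auto
    then show ?thesis
      using \<phi>X by simp
  qed
  then show ?thesis
    using that \<eta>_meas g(2) \<eta>g by blast
qed

end

locale Lp_functional_density = Lp_functional M p K h0 \<phi>
  for M :: "'t measure" and p K h0
    and \<phi> :: "('t \<Rightarrow> 'z::{real_normed_vector, second_countable_topology}) \<Rightarrow> real" +
  fixes \<eta> :: "'t \<Rightarrow> 'z \<Rightarrow>\<^sub>L real" and g :: "'t \<Rightarrow> real"
  assumes \<eta>_meas[measurable]: "\<eta> \<in> borel_measurable M" and g_int: "integrable M g"
    and \<eta>_le: "\<And>t. norm (\<eta> t) \<le> g t"
    and \<phi>_unit_fun: "\<And>E z. E \<in> sets M \<Longrightarrow> \<phi> (unit_fun E z) = (\<integral>t. indicator E t * blinfun_apply (\<eta> t) z \<partial>M)"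
begin

lemma \<eta>_apply_measurable[measurable (raw)]:
  "b \<in> borel_measurable M \<Longrightarrow> (\<lambda>t. blinfun_apply (\<eta> t) (b t)) \<in> borel_measurable M"
  by (rule borel_measurable_blinfun_apply[OF borel_measurable_blinfun_point[OF \<eta>_meas]])

lemma \<eta>_apply_le: "\<bar>blinfun_apply (\<eta> t) z\<bar> \<le> g t * norm z"
  using norm_blinfun[of "\<eta> t" z] mult_right_mono[OF \<eta>_le[of t], of "norm z"] by simp

lemma \<eta>_apply_integrable:
  assumes "b \<in> borel_measurable M" "\<And>t. norm (b t) \<le> B"
  shows "integrable M (\<lambda>t. blinfun_apply (\<eta> t) (b t))"
proof (rule Bochner_Integration.integrable_bound)
  show "integrable M (\<lambda>t. B * g t)"
    using g_int by simp
  have g0: "g t \<ge> 0" for t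
    using order.trans[OF norm_ge_zero \<eta>_le] .
  show "AE t in M. norm (blinfun_apply (\<eta> t) (b t)) \<le> norm (B * g t)"
  proof (rule AE_I2)
    fix t
    have "g t * norm (b t) \<le> g t * B"
      using assms(2) g0 by (intro mult_left_mono)
    then show "norm (blinfun_apply (\<eta> t) (b t)) \<le> norm (B * g t)"
      using \<eta>_apply_le[of t "b t"] abs_ge_self[of "B * g t"] by (simp add: mult.commute)
  qed
qed (use assms(1) in measurable)

lemma simple_representation:
  assumes s: "simple_function M s"
  shows "\<phi> (\<lambda>t. h0 t *\<^sub>R s t) = (\<integral>t. blinfun_apply (\<eta> t) (s t) \<partial>M)"
proof -
  define E where "E z = s -` {z} \<inter> space M" for z
  have E[measurable]: "E z \<in> sets M" for z
    unfolding E_def using s by (rule simple_functionD)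
  have fin: "finite (s ` space M)"
    using s by (rule simple_functionD)
  have sum: "(\<lambda>t. \<Sum>z\<in>Z. unit_fun (E z) z t) \<in> Lp M (ennreal p) \<and>
      \<phi> (\<lambda>t. \<Sum>z\<in>Z. unit_fun (E z) z t) = (\<Sum>z\<in>Z. \<phi> (unit_fun (E z) z))" if "finite Z" for Z
    using that
  proof (induction Z)
    case empty
    then show ?case
      by (simp add: \<phi>_zero Lp_iff[OF p])
  next
    case (insert w Z)
    then show ?case
      using Lp_add[OF p unit_fun_Lp[OF E, of w w]] \<phi>_add[OF unit_fun_Lp[OF E, of w w]] by simp
  qed
  have split: "(\<Sum>z\<in>s ` space M. indicator (E z) t *\<^sub>R f z) = f (s t)" if "t \<in> space M"
    for t and f :: "'z \<Rightarrow> 'c::real_vector"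
  proof -
    have "(\<Sum>z\<in>s ` space M. indicator (E z) t *\<^sub>R f z) = (\<Sum>z\<in>s ` space M. if z = s t then f z else 0)"
      using that by (intro sum.cong) (auto simp: E_def split: split_indicator)
    then show ?thesis
      using that fin by simp
  qed
  have eq: "h0 t *\<^sub>R s t = (\<Sum>z\<in>s ` space M. unit_fun (E z) z t)" if "t \<in> space M" for t
    unfolding unit_fun_def using split[OF that, of "\<lambda>z. h0 t *\<^sub>R z"] by simp
  have [measurable]: "s \<in> borel_measurable M"
    using s by (rule borel_measurable_simple_function)
  have L: "(\<lambda>t. h0 t *\<^sub>R s t) \<in> Lp M (ennreal p)"
    by (rule Lp_mono[OF p _ conjunct1[OF sum[OF fin]]]) (auto simp: eq)
  have "\<phi> (\<lambda>t. h0 t *\<^sub>R s t) = \<phi> (\<lambda>t. \<Sum>z\<in>s ` space M. unit_fun (E z) z t)"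
    by (rule \<phi>_cong_AE[OF L]) (use sum[OF fin] eq in auto)
  also have "\<dots> = (\<Sum>z\<in>s ` space M. \<integral>t. indicator (E z) t * blinfun_apply (\<eta> t) z \<partial>M)"
    using sum[OF fin] \<phi>_unit_fun[OF E] by simp
  also have "\<dots> = (\<integral>t. (\<Sum>z\<in>s ` space M. indicator (E z) t * blinfun_apply (\<eta> t) z) \<partial>M)"
  proof (rule Bochner_Integration.integral_sum[symmetric])
    fix z
    show "integrable M (\<lambda>t. indicator (E z) t * blinfun_apply (\<eta> t) z)"
      using integrable_mult_indicator[OF E[of z] \<eta>_apply_integrable[of "\<lambda>_. z" "norm z"]] by simp
  qed
  also have "\<dots> = (\<integral>t. blinfun_apply (\<eta> t) (s t) \<partial>M)"
  proof (rule Bochner_Integration.integral_cong[OF refl])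
    fix t assume "t \<in> space M"
    then show "(\<Sum>z\<in>s ` space M. indicator (E z) t * blinfun_apply (\<eta> t) z) = blinfun_apply (\<eta> t) (s t)"
      using split[of t "\<lambda>z. blinfun_apply (\<eta> t) z"] by simp
  qed
  finally show ?thesis .
qed

lemma bounded_representation:
  assumes b[measurable]: "b \<in> borel_measurable M" and le: "\<And>t. norm (b t) \<le> B"
  shows "\<phi> (\<lambda>t. h0 t *\<^sub>R b t) = (\<integral>t. blinfun_apply (\<eta> t) (b t) \<partial>M)"
proof -
  obtain F where F: "\<And>i. simple_function M (F i)" and lim: "\<And>t. t \<in> space M \<Longrightarrow> (\<lambda>i. F i t) \<longlonglongrightarrow> b t"
    and F_le: "\<And>i t. t \<in> space M \<Longrightarrow> dist (F i t) 0 \<le> 2 * dist (b t) 0"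
    using borel_measurable_implies_sequence_metric[OF b, of 0] by blast
  note [measurable] = borel_measurable_simple_function[OF F]
  have B: "norm (F i t) \<le> 2 * B" if "t \<in> space M" for i t
    using F_le[OF that, of i] le[of t] by simp
  have "(\<lambda>i. \<phi> (\<lambda>t. h0 t *\<^sub>R F i t)) \<longlonglongrightarrow> \<phi> (\<lambda>t. h0 t *\<^sub>R b t)"
  proof (rule \<phi>_tendsto)
    show "integrable M (\<lambda>t. (2 * B * h0 t) powr p)"
      using h0_int by (simp add: powr_mult)
    show "AE t in M. norm (h0 t *\<^sub>R F i t) \<le> 2 * B * h0 t" for i
      using B h0_pos by (intro AE_I2) (simp add: mult.commute mult_right_mono abs_of_pos)
    show "AE t in M. (\<lambda>i. h0 t *\<^sub>R F i t) \<longlonglongrightarrow> h0 t *\<^sub>R b t"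
      by (intro AE_I2 tendsto_scaleR tendsto_const lim)
  qed measurable
  then have 1: "(\<lambda>i. \<integral>t. blinfun_apply (\<eta> t) (F i t) \<partial>M) \<longlonglongrightarrow> \<phi> (\<lambda>t. h0 t *\<^sub>R b t)"
    by (simp add: simple_representation[OF F])
  have 2: "(\<lambda>i. \<integral>t. blinfun_apply (\<eta> t) (F i t) \<partial>M) \<longlonglongrightarrow> (\<integral>t. blinfun_apply (\<eta> t) (b t) \<partial>M)"
  proof (rule integral_dominated_convergence)
    show "integrable M (\<lambda>t. 2 * B * g t)"
      using g_int by simp
    show "AE t in M. (\<lambda>i. blinfun_apply (\<eta> t) (F i t)) \<longlonglongrightarrow> blinfun_apply (\<eta> t) (b t)"
      using lim by (auto intro!: tendsto_intros)
    show "AE t in M. norm (blinfun_apply (\<eta> t) (F i t)) \<le> 2 * B * g t" for i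
    proof (rule AE_I2)
      fix t assume "t \<in> space M"
      have "g t * norm (F i t) \<le> g t * (2 * B)"
        using B[OF \<open>t \<in> space M\<close>] order.trans[OF norm_ge_zero \<eta>_le[of t]] by (intro mult_left_mono)
      then show "norm (blinfun_apply (\<eta> t) (F i t)) \<le> 2 * B * g t"
        using \<eta>_apply_le[of t "F i t"] by (simp add: ac_simps)
    qed
  qed measurable
  show ?thesis
    using LIMSEQ_unique[OF 1 2] .
qed

text \<open>A direction in which \<open>\<eta> t\<close> reaches half of its norm can be chosen
  measurably from a dense sequence, because exceeding half is an open condition. The factor 2 is the
  price; the result is used only to place the density in the conjugate space.\<close>

lemma norm_density_le:
  assumes w[measurable]: "w \<in> borel_measurable M" and w0: "\<And>t. 0 \<le> w t" and wB: "\<And>t. w t \<le> real B"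
  shows "(\<integral>t. w t * norm (\<eta> t) \<partial>M) \<le> 2 * K * (\<integral>t. (w t * h0 t) powr p \<partial>M) powr (1 / p)"
proof -
  obtain d :: "nat \<Rightarrow> 'z" where d: "\<And>x e. e > 0 \<Longrightarrow> \<exists>n. dist x (d n) < e"
    by (erule ex_dense_sequence)
  \<comment> \<open>Normalising by \<open>sgn\<close> keeps every direction in the unit ball. For
    \<open>\<eta> t = 0\<close> the condition holds trivially, so a least index exists at every
    \<open>t\<close>.\<close>
  define Q where "Q n t \<longleftrightarrow> norm (\<eta> t) / 2 \<le> blinfun_apply (\<eta> t) (sgn (d n))" for n t
  have [measurable]: "Measurable.pred M (Q n)" for n
    unfolding Q_def by measurable
  have exQ: "\<exists>n. Q n t" for t
  proof (cases "\<eta> t = 0")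
    case True
    then show ?thesis
      by (simp add: Q_def)
  next
    case False
    have "\<exists>x. norm (\<eta> t) / 2 * norm x < blinfun_apply (\<eta> t) x"
    proof (rule ccontr)
      assume "\<not> ?thesis"
      then have *: "blinfun_apply (\<eta> t) x \<le> norm (\<eta> t) / 2 * norm x" for x
        by (simp add: not_less)
      have "norm (\<eta> t) \<le> norm (\<eta> t) / 2"
      proof (rule norm_blinfun_bound)
        show "norm (blinfun_apply (\<eta> t) x) \<le> norm (\<eta> t) / 2 * norm x" for x
          using *[of x] *[of "- x"] by (simp add: abs_le_iff blinfun.minus_right)
      qed simp
      then show False
        using False by simp
    qed
    then obtain x where x: "norm (\<eta> t) / 2 * norm x < blinfun_apply (\<eta> t) x"
      by blast
    define U where "U = {x. norm (\<eta> t) / 2 * norm x < blinfun_apply (\<eta> t) x}"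
    have "open U"
      unfolding U_def by (intro open_Collect_less continuous_intros)
    moreover have "x \<in> U"
      using x by (simp add: U_def)
    ultimately obtain r where r: "r > 0" "ball x r \<subseteq> U"
      using open_contains_ball by blast
    obtain n where "dist x (d n) < r"
      using d r by blast
    then have n: "d n \<in> U"
      using r by auto
    then have "d n \<noteq> 0"
      by (auto simp: U_def)
    then have "Q n t"
      using n unfolding Q_def U_def by (simp add: sgn_div_norm blinfun.scaleR_right field_simps)
    then show ?thesis
      by blast
  qed
  define u where "u t = w t *\<^sub>R sgn (d (LEAST n. Q n t))" for t
  have [measurable]: "u \<in> borel_measurable M"
    unfolding u_def by measurable
  have u_le: "norm (u t) \<le> w t" for t
    using w0[of t] by (simp add: u_def norm_sgn)
  have u_B: "norm (u t) \<le> real B" for t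
    using u_le wB order.trans by blast
  have ge: "w t * norm (\<eta> t) / 2 \<le> blinfun_apply (\<eta> t) (u t)" for t
  proof -
    have "Q (LEAST n. Q n t) t"
      using exQ by (rule LeastI_ex[of "\<lambda>n. Q n t"])
    then have "w t * (norm (\<eta> t) / 2) \<le> w t * blinfun_apply (\<eta> t) (sgn (d (LEAST n. Q n t)))"
      using w0 unfolding Q_def by (intro mult_left_mono)
    then show ?thesis
      by (simp add: u_def blinfun.scaleR_right)
  qed
  have int: "integrable M (\<lambda>t. blinfun_apply (\<eta> t) (u t))"
    by (rule \<eta>_apply_integrable[OF _ u_B]) measurable
  have int2: "integrable M (\<lambda>t. w t * norm (\<eta> t))"
  proof (rule Bochner_Integration.integrable_bound)
    show "integrable M (\<lambda>t. 2 * blinfun_apply (\<eta> t) (u t))"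
      using int by simp
    show "AE t in M. norm (w t * norm (\<eta> t)) \<le> norm (2 * blinfun_apply (\<eta> t) (u t))"
      using ge w0 by (intro AE_I2) (smt (verit) field_sum_of_halves mult_nonneg_nonneg norm_ge_zero real_norm_def)
  qed measurable
  have hp: "integrable M (\<lambda>t. (w t * h0 t) powr p)"
  proof (rule Bochner_Integration.integrable_bound)
    show "integrable M (\<lambda>t. real B powr p * h0 t powr p)"
      using h0_int by simp
    show "AE t in M. norm ((w t * h0 t) powr p) \<le> norm (real B powr p * h0 t powr p)"
      using w0 wB p by (intro AE_I2) (auto simp: powr_mult intro!: mult_right_mono powr_mono2)
  qed measurable
  have uL: "(\<lambda>t. h0 t *\<^sub>R u t) \<in> Lp M (ennreal p)"
    by (rule Lp_dominated[OF _ hp]) (use u_le h0_pos in \<open>auto simp: abs_of_pos mult.commute mult_left_mono\<close>)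
  have "(\<integral>t. w t * norm (\<eta> t) \<partial>M) / 2 = (\<integral>t. w t * norm (\<eta> t) / 2 \<partial>M)"
    by simp
  also have "\<dots> \<le> (\<integral>t. blinfun_apply (\<eta> t) (u t) \<partial>M)"
    using int int2 ge by (intro integral_mono) auto
  also have "\<dots> = \<phi> (\<lambda>t. h0 t *\<^sub>R u t)"
    by (rule bounded_representation[OF _ u_B, symmetric]) measurable
  also have "\<dots> \<le> K * Lp_norm M p (\<lambda>t. h0 t *\<^sub>R u t)"
    using \<phi>_bound[OF uL] by simp
  also have "\<dots> \<le> K * (\<integral>t. (w t * h0 t) powr p \<partial>M) powr (1 / p)"
  proof (intro mult_left_mono K)
    have "norm (h0 t *\<^sub>R u t) \<le> w t * h0 t" for t
      using u_le[of t] h0_pos[of t] by (simp add: abs_of_pos mult.commute mult_left_mono)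
    then have "(\<integral>t. norm (h0 t *\<^sub>R u t) powr p \<partial>M) \<le> (\<integral>t. (w t * h0 t) powr p \<partial>M)"
      using uL hp p by (intro integral_mono powr_mono2) (auto simp: Lp_iff[OF p])
    then show "Lp_norm M p (\<lambda>t. h0 t *\<^sub>R u t) \<le> (\<integral>t. (w t * h0 t) powr p \<partial>M) powr (1 / p)"
      unfolding Lp_norm_def using p by (intro powr_mono2) auto
  qed
  finally show ?thesis
    by simp
qed

text \<open>Dividing \<open>\<eta>\<close> by the weight gives the density of \<open>\<phi>\<close>
  itself. The converse of Hoelder's inequality comes first: it makes the pairing with every
  \<open>a\<close> in L^p integrable, and this pairing then dominates the truncated
  integrals.\<close>

lemma representation:
  assumes refl: "reflexive TYPE('z)"
  obtains \<xi> :: "'t \<Rightarrow> 'z \<Rightarrow>\<^sub>L real" where "\<xi> \<in> Lp M (conjugate_exponent p)"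
    "\<And>a. a \<in> Lp M (ennreal p) \<Longrightarrow> \<phi> a = (\<integral>t. blinfun_apply (\<xi> t) (a t) \<partial>M)"
proof -
  define \<xi> where "\<xi> t = (1 / h0 t) *\<^sub>R \<eta> t" for t
  have \<xi>_meas[measurable]: "\<xi> \<in> borel_measurable M"
  proof -
    obtain D :: "nat \<Rightarrow> 'z \<Rightarrow>\<^sub>L real" where D: "\<And>f r. r > 0 \<Longrightarrow> \<exists>n. dist f (D n) < r"
      by (erule reflexive_imp_separable_dual[OF refl])
    show ?thesis
      by (rule borel_measurable_blinfunI[OF _ D]) (simp_all add: \<xi>_def blinfun.scaleR_left)
  qed
  have h\<xi>: "h0 t * norm (\<xi> t) = norm (\<eta> t)" for t
    using h0_pos[of t] by (simp add: \<xi>_def)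
  have "(\<lambda>t. norm (\<xi> t)) \<in> Lp M (conjugate_exponent p)"
  proof (rule converse_Holder[where K="2 * K" and ?h0.0=h0, OF p])
    show "integrable M (\<lambda>t. h0 t * norm (\<xi> t))"
      unfolding h\<xi> by (rule Bochner_Integration.integrable_bound[OF g_int])
        (use \<eta>_le in \<open>auto intro: order.trans[OF _ abs_ge_self]\<close>)
    show "(\<integral>t. w t * (h0 t * norm (\<xi> t)) \<partial>M) \<le> 2 * K * (\<integral>t. (w t * h0 t) powr p \<partial>M) powr (1 / p)"
      if "w \<in> borel_measurable M" "\<And>t. 0 \<le> w t" "\<And>t. w t \<le> real n" for w n
      unfolding h\<xi> by (rule norm_density_le[OF that])
  qed (use h0_pos h0_int in auto)
  then have \<xi>: "\<xi> \<in> Lp M (conjugate_exponent p)"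
    by (auto simp: Lp_def split: if_splits)
  have int: "integrable M (\<lambda>t. blinfun_apply (\<xi> t) (a t))" if "a \<in> Lp M (ennreal p)" for a
    using that Holder_Lp[OF p \<xi>] by blast
  have "\<phi> a = (\<integral>t. blinfun_apply (\<xi> t) (a t) \<partial>M)" if a: "a \<in> Lp M (ennreal p)" for a
  proof -
    note [measurable] = Lp_measurable[OF a]
    \<comment> \<open>\<open>b n\<close> is \<open>a\<close> divided by the weight, set to zero
      where this quotient exceeds \<open>n\<close>. Since \<open>h0 t\<close> is positive, every
      \<open>t\<close> is eventually unaffected.\<close>
    define A where "A n t \<longleftrightarrow> norm (a t) \<le> real n * h0 t" for n t
    have [measurable]: "Measurable.pred M (A n)" for n
      unfolding A_def by measurable
    define b where "b n t = (if A n t then (1 / h0 t) *\<^sub>R a t else 0)" for n t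
    have [measurable]: "b n \<in> borel_measurable M" for n
      unfolding b_def by measurable
    have b_le: "norm (b n t) \<le> real n" for n t
      using h0_pos[of t] by (auto simp: b_def A_def field_simps)
    have hb: "h0 t *\<^sub>R b n t = (if A n t then a t else 0)" for n t
      using h0_pos[of t] by (simp add: b_def)
    have \<eta>b: "blinfun_apply (\<eta> t) (b n t) = (if A n t then blinfun_apply (\<xi> t) (a t) else 0)" for n t
      using h0_pos[of t] by (simp add: b_def \<xi>_def blinfun.scaleR_right blinfun.scaleR_left)
    have ev: "\<forall>\<^sub>F n in sequentially. A n t" for t
    proof -
      obtain n0 :: nat where "norm (a t) / h0 t \<le> real n0"
        using real_arch_simple by blast
      then have n0: "norm (a t) \<le> real n0 * h0 t"
        using h0_pos[of t] by (simp add: field_simps)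
      have "A n t" if "n \<ge> n0" for n
      proof -
        have "real n0 * h0 t \<le> real n * h0 t"
          using that h0_pos[of t] by (intro mult_right_mono) auto
        then show ?thesis
          using n0 by (simp add: A_def)
      qed
      then show ?thesis
        unfolding eventually_sequentially by blast
    qed
    have ev_lim: "(\<lambda>n. if A n t then x else 0) \<longlonglongrightarrow> x" for t and x :: "'c::{zero, topological_space}"
      by (rule tendsto_eventually) (use ev[of t] in eventually_elim, simp)
    have 1: "(\<lambda>n. \<phi> (\<lambda>t. h0 t *\<^sub>R b n t)) \<longlonglongrightarrow> \<phi> a"
    proof (rule \<phi>_tendsto)
      show "integrable M (\<lambda>t. norm (a t) powr p)"
        using a by (simp add: Lp_iff[OF p])
      show "AE t in M. norm (h0 t *\<^sub>R b n t) \<le> norm (a t)" for n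
        unfolding hb by simp
      show "AE t in M. (\<lambda>n. h0 t *\<^sub>R b n t) \<longlonglongrightarrow> a t"
        unfolding hb by (intro AE_I2 ev_lim)
    qed measurable
    have 2: "(\<lambda>n. \<integral>t. blinfun_apply (\<eta> t) (b n t) \<partial>M) \<longlonglongrightarrow> (\<integral>t. blinfun_apply (\<xi> t) (a t) \<partial>M)"
    proof (rule integral_dominated_convergence)
      show "integrable M (\<lambda>t. norm (blinfun_apply (\<xi> t) (a t)))"
        using int[OF a] by simp
      show "AE t in M. norm (blinfun_apply (\<eta> t) (b n t)) \<le> norm (blinfun_apply (\<xi> t) (a t))" for n
        unfolding \<eta>b by simp
      show "AE t in M. (\<lambda>n. blinfun_apply (\<eta> t) (b n t)) \<longlonglongrightarrow> blinfun_apply (\<xi> t) (a t)"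
        unfolding \<eta>b by (intro AE_I2 ev_lim)
    qed (use borel_measurable_integrable[OF int[OF a]] in measurable)
    show ?thesis
      using LIMSEQ_unique[OF 1] 2 by (simp add: bounded_representation[OF _ b_le])
  qed
  then show ?thesis
    using that \<xi> by blast
qed

end

section \<open>Normal cones\<close>

text \<open>The root \<open>h powr (1 / p)\<close> of a positive integrable function serves as the
  weight. The absolute value of \<open>K\<close> is taken because the bound is not assumed to have a
  nonnegative constant.\<close>

lemma Lp_dual_representation:
  fixes \<phi> :: "('t \<Rightarrow> 'z::{real_normed_vector, second_countable_topology}) \<Rightarrow> real"
  assumes M: "sigma_finite_measure M" and p: "1 \<le> p" and refl: "reflexive TYPE('z)"
    and add: "\<And>f g. f \<in> Lp M (ennreal p) \<Longrightarrow> g \<in> Lp M (ennreal p) \<Longrightarrow> \<phi> (\<lambda>t. f t + g t) = \<phi> f + \<phi> g"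
    and scale: "\<And>c f. f \<in> Lp M (ennreal p) \<Longrightarrow> \<phi> (\<lambda>t. c *\<^sub>R f t) = c * \<phi> f"
    and bound: "\<And>f. f \<in> Lp M (ennreal p) \<Longrightarrow> \<bar>\<phi> f\<bar> \<le> K * Lp_norm M p f"
  obtains \<xi> :: "'t \<Rightarrow> 'z \<Rightarrow>\<^sub>L real" where "\<xi> \<in> Lp M (conjugate_exponent p)"
    "\<And>a. a \<in> Lp M (ennreal p) \<Longrightarrow> \<phi> a = (\<integral>t. blinfun_apply (\<xi> t) (a t) \<partial>M)"
proof -
  interpret sigma_finite_measure M by fact
  obtain h :: "'t \<Rightarrow> real" where h: "h \<in> borel_measurable M" "\<And>x. h x > 0" "integrable M h"
    using obtain_positive_integrable_function by metis
  have "(\<lambda>t. (h t powr (1 / p)) powr p) = h"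
    using h(2) p by (auto simp: fun_eq_iff powr_powr abs_of_pos)
  then have int: "integrable M (\<lambda>t. (h t powr (1 / p)) powr p)"
    using h(3) by simp
  have bound': "\<bar>\<phi> f\<bar> \<le> \<bar>K\<bar> * Lp_norm M p f" if "f \<in> Lp M (ennreal p)" for f
    using bound[OF that] mult_right_mono[OF abs_ge_self[of K] Lp_norm_nonneg[of M p f]] by linarith
  interpret Lp_functional M p "\<bar>K\<bar>" "\<lambda>t. h t powr (1 / p)" \<phi>
  proof unfold_locales
    show "(\<lambda>t. h t powr (1 / p)) \<in> borel_measurable M"
      using h(1) by measurable
    show "0 < h t powr (1 / p)" for t
      using h(2)[of t] by simp
  qed (use p add scale bound' int in auto)
  obtain \<eta> :: "'t \<Rightarrow> 'z \<Rightarrow>\<^sub>L real" and g where "\<eta> \<in> borel_measurable M" "integrable M g"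
    "\<And>t. norm (\<eta> t) \<le> g t"
    "\<And>E z. E \<in> sets M \<Longrightarrow> \<phi> (unit_fun E z) = (\<integral>t. indicator E t * blinfun_apply (\<eta> t) z \<partial>M)"
    by (erule ex_operator_density[OF refl])
  then interpret Lp_functional_density M p "\<bar>K\<bar>" "\<lambda>t. h t powr (1 / p)" \<phi> \<eta> g
    by unfold_locales
  show ?thesis
    using representation[OF refl] that by blast
qed

text \<open>Membership in the dual is automatic: \<open>norm \<xi> + norm \<zeta>\<close> bounds the
  pair with respect to the sum norm.\<close>

lemma clarke_normal_pairs_iff:
  fixes \<xi> :: "'a::real_normed_vector \<Rightarrow>\<^sub>L real" and \<zeta> :: "'b::real_normed_vector \<Rightarrow>\<^sub>L real"
  shows "(\<xi>, \<zeta>) \<in> clarke_normal_pairs C w \<longleftrightarrow>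
    (\<forall>v\<in>clarke_tangent_cone (prod_nspace type_nspace type_nspace) C w.
      blinfun_apply \<xi> (fst v) + blinfun_apply \<zeta> (snd v) \<le> 0)"
proof -
  have "\<bar>blinfun_apply \<xi> a + blinfun_apply \<zeta> b\<bar> \<le> (norm \<xi> + norm \<zeta>) * (norm a + norm b)" for a b
  proof -
    have "norm \<xi> * norm a \<le> (norm \<xi> + norm \<zeta>) * norm a" "norm \<zeta> * norm b \<le> (norm \<xi> + norm \<zeta>) * norm b"
      by (intro mult_right_mono; simp)+
    moreover have "\<bar>blinfun_apply \<xi> a\<bar> \<le> norm \<xi> * norm a" "\<bar>blinfun_apply \<zeta> b\<bar> \<le> norm \<zeta> * norm b"
      using norm_blinfun[of \<xi> a] norm_blinfun[of \<zeta> b] by simp_all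
    ultimately show ?thesis
      unfolding distrib_left by linarith
  qed
  then have "pair_functional (\<xi>, \<zeta>) \<in> dual_of (prod_nspace type_nspace type_nspace)"
    by (auto simp: dual_of_def pair_functional_def prod_nspace_def type_nspace_def extensional_def
      blinfun.add_right blinfun.scaleR_right algebra_simps intro!: exI[of _ "norm \<xi> + norm \<zeta>"])
  then show ?thesis
    by (auto simp: clarke_normal_pairs_def clarke_normal_cone_def pair_functional_def split_beta)
qed

text \<open>Zero is the value of the truncated selections below wherever nothing is
  selected.\<close>

lemma zero_in_clarke_tangent_cone_type_prod:
  "0 \<in> clarke_tangent_cone (prod_nspace type_nspace type_nspace) C w"
  unfolding clarke_tangent_cone_type_prod tangent_good_def by (auto intro!: exI[of _ 1])

section \<open>Localisation of the normal cone\<close>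

context closed_multifunction
begin

lemma AE_normal_pairs:
  assumes x: "x \<in> borel_measurable M"
    and \<xi>: "\<xi> \<in> Lp M (conjugate_exponent p)" and \<zeta>: "\<zeta> \<in> Lp M (conjugate_exponent r)"
    and le: "\<And>v1 v2. (v1, v2) \<in> Sel M (ennreal p) (ennreal r) (tcone x) \<Longrightarrow>
      (\<integral>t. blinfun_apply (\<xi> t) (v1 t) \<partial>M) + (\<integral>t. blinfun_apply (\<zeta> t) (v2 t) \<partial>M) \<le> 0"
  shows "AE t in M. (\<xi> t, \<zeta> t) \<in> clarke_normal_pairs (C t) (x t)"
proof -
  note [measurable] = x Lp_measurable[OF \<xi>] Lp_measurable[OF \<zeta>]
  define \<psi> where "\<psi> t w = blinfun_apply (\<xi> t) (fst w) + blinfun_apply (\<zeta> t) (snd w)" for t and w :: "'z \<times> 'y"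
  \<comment> \<open>Division by \<open>L t\<close> makes \<open>\<psi> t\<close> Lipschitz with
    constant 1, as the selection theorem demands, and does not change its sign.\<close>
  define L where "L t = 1 + norm (\<xi> t) + norm (\<zeta> t)" for t
  have L: "L t > 0" for t
    unfolding L_def by (smt (verit) norm_ge_zero)
  have [measurable]: "L \<in> borel_measurable M"
    unfolding L_def by measurable
  have \<psi>_meas[measurable (raw)]: "(\<lambda>t. \<psi> t (w t)) \<in> borel_measurable M" if "w \<in> borel_measurable M" for w
  proof -
    have "(\<lambda>t. fst (w t)) \<in> borel_measurable M" "(\<lambda>t. snd (w t)) \<in> borel_measurable M"
      using that by (rule borel_measurable_fst borel_measurable_snd)+
    then show ?thesis
      unfolding \<psi>_def
      by (intro borel_measurable_add
        borel_measurable_blinfun_apply[OF borel_measurable_blinfun_point[OF Lp_measurable[OF \<xi>]]]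
        borel_measurable_blinfun_apply[OF borel_measurable_blinfun_point[OF Lp_measurable[OF \<zeta>]]])
  qed
  have \<psi>_lip: "\<psi> t w' / L t \<le> \<psi> t w / L t + dist w w'" for t w w'
  proof -
    have dist_eq: "dist w w' = norm (fst w' - fst w, snd w' - snd w)"
      by (subst dist_commute) (simp add: dist_norm minus_prod_def)
    have "\<psi> t w' - \<psi> t w = blinfun_apply (\<xi> t) (fst w' - fst w) + blinfun_apply (\<zeta> t) (snd w' - snd w)"
      by (simp add: \<psi>_def blinfun.diff_right)
    also have "\<dots> \<le> norm (\<xi> t) * norm (fst w' - fst w) + norm (\<zeta> t) * norm (snd w' - snd w)"
      using norm_blinfun[of "\<xi> t" "fst w' - fst w"] norm_blinfun[of "\<zeta> t" "snd w' - snd w"] by simp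
    also have "\<dots> \<le> norm (\<xi> t) * dist w w' + norm (\<zeta> t) * dist w w'"
      using norm_fst_le[of "fst w' - fst w" "snd w' - snd w"] norm_snd_le[of "snd w' - snd w" "fst w' - fst w"]
      by (intro add_mono mult_left_mono) (simp_all add: dist_eq)
    also have "\<dots> \<le> L t * dist w w'"
      by (simp add: L_def algebra_simps)
    finally show ?thesis
      using L[of t] by (simp add: field_simps)
  qed
  \<comment> \<open>\<open>G 0\<close> expresses \<open>\<psi> t w > 0\<close>, and \<open>G (Suc i)\<close> tangency of \<open>w\<close> at tolerance \<open>1 / (i + 1)\<close>.\<close>
  define G where "G j k l t w = (case j of
      0 \<Rightarrow> 1 / real (Suc k) - \<psi> t w / L t
    | Suc i \<Rightarrow> case l of (n, q) \<Rightarrow>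
        if dist (castaing n t) (x t) < 1 / real (Suc k) \<and> 0 < real_of_rat q \<and> real_of_rat q < 1 / real (Suc k)
        then infdist (castaing n t + real_of_rat q *\<^sub>R w) (C t) - real_of_rat q * (1 / real (Suc i)) else 0)"
    for j k :: nat and l :: "nat \<times> rat" and t and w :: "'z \<times> 'y"
  have G_meas: "(\<lambda>t. G j k l t w) \<in> borel_measurable M" for j k l w
    unfolding G_def by (cases j; cases l; simp; measurable)
  have G_lip: "G j k l t w \<le> G j k l t w' + dist w w'" for j k l t w w'
  proof (cases j)
    case 0
    then show ?thesis
      using \<psi>_lip[of t w' w] by (simp add: G_def)
  next
    case (Suc i)
    obtain n q where l: "l = (n, q)"
      by fastforce
    show ?thesis
    proof (cases "dist (castaing n t) (x t) < 1 / real (Suc k) \<and> 0 < real_of_rat q \<and> real_of_rat q < 1 / real (Suc k)")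
      case True
      \<comment> \<open>Steps of length at most 1 keep the Lipschitz constant in \<open>w\<close> at
        most 1.\<close>
      have "1 / real (Suc k) \<le> 1"
        by simp
      then have q: "0 < real_of_rat q" "real_of_rat q \<le> 1"
        using True by linarith+
      have "dist (castaing n t + real_of_rat q *\<^sub>R w) (castaing n t + real_of_rat q *\<^sub>R w') =
          real_of_rat q * dist w w'"
        using q by (simp add: dist_norm flip: scaleR_diff_right)
      also have "\<dots> \<le> dist w w'"
        using q by (intro mult_left_le_one_le) auto
      finally show ?thesis
        using True infdist_triangle[of "castaing n t + real_of_rat q *\<^sub>R w" "C t" "castaing n t + real_of_rat q *\<^sub>R w'"]
        by (simp add: G_def Suc l)
    next
      case False
      then show ?thesis
        unfolding G_def Suc l by auto
    qed
  qed
  define bad where "bad t w \<longleftrightarrow> (\<forall>j. \<exists>k. dense_good x t w (1 / real (Suc j)) (1 / real (Suc k))) \<and> 0 < \<psi> t w" for t w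
  have G_iff: "(\<forall>j. \<exists>k. \<forall>l. G j k l t w \<le> 0) \<longleftrightarrow> bad t w" for t w
  proof -
    have "(\<exists>k. \<forall>l. G 0 k l t w \<le> 0) \<longleftrightarrow> (\<exists>k. inverse (real (Suc k)) \<le> \<psi> t w / L t)"
      by (simp add: G_def inverse_eq_divide)
    also have "\<dots> \<longleftrightarrow> 0 < \<psi> t w / L t"
      by (metis inverse_positive_iff_positive less_imp_le less_le_trans of_nat_0_less_iff reals_Archimedean zero_less_Suc)
    also have "\<dots> \<longleftrightarrow> 0 < \<psi> t w"
      using L[of t] by (simp add: zero_less_divide_iff)
    finally have 0: "(\<exists>k. \<forall>l. G 0 k l t w \<le> 0) \<longleftrightarrow> 0 < \<psi> t w" .
    have S: "(\<forall>l. G (Suc i) k l t w \<le> 0) \<longleftrightarrow> dense_good x t w (1 / real (Suc i)) (1 / real (Suc k))" for i k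
      unfolding dense_good_def G_def by (auto simp del: of_nat_Suc)
    show ?thesis
      unfolding bad_def S[symmetric] 0[symmetric] by (metis not0_implies_Suc)
  qed
  obtain v where v[measurable]: "v \<in> borel_measurable M"
    and v_sel: "AE t in M. (\<exists>w. \<forall>j. \<exists>k. \<forall>l. G j k l t w \<le> 0) \<longrightarrow> (\<forall>j. \<exists>k. \<forall>l. G j k l t (v t) \<le> 0)"
    by (rule AE_measurable_selection[of G, OF G_meas G_lip])
  have v_bad: "AE t in M. (\<exists>w. bad t w) \<longrightarrow> bad t (v t)"
    using v_sel unfolding G_iff .
  obtain h e :: "'t \<Rightarrow> real" where [measurable]: "h \<in> borel_measurable M" "e \<in> borel_measurable M" and
    h: "integrable M h" "\<And>t. 0 < h t" "\<And>t. h t \<le> 1" and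
    e: "\<And>t. 0 < e t" "\<And>t. e t powr p \<le> h t" "\<And>t. e t powr r \<le> h t"
    by (rule ex_weight) blast
  have "AE t in M. \<not> (bad t (v t) \<and> norm (v t) \<le> real n * e t)" for n
  proof -
    \<comment> \<open>A selected vector need not be integrable; the cut at \<open>n * e t\<close>
      places it in both function spaces. Every vector passes the cut for some \<open>n\<close>
      because \<open>e t\<close> is positive.\<close>
    define u where "u t = (if bad t (v t) \<and> norm (v t) \<le> real n * e t then v t else 0)" for t
    have [measurable]: "u \<in> borel_measurable M"
      unfolding u_def bad_def by measurable
    have u_le: "norm (u t) \<le> real n * e t" for t
      using e(1)[of t] by (simp add: u_def less_imp_le)
    have L: "(\<lambda>t. f (u t)) \<in> Lp M (ennreal q)"
      if "q \<ge> 1" "\<And>t. e t powr q \<le> h t" "\<And>w. norm (f w) \<le> norm w" "(\<lambda>t. f (u t)) \<in> borel_measurable M"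
      for q and f :: "'z \<times> 'y \<Rightarrow> 'c::real_normed_vector"
    proof (rule Lp_bound[OF that(1,4)])
      show "integrable M (\<lambda>t. real n powr q * h t)"
        using h(1) by simp
      show "AE t in M. norm (f (u t)) powr q \<le> real n powr q * h t"
      proof (rule AE_I2)
        fix t
        have "norm (f (u t)) powr q \<le> (real n * e t) powr q"
          using that(1) order.trans[OF that(3) u_le] by (intro powr_mono2) auto
        also have "\<dots> = real n powr q * e t powr q"
          by (rule powr_mult)
        also have "\<dots> \<le> real n powr q * h t"
          using that(2) by (intro mult_left_mono) auto
        finally show "norm (f (u t)) powr q \<le> real n powr q * h t" .
      qed
    qed
    have u1: "(\<lambda>t. fst (u t)) \<in> Lp M (ennreal p)"
      by (rule L[OF p e(2)]) (auto intro: norm_fst_le_norm borel_measurable_fst)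
    have u2: "(\<lambda>t. snd (u t)) \<in> Lp M (ennreal r)"
      by (rule L[OF r e(3)]) (auto intro: norm_snd_le_norm borel_measurable_snd)
    have "AE t in M. u t \<in> tcone x t"
      using AE_dense_good_tcone
    proof eventually_elim
      case (elim t)
      show ?case
      proof (cases "bad t (v t)")
        case True
        then have "v t \<in> tcone x t"
          using elim unfolding bad_def by blast
        then show ?thesis
          by (simp add: u_def zero_in_clarke_tangent_cone_type_prod)
      qed (simp add: u_def zero_in_clarke_tangent_cone_type_prod)
    qed
    then have "(\<lambda>t. fst (u t), \<lambda>t. snd (u t)) \<in> Sel M (ennreal p) (ennreal r) (tcone x)"
      using u1 u2 by (simp add: Sel_iff)
    from le[OF this] have le0: "(\<integral>t. blinfun_apply (\<xi> t) (fst (u t)) \<partial>M) + (\<integral>t. blinfun_apply (\<zeta> t) (snd (u t)) \<partial>M) \<le> 0" .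
    have i1: "integrable M (\<lambda>t. blinfun_apply (\<xi> t) (fst (u t)))"
      using Holder_Lp[OF p \<xi>] u1 by blast
    have i2: "integrable M (\<lambda>t. blinfun_apply (\<zeta> t) (snd (u t)))"
      using Holder_Lp[OF r \<zeta>] u2 by blast
    have \<psi>_int: "integrable M (\<lambda>t. \<psi> t (u t))"
      unfolding \<psi>_def using i1 i2 by simp
    have zero: "\<psi> t 0 = 0" for t
      by (simp add: \<psi>_def)
    have \<psi>0: "0 \<le> \<psi> t (u t)" for t
      using zero by (auto simp: u_def bad_def)
    have "(\<integral>t. \<psi> t (u t) \<partial>M) \<le> 0"
      unfolding \<psi>_def using i1 i2 le0 by simp
    moreover have "0 \<le> (\<integral>t. \<psi> t (u t) \<partial>M)"
      using \<psi>0 by simp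
    ultimately have "AE t in M. \<psi> t (u t) = 0"
      using integral_nonneg_eq_0_iff_AE[OF \<psi>_int] \<psi>0 by simp
    then show ?thesis
      by eventually_elim (auto simp: u_def bad_def)
  qed
  then have "AE t in M. \<forall>n. \<not> (bad t (v t) \<and> norm (v t) \<le> real n * e t)"
    by (intro AE_all_countable[THEN iffD2] allI)
  then show ?thesis
    using v_bad AE_dense_good_tcone
  proof eventually_elim
    case (elim t)
    obtain n :: nat where "norm (v t) / e t \<le> real n"
      using real_arch_simple by blast
    then have "norm (v t) \<le> real n * e t"
      using e(1)[of t] by (simp add: field_simps)
    then have "\<not> bad t (v t)"
      using elim(1) by blast
    then have "\<not> bad t w" for w
      using elim(2) by blast
    then have "\<psi> t w \<le> 0" if "w \<in> tcone x t" for w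
      using that elim(3) unfolding bad_def by (meson not_less)
    then show ?case
      unfolding clarke_normal_pairs_iff \<psi>_def by blast
  qed
qed

text \<open>In one direction the pointwise inequality is integrated along tangent selections. In the
  other the functional is represented by densities, and its sign on all tangent selections is
  localised by \<open>AE_normal_pairs\<close>.\<close>

theorem normal_cone_Sel:
  assumes x: "(x1, x2) \<in> SelC" and refl: "reflexive TYPE('z)" "reflexive TYPE('y)"
  shows "clarke_normal_cone (prod_nspace (Lp_nspace M p) (Lp_nspace M r)) SelC (x1, x2) =
    integral_functional M p r ` Sel M (conjugate_exponent p) (conjugate_exponent r)
      (\<lambda>t. clarke_normal_pairs (C t) (x1 t, x2 t))"
proof -
  let ?X = "prod_nspace (Lp_nspace M p :: ('t \<Rightarrow> 'z) nspace) (Lp_nspace M r :: ('t \<Rightarrow> 'y) nspace)"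
  have nspace: "points ?X = Lp M (ennreal p) \<times> Lp M (ennreal r)"
    "plus_of ?X (a, b) (a', b') = (\<lambda>t. a t + a' t, \<lambda>t. b t + b' t)"
    "scale_of ?X c (a, b) = (\<lambda>t. c *\<^sub>R a t, \<lambda>t. c *\<^sub>R b t)"
    "norm_of ?X (a, b) = Lp_norm M p a + Lp_norm M r b" for a b a' b' c
    by (simp_all add: prod_nspace_def Lp_nspace_def Lp_norm_def)
  have x12: "(\<lambda>t. (x1 t, x2 t)) \<in> borel_measurable M"
    using x by (auto simp: Sel_iff dest!: Lp_measurable)
  note T = tangent_cone_Sel[OF x]
  show ?thesis
  proof (intro subset_antisym subsetI)
    fix \<Phi> assume \<Phi>: "\<Phi> \<in> clarke_normal_cone ?X SelC (x1, x2)"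
    then have extn: "\<Phi> \<in> extensional (Lp M (ennreal p) \<times> Lp M (ennreal r))"
      and neg: "\<And>v. v \<in> Sel M (ennreal p) (ennreal r) (tcone (\<lambda>t. (x1 t, x2 t))) \<Longrightarrow> \<Phi> v \<le> 0"
      and add: "\<And>a b a' b'. a \<in> Lp M (ennreal p) \<Longrightarrow> b \<in> Lp M (ennreal r) \<Longrightarrow> a' \<in> Lp M (ennreal p) \<Longrightarrow>
        b' \<in> Lp M (ennreal r) \<Longrightarrow> \<Phi> (\<lambda>t. a t + a' t, \<lambda>t. b t + b' t) = \<Phi> (a, b) + \<Phi> (a', b')"
      and scale: "\<And>c a b. a \<in> Lp M (ennreal p) \<Longrightarrow> b \<in> Lp M (ennreal r) \<Longrightarrow>
        \<Phi> (\<lambda>t. c *\<^sub>R a t, \<lambda>t. c *\<^sub>R b t) = c * \<Phi> (a, b)"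
      unfolding clarke_normal_cone_def dual_of_def T
      by (fastforce simp: nspace)+
    obtain K where bound: "\<And>a b. a \<in> Lp M (ennreal p) \<Longrightarrow> b \<in> Lp M (ennreal r) \<Longrightarrow>
        \<bar>\<Phi> (a, b)\<bar> \<le> K * (Lp_norm M p a + Lp_norm M r b)"
      using \<Phi> unfolding clarke_normal_cone_def dual_of_def by (fastforce simp: nspace)
    have z1: "(\<lambda>t. 0 :: 'z) \<in> Lp M (ennreal p)" and z2: "(\<lambda>t. 0 :: 'y) \<in> Lp M (ennreal r)"
      by (simp_all add: Lp_iff[OF p] Lp_iff[OF r])
    have n0: "Lp_norm M p (\<lambda>t. 0 :: 'z) = 0" "Lp_norm M r (\<lambda>t. 0 :: 'y) = 0"
      by (simp_all add: Lp_norm_def)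
    \<comment> \<open>The functional is restricted to each factor in turn; with the sum norm the
      same \<open>K\<close> bounds both restrictions, and additivity recombines them.\<close>
    obtain \<xi> :: "'t \<Rightarrow> 'z \<Rightarrow>\<^sub>L real" where \<xi>: "\<xi> \<in> Lp M (conjugate_exponent p)"
      and \<Phi>\<xi>: "\<And>a. a \<in> Lp M (ennreal p) \<Longrightarrow> \<Phi> (a, \<lambda>t. 0) = (\<integral>t. blinfun_apply (\<xi> t) (a t) \<partial>M)"
    proof (rule Lp_dual_representation[OF sigma_finite_measure_axioms p refl(1), of "\<lambda>a. \<Phi> (a, \<lambda>t. 0)" K])
      show "\<Phi> (\<lambda>t. f t + g t, \<lambda>t. 0) = \<Phi> (f, \<lambda>t. 0) + \<Phi> (g, \<lambda>t. 0)"
        if "f \<in> Lp M (ennreal p)" "g \<in> Lp M (ennreal p)" for f g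
        using add[OF that(1) z2 that(2) z2] by simp
      show "\<Phi> (\<lambda>t. c *\<^sub>R f t, \<lambda>t. 0) = c * \<Phi> (f, \<lambda>t. 0)" if "f \<in> Lp M (ennreal p)" for c f
        using scale[OF that z2] by simp
      show "\<bar>\<Phi> (f, \<lambda>t. 0)\<bar> \<le> K * Lp_norm M p f" if "f \<in> Lp M (ennreal p)" for f
        using bound[OF that z2] n0 by simp
    qed blast
    obtain \<zeta> :: "'t \<Rightarrow> 'y \<Rightarrow>\<^sub>L real" where \<zeta>: "\<zeta> \<in> Lp M (conjugate_exponent r)"
      and \<Phi>\<zeta>: "\<And>b. b \<in> Lp M (ennreal r) \<Longrightarrow> \<Phi> (\<lambda>t. 0, b) = (\<integral>t. blinfun_apply (\<zeta> t) (b t) \<partial>M)"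
    proof (rule Lp_dual_representation[OF sigma_finite_measure_axioms r refl(2), of "\<lambda>b. \<Phi> (\<lambda>t. 0, b)" K])
      show "\<Phi> (\<lambda>t. 0, \<lambda>t. f t + g t) = \<Phi> (\<lambda>t. 0, f) + \<Phi> (\<lambda>t. 0, g)"
        if "f \<in> Lp M (ennreal r)" "g \<in> Lp M (ennreal r)" for f g
        using add[OF z1 that(1) z1 that(2)] by simp
      show "\<Phi> (\<lambda>t. 0, \<lambda>t. c *\<^sub>R f t) = c * \<Phi> (\<lambda>t. 0, f)" if "f \<in> Lp M (ennreal r)" for c f
        using scale[OF z1 that] by simp
      show "\<bar>\<Phi> (\<lambda>t. 0, f)\<bar> \<le> K * Lp_norm M r f" if "f \<in> Lp M (ennreal r)" for f
        using bound[OF z1 that] n0 by simp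
    qed blast
    have eq: "\<Phi> (a, b) = (\<integral>t. blinfun_apply (\<xi> t) (a t) \<partial>M) + (\<integral>t. blinfun_apply (\<zeta> t) (b t) \<partial>M)"
      if "a \<in> Lp M (ennreal p)" "b \<in> Lp M (ennreal r)" for a b
      using add[OF that(1) z2 z1 that(2)] \<Phi>\<xi>[OF that(1)] \<Phi>\<zeta>[OF that(2)] by simp
    \<comment> \<open>Both sides are extensional, so agreement on the product of the two spaces is
      equality.\<close>
    have "\<Phi> = integral_functional M p r (\<xi>, \<zeta>)"
    proof (rule extensionalityI[OF extn])
      show "integral_functional M p r (\<xi>, \<zeta>) \<in> extensional (Lp M (ennreal p) \<times> Lp M (ennreal r))"
        by (simp add: integral_functional_def)
      show "\<Phi> w = integral_functional M p r (\<xi>, \<zeta>) w" if "w \<in> Lp M (ennreal p) \<times> Lp M (ennreal r)" for w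
        using that eq by (auto simp: integral_functional_def)
    qed
    moreover have "AE t in M. (\<xi> t, \<zeta> t) \<in> clarke_normal_pairs (C t) (x1 t, x2 t)"
    proof (rule AE_normal_pairs[OF x12 \<xi> \<zeta>])
      fix v1 v2 assume v: "(v1, v2) \<in> Sel M (ennreal p) (ennreal r) (tcone (\<lambda>t. (x1 t, x2 t)))"
      then show "(\<integral>t. blinfun_apply (\<xi> t) (v1 t) \<partial>M) + (\<integral>t. blinfun_apply (\<zeta> t) (v2 t) \<partial>M) \<le> 0"
        using neg[OF v] eq[of v1 v2] by (simp add: Sel_iff)
    qed
    ultimately show "\<Phi> \<in> integral_functional M p r ` Sel M (conjugate_exponent p) (conjugate_exponent r)
        (\<lambda>t. clarke_normal_pairs (C t) (x1 t, x2 t))"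
      using \<xi> \<zeta> by (auto simp: Sel_iff intro!: image_eqI[of _ _ "(\<xi>, \<zeta>)"])
  next
    fix \<Phi> assume "\<Phi> \<in> integral_functional M p r ` Sel M (conjugate_exponent p) (conjugate_exponent r)
        (\<lambda>t. clarke_normal_pairs (C t) (x1 t, x2 t))"
    then obtain \<xi> \<zeta> where \<Phi>: "\<Phi> = integral_functional M p r (\<xi>, \<zeta>)"
      and \<xi>: "\<xi> \<in> Lp M (conjugate_exponent p)" and \<zeta>: "\<zeta> \<in> Lp M (conjugate_exponent r)"
      and normal: "AE t in M. (\<xi> t, \<zeta> t) \<in> clarke_normal_pairs (C t) (x1 t, x2 t)"
      by (auto simp: Sel_iff)
    obtain K1 where K1: "\<And>a. a \<in> Lp M (ennreal p) \<Longrightarrow> integrable M (\<lambda>t. blinfun_apply (\<xi> t) (a t))"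
      "\<And>a. a \<in> Lp M (ennreal p) \<Longrightarrow> \<bar>\<integral>t. blinfun_apply (\<xi> t) (a t) \<partial>M\<bar> \<le> K1 * Lp_norm M p a"
      using Holder_Lp[OF p \<xi>] by blast
    obtain K2 where K2: "\<And>a. a \<in> Lp M (ennreal r) \<Longrightarrow> integrable M (\<lambda>t. blinfun_apply (\<zeta> t) (a t))"
      "\<And>a. a \<in> Lp M (ennreal r) \<Longrightarrow> \<bar>\<integral>t. blinfun_apply (\<zeta> t) (a t) \<partial>M\<bar> \<le> K2 * Lp_norm M r a"
      using Holder_Lp[OF r \<zeta>] by blast
    have eq: "\<Phi> (a, b) = (\<integral>t. blinfun_apply (\<xi> t) (a t) \<partial>M) + (\<integral>t. blinfun_apply (\<zeta> t) (b t) \<partial>M)"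
      if "a \<in> Lp M (ennreal p)" "b \<in> Lp M (ennreal r)" for a b
      using that by (simp add: \<Phi> integral_functional_def)
    have bound: "\<bar>\<Phi> (a, b)\<bar> \<le> max K1 K2 * (Lp_norm M p a + Lp_norm M r b)"
      if "a \<in> Lp M (ennreal p)" "b \<in> Lp M (ennreal r)" for a b
    proof -
      have "K1 * Lp_norm M p a \<le> max K1 K2 * Lp_norm M p a" "K2 * Lp_norm M r b \<le> max K1 K2 * Lp_norm M r b"
        by (intro mult_right_mono Lp_norm_nonneg; simp)+
      then show ?thesis
        using K1(2)[OF that(1)] K2(2)[OF that(2)] unfolding eq[OF that] by (simp add: distrib_left)
    qed
    have "\<Phi> \<in> dual_of ?X"
      unfolding dual_of_def mem_Collect_eq
    proof (intro conjI)
      show "\<Phi> \<in> extensional (points ?X)"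
        by (simp add: nspace \<Phi> integral_functional_def)
      show "\<forall>u\<in>points ?X. \<forall>v\<in>points ?X. \<Phi> (plus_of ?X u v) = \<Phi> u + \<Phi> v"
        by (auto simp: nspace eq Lp_add[OF p] Lp_add[OF r] K1 K2 blinfun.add_right)
      show "\<forall>c. \<forall>u\<in>points ?X. \<Phi> (scale_of ?X c u) = c * \<Phi> u"
        by (auto simp: nspace eq Lp_scale[OF p] Lp_scale[OF r] blinfun.scaleR_right distrib_left)
      show "\<exists>K. \<forall>u\<in>points ?X. \<bar>\<Phi> u\<bar> \<le> K * norm_of ?X u"
        using bound by (intro exI[of _ "max K1 K2"]) (auto simp: nspace)
    qed
    moreover have "\<Phi> v \<le> 0" if "v \<in> Sel M (ennreal p) (ennreal r) (tcone (\<lambda>t. (x1 t, x2 t)))" for v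
    proof -
      obtain v1 v2 where v12: "v = (v1, v2)"
        by fastforce
      have v: "v = (v1, v2)" "v1 \<in> Lp M (ennreal p)" "v2 \<in> Lp M (ennreal r)"
        and vT: "AE t in M. (v1 t, v2 t) \<in> tcone (\<lambda>t. (x1 t, x2 t)) t"
        using that unfolding v12 Sel_iff by auto
      have "AE t in M. blinfun_apply (\<xi> t) (v1 t) + blinfun_apply (\<zeta> t) (v2 t) \<le> 0"
        using normal vT by eventually_elim (auto simp: clarke_normal_pairs_iff)
      then have "(\<integral>t. blinfun_apply (\<xi> t) (v1 t) + blinfun_apply (\<zeta> t) (v2 t) \<partial>M) \<le> 0"
        using integral_mono_AE[OF Bochner_Integration.integrable_add[OF K1(1)[OF v(2)] K2(1)[OF v(3)]],
          of "\<lambda>t. 0"] by simp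
      then show ?thesis
        using v eq K1(1)[OF v(2)] K2(1)[OF v(3)] by simp
    qed
    ultimately show "\<Phi> \<in> clarke_normal_cone ?X SelC (x1, x2)"
      unfolding clarke_normal_cone_def T by blast
  qed
qed

end

theorem corollary5p3:
  fixes M :: "'t measure"
    and F :: "'t \<Rightarrow> 'z::{banach, second_countable_topology} \<Rightarrow> 'y::{banach, second_countable_topology} set"
    and p r :: real
  assumes "complete_measure M" and "sigma_finite_measure M"
    and "reflexive TYPE('z)" and "reflexive TYPE('y)"
    and "1 \<le> p" and "1 \<le> r"
    and "measurable_closed_multifunction M (\<lambda>t. Gr (F t))"
  shows "Gr_nemytskii M p r F = Sel M (ennreal p) (ennreal r) (\<lambda>t. Gr (F t)) \<and>
    (\<forall>(x, y) \<in> Gr_nemytskii M p r F.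
       clarke_tangent_cone (prod_nspace (Lp_nspace M p) (Lp_nspace M r)) (Gr_nemytskii M p r F) (x, y)
         = Sel M (ennreal p) (ennreal r)
             (\<lambda>t. clarke_tangent_cone (prod_nspace type_nspace type_nspace) (Gr (F t)) (x t, y t)) \<and>
       clarke_normal_cone (prod_nspace (Lp_nspace M p) (Lp_nspace M r)) (Gr_nemytskii M p r F) (x, y)
         = integral_functional M p r `
             Sel M (conjugate_exponent p) (conjugate_exponent r)
               (\<lambda>t. clarke_normal_pairs (Gr (F t)) (x t, y t)))"
proof -
  interpret closed_multifunction M "\<lambda>t. Gr (F t)" p r
    using assms by (simp add: closed_multifunction_def closed_multifunction_axioms_def)
  \<comment> \<open>Lying in the graph almost everywhere is the defining condition of the Nemytskii
    operator, so both sides unfold to the same set.\<close>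
  have "Gr_nemytskii M p r F = SelC"
    by (auto simp: Gr_nemytskii_def nemytskii_def Sel_def Gr_def)
  then show ?thesis
    using tangent_cone_Sel normal_cone_Sel[OF _ assms(3,4)] by auto
qed

end
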